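(* Let $(G,\Pi)$ be a connected Poisson-Lie group of dimension $n$ with Lie algebra $\mathfrak{g}$, such that the dual Lie algebra $(\mathfrak{g}^*,[\cdot,\cdot]_{\mathfrak{g}^*})$ is unimodular. Let $\nu\in\wedge^n\mathfrak{g}^*$ with $\nu\neq 0$, and let $\nu^l$ be the corresponding left-invariant volume form on $G$. Let $f_0:G\to\mathbb{R}$, $f_0(g)=\det(\mathrm{Ad}^n_g)$, where $\mathrm{Ad}^n:G\times\wedge^n\mathfrak{g}\to\wedge^n\mathfrak{g}$ is the adjoint action of $G$ on $\wedge^n\mathfrak{g}$. Then the volume form $\sqrt{f_0}\,\nu^l$ is preserved by all Hamiltonian vector fields, i.e. $\mathcal{L}_{X_H^\Pi}(\sqrt{f_0}\,\nu^l)=0$ for every $H\in C^\infty(G)$.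
   Context: A Poisson structure on a manifold $M$ is a bivector field $\Pi$ with $[\Pi,\Pi]=0$ (Schouten-Nijenhuis bracket). The map $\Pi^\sharp:T^*M\to TM$ is defined by $\langle\Pi^\sharp(\alpha),\beta\rangle=\Pi(\alpha,\beta)$, and the Hamiltonian vector field of $H\in C^\infty(M)$ is $X_H^\Pi=\Pi^\sharp(\mathrm{d}H)$. A Poisson-Lie group $(G,\Pi)$ is a Lie group $G$ with a Poisson structure $\Pi$ that is multiplicative: $\Pi(gh)=(L_g)_*(\Pi(h))+(R_h)_*(\Pi(g))$ for all $g,h\in G$. Then $\Pi(e)=0$ at the identity element $e$. The differential of $\Pi$ at $e$ (intrinsic derivative) defines a linear map $\delta=\mathrm{d}_e\Pi:\mathfrak{g}\to\wedge^2\mathfrak{g}$, where $\mathfrak{g}=T_eG$, and its dual map $\delta^*=[\cdot,\cdot]_{\mathfrak{g}^*}:\wedge^2\mathfrak{g}^*\to\mathfrak{g}^*$ is a Lie bracket on $\mathfrak{g}^*$; $(\mathfrak{g}^*,[\cdot,\cdot]_{\mathfrak{g}^*})$ is called the dual Lie algebra. A finite-dimensional Lie algebra $\mathfrak{h}$ is unimodular if its modular character $\mathcal{M}_{\mathfrak{h}}\in\mathfrak{h}^*$, $\mathcal{M}_{\mathfrak{h}}(\xi)=\mathrm{Tr}(\mathrm{ad}_\xi)$, vanishes. (An orientable Poisson manifold is called unimodular if it has a volume form preserved by all Hamiltonian vector fields; it is known that a connected Poisson-Lie group $(G,\Pi)$ is unimodular in this sense if and only if $\mathfrak{g}^*$ is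 a unimodular Lie algebra.) A volume form is a nowhere vanishing form of top degree. Since $G$ is connected and $f_0(e)=1$, the function $f_0$ is everywhere positive. A vector field $X$ preserves a volume form $\Phi$ if $\mathcal{L}_X\Phi=0$. *)

theory Defs
  imports "HOL-Analysis.Analysis" "HOL-Library.Function_Algebras"
begin

section \<open>Linear algebra\<close>

text \<open>Pointwise scalar multiplication, so that spaces of multilinear maps are subspaces of a
  \<^class>\<open>real_vector\<close>. The additive structure comes from \<^theory>\<open>HOL-Library.Function_Algebras\<close>.\<close>

instantiation "fun" :: (type, real_vector) real_vector
begin

definition scaleR_fun_def: "r *\<^sub>R f = (\<lambda>x. r *\<^sub>R f x)"

instance
  by standard (simp_all add: scaleR_fun_def plus_fun_def scaleR_add_right scaleR_add_left)

end

type_synonym 'v dual = "'v \<Rightarrow>\<^sub>L real"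

definition some_basis :: "'v::real_vector set \<Rightarrow> 'v set" where
  "some_basis V = (SOME B. B \<subseteq> V \<and> independent B \<and> span B = V)"

text \<open>Trace and determinant of an endomorphism \<open>T\<close> of a finite-dimensional subspace \<open>V\<close>:
  the matrix of \<open>T\<close> has entry \<open>representation B (T b) b'\<close> in row \<open>b'\<close> and column \<open>b\<close>.\<close>

definition endo_trace :: "'v::real_vector set \<Rightarrow> ('v \<Rightarrow> 'v) \<Rightarrow> real" where
  "endo_trace V T = (let B = some_basis V in \<Sum>b\<in>B. representation B (T b) b)"

definition endo_det :: "'v::real_vector set \<Rightarrow> ('v \<Rightarrow> 'v) \<Rightarrow> real" where
  "endo_det V T = (let B = some_basis V in
     \<Sum>p | p permutes B. of_int (sign p) * (\<Prod>b\<in>B. representation B (T b) (p b)))"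

text \<open>Alternating multilinear forms whose slots are indexed by the finite type \<open>'k\<close>.
  With \<open>'v\<close> a space of dimension \<open>CARD('k)\<close> these are the top-degree forms; with the dual of
  \<open>'v\<close> in place of \<open>'v\<close> they are the top-degree multivectors.\<close>

definition alternating_forms :: "(('k::finite \<Rightarrow> 'v::real_vector) \<Rightarrow> real) set" where
  "alternating_forms = {\<omega>. (\<forall>v i. linear (\<lambda>x. \<omega> (v(i := x)))) \<and>
                            (\<forall>v i j. i \<noteq> j \<and> v i = v j \<longrightarrow> \<omega> v = 0)}"

definition pullback_covector ::
    "('v::real_normed_vector \<Rightarrow> 'w::real_normed_vector) \<Rightarrow> 'w dual \<Rightarrow> 'v dual" where
  "pullback_covector L \<alpha> = Blinfun (\<lambda>v. blinfun_apply \<alpha> (L v))"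

text \<open>The map \<open>\<Pi>\<^sup>\<sharp>\<close> at one point: \<open>\<langle>\<Pi>\<^sup>\<sharp>(\<alpha>), \<beta>\<rangle> = \<Pi>(\<alpha>, \<beta>)\<close> for all \<open>\<beta>\<close>.\<close>

definition sharp :: "('v::real_normed_vector dual \<Rightarrow> 'v dual \<Rightarrow> real) \<Rightarrow> 'v dual \<Rightarrow> 'v" where
  "sharp P \<alpha> = (THE v. \<forall>\<beta>. blinfun_apply \<beta> v = P \<alpha> \<beta>)"


section \<open>Smooth manifolds\<close>

primrec Ck_on :: "nat \<Rightarrow> ('a::real_normed_vector \<Rightarrow> 'b::real_normed_vector) \<Rightarrow> 'a set \<Rightarrow> bool" where
  "Ck_on 0 f S \<longleftrightarrow> continuous_on S f"
| "Ck_on (Suc k) f S \<longleftrightarrow>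
     f differentiable_on S \<and> (\<forall>v. Ck_on k (\<lambda>x. frechet_derivative f (at x) v) S)"

text \<open>Only used for open \<open>S\<close>.\<close>

definition smooth_on :: "'a set \<Rightarrow> ('a::real_normed_vector \<Rightarrow> 'b::real_normed_vector) \<Rightarrow> bool" where
  "smooth_on S f \<longleftrightarrow> (\<forall>k. Ck_on k f S)"

text \<open>A chart is a pair of its domain and its coordinate map; the coordinate map is only
  meaningful on the domain.\<close>

type_synonym ('m, 'e) chart = "'m set \<times> ('m \<Rightarrow> 'e)"
type_synonym ('m, 'e) atlas = "('m, 'e) chart set"

definition chart_inv :: "('m, 'e) chart \<Rightarrow> 'e \<Rightarrow> 'm" where
  "chart_inv c = inv_into (fst c) (snd c)"

definition chart_range :: "('m, 'e) chart \<Rightarrow> 'e set" where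
  "chart_range c = snd c ` fst c"

definition smooth_atlas ::
    "('m::{t2_space, second_countable_topology}, 'e::euclidean_space) atlas \<Rightarrow> bool" where
  "smooth_atlas A \<longleftrightarrow>
     (\<forall>c\<in>A. open (fst c) \<and> open (chart_range c) \<and>
             homeomorphism (fst c) (chart_range c) (snd c) (chart_inv c)) \<and>
     (\<Union>c\<in>A. fst c) = UNIV \<and>
     (\<forall>c\<in>A. \<forall>d\<in>A. smooth_on (snd c ` (fst c \<inter> fst d)) (snd d \<circ> chart_inv c))"

definition product_atlas :: "('m, 'e) atlas \<Rightarrow> ('n, 'f) atlas \<Rightarrow> ('m \<times> 'n, 'e \<times> 'f) atlas" where
  "product_atlas A B = {(fst c \<times> fst d, map_prod (snd c) (snd d)) | c d. c \<in> A \<and> d \<in> B}"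

definition smooth_map ::
    "('m::topological_space, 'e::euclidean_space) atlas \<Rightarrow>
     ('n::topological_space, 'f::euclidean_space) atlas \<Rightarrow> ('m \<Rightarrow> 'n) \<Rightarrow> bool" where
  "smooth_map A B f \<longleftrightarrow> continuous_on UNIV f \<and>
     (\<forall>c\<in>A. \<forall>d\<in>B. smooth_on (snd c ` (fst c \<inter> f -` fst d)) (snd d \<circ> f \<circ> chart_inv c))"

definition smooth_fun :: "('m, 'e::euclidean_space) atlas \<Rightarrow> ('m \<Rightarrow> real) \<Rightarrow> bool" where
  "smooth_fun A H \<longleftrightarrow> (\<forall>c\<in>A. smooth_on (chart_range c) (H \<circ> chart_inv c))"

text \<open>Tangent spaces: every point \<open>p\<close> is given a preferred chart \<open>chart_at A p\<close>, and
  \<open>T\<^sub>pM\<close> is the model space \<open>'e\<close>, a tangent vector being identified with its components in the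
  preferred chart at its base point. Hence covectors at \<open>p\<close> are elements of \<open>'e dual\<close>, and
  tensor fields are functions of \<open>p\<close> with values in tensors on \<open>'e\<close>. Since the preferred chart
  jumps from point to point, such fields have to be read in a fixed chart before they are
  differentiated; this is the purpose of the \<open>_in\<close> functions below.\<close>

definition chart_at :: "('m, 'e) atlas \<Rightarrow> 'm \<Rightarrow> ('m, 'e) chart" where
  "chart_at A p = (SOME c. c \<in> A \<and> p \<in> fst c)"

definition coord_at :: "('m, 'e) atlas \<Rightarrow> 'm \<Rightarrow> 'e" where
  "coord_at A p = snd (chart_at A p) p"

definition tangent_map ::
    "('m, 'e::real_normed_vector) atlas \<Rightarrow> ('n, 'f::real_normed_vector) atlas \<Rightarrow>
     ('m \<Rightarrow> 'n) \<Rightarrow> 'm \<Rightarrow> 'e \<Rightarrow> 'f" where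
  "tangent_map A B f p =
     frechet_derivative (snd (chart_at B (f p)) \<circ> f \<circ> chart_inv (chart_at A p)) (at (coord_at A p))"

definition differential :: "('m, 'e::real_normed_vector) atlas \<Rightarrow> ('m \<Rightarrow> real) \<Rightarrow> 'm \<Rightarrow> 'e dual" where
  "differential A H p =
     Blinfun (frechet_derivative (H \<circ> chart_inv (chart_at A p)) (at (coord_at A p)))"

text \<open>The derivative at \<open>p\<close> of the coordinate map of \<open>c\<close>, from \<open>T\<^sub>pM\<close> to the model space,
  and its inverse.\<close>

definition to_chart :: "('m, 'e::real_normed_vector) atlas \<Rightarrow> ('m, 'e) chart \<Rightarrow> 'm \<Rightarrow> 'e \<Rightarrow> 'e" where
  "to_chart A c p = frechet_derivative (snd c \<circ> chart_inv (chart_at A p)) (at (coord_at A p))"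

definition from_chart :: "('m, 'e::real_normed_vector) atlas \<Rightarrow> ('m, 'e) chart \<Rightarrow> 'm \<Rightarrow> 'e \<Rightarrow> 'e" where
  "from_chart A c p = frechet_derivative (snd (chart_at A p) \<circ> chart_inv c) (at (snd c p))"

definition vector_field_in ::
    "('m, 'e::real_normed_vector) atlas \<Rightarrow> ('m, 'e) chart \<Rightarrow> ('m \<Rightarrow> 'e) \<Rightarrow> 'e \<Rightarrow> 'e" where
  "vector_field_in A c X q = to_chart A c (chart_inv c q) (X (chart_inv c q))"

type_synonym ('m, 'k, 'e) form_field = "'m \<Rightarrow> ('k \<Rightarrow> 'e) \<Rightarrow> real"

definition form_in ::
    "('m, 'e::real_normed_vector) atlas \<Rightarrow> ('m, 'e) chart \<Rightarrow>
     ('m, 'k, 'e) form_field \<Rightarrow> 'e \<Rightarrow> ('k \<Rightarrow> 'e) \<Rightarrow> real" where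
  "form_in A c \<omega> q v = \<omega> (chart_inv c q) (\<lambda>i. from_chart A c (chart_inv c q) (v i))"

type_synonym ('m, 'e) bivector_field = "'m \<Rightarrow> 'e dual \<Rightarrow> 'e dual \<Rightarrow> real"

definition bivector_in ::
    "('m, 'e::real_normed_vector) atlas \<Rightarrow> ('m, 'e) chart \<Rightarrow>
     ('m, 'e) bivector_field \<Rightarrow> 'e \<Rightarrow> 'e dual \<Rightarrow> 'e dual \<Rightarrow> real" where
  "bivector_in A c P q \<alpha> \<beta> =
     P (chart_inv c q) (pullback_covector (to_chart A c (chart_inv c q)) \<alpha>)
                       (pullback_covector (to_chart A c (chart_inv c q)) \<beta>)"


section \<open>Volume forms and the Lie derivative\<close>

definition volume_form ::
    "('m, real^'n) atlas \<Rightarrow> ('m, 'n::finite, real^'n) form_field \<Rightarrow> bool" where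
  "volume_form A \<omega> \<longleftrightarrow>
     (\<forall>p. \<omega> p \<in> alternating_forms \<and> \<omega> p \<noteq> 0) \<and>
     (\<forall>c\<in>A. \<forall>v. smooth_on (chart_range c) (\<lambda>q. form_in A c \<omega> q v))"

text \<open>The formula \<open>(L\<^sub>X\<omega>)(Y\<^sub>1,\<dots>,Y\<^sub>k) = X(\<omega>(Y\<^sub>1,\<dots>,Y\<^sub>k)) - (\<Sum>i. \<omega>(Y\<^sub>1,\<dots>,[X,Y\<^sub>i],\<dots>,Y\<^sub>k))\<close>, evaluated at
  \<open>p\<close> on vector fields \<open>Y\<^sub>i\<close> with constant components \<open>v i\<close> in the preferred chart at \<open>p\<close>, for
  which \<open>[X,Y\<^sub>i] = - DX(v i)\<close>.\<close>

definition lie_derivative ::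
    "('m, 'e::real_normed_vector) atlas \<Rightarrow> ('m \<Rightarrow> 'e) \<Rightarrow>
     ('m, 'k::finite, 'e) form_field \<Rightarrow> ('m, 'k, 'e) form_field" where
  "lie_derivative A X \<omega> p v =
     (let c = chart_at A p; x = coord_at A p;
          X' = vector_field_in A c X; \<omega>' = form_in A c \<omega>
      in frechet_derivative (\<lambda>q. \<omega>' q v) (at x) (X' x) +
         (\<Sum>i\<in>UNIV. \<omega>' x (v(i := frechet_derivative X' (at x) (v i)))))"


section \<open>Poisson structures\<close>

definition bivector_field ::
    "('m, 'e::euclidean_space) atlas \<Rightarrow> ('m, 'e) bivector_field \<Rightarrow> bool" where
  "bivector_field A P \<longleftrightarrow>
     (\<forall>p. bilinear (P p) \<and> (\<forall>\<alpha>. P p \<alpha> \<alpha> = 0)) \<and>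
     (\<forall>c\<in>A. \<forall>\<alpha> \<beta>. smooth_on (chart_range c) (\<lambda>q. bivector_in A c P q \<alpha> \<beta>))"

text \<open>The Schouten-Nijenhuis bracket of two bivector fields, a trivector field. In coordinates
  it is the standard formula
  \<open>[P,Q]\<^sup>i\<^sup>j\<^sup>k = (\<Sum>l. P\<^sup>i\<^sup>l \<partial>\<^sub>l Q\<^sup>j\<^sup>k + Q\<^sup>i\<^sup>l \<partial>\<^sub>l P\<^sup>j\<^sup>k) + cyclic permutations of (i,j,k)\<close>,
  where \<open>\<Sum>l. P\<^sup>i\<^sup>l \<partial>\<^sub>l\<close> is the derivative along \<open>P\<^sup>\<sharp>(dx\<^sup>i)\<close>.\<close>

definition schouten_bracket ::
    "('m, 'e::euclidean_space) atlas \<Rightarrow> ('m, 'e) bivector_field \<Rightarrow> ('m, 'e) bivector_field \<Rightarrow>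
     'm \<Rightarrow> 'e dual \<Rightarrow> 'e dual \<Rightarrow> 'e dual \<Rightarrow> real" where
  "schouten_bracket A P Q p \<alpha> \<beta> \<gamma> =
     (let c = chart_at A p; x = coord_at A p;
          P' = bivector_in A c P; Q' = bivector_in A c Q;
          t = (\<lambda>\<xi> \<eta> \<zeta>. frechet_derivative (\<lambda>q. Q' q \<eta> \<zeta>) (at x) (sharp (P' x) \<xi>) +
                        frechet_derivative (\<lambda>q. P' q \<eta> \<zeta>) (at x) (sharp (Q' x) \<xi>))
      in t \<alpha> \<beta> \<gamma> + t \<beta> \<gamma> \<alpha> + t \<gamma> \<alpha> \<beta>)"

definition poisson_structure ::
    "('m, 'e::euclidean_space) atlas \<Rightarrow> ('m, 'e) bivector_field \<Rightarrow> bool" where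
  "poisson_structure A P \<longleftrightarrow>
     bivector_field A P \<and> (\<forall>p \<alpha> \<beta> \<gamma>. schouten_bracket A P P p \<alpha> \<beta> \<gamma> = 0)"

definition hamiltonian_vector_field ::
    "('m, 'e::real_normed_vector) atlas \<Rightarrow> ('m, 'e) bivector_field \<Rightarrow> ('m \<Rightarrow> real) \<Rightarrow> 'm \<Rightarrow> 'e" where
  "hamiltonian_vector_field A P H p = sharp (P p) (differential A H p)"


section \<open>Poisson-Lie groups\<close>

definition lie_group ::
    "('g::{t2_space, second_countable_topology}, 'e::euclidean_space) atlas \<Rightarrow>
     ('g \<Rightarrow> 'g \<Rightarrow> 'g) \<Rightarrow> 'g \<Rightarrow> ('g \<Rightarrow> 'g) \<Rightarrow> bool" where
  "lie_group A mul one invs \<longleftrightarrow>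
     smooth_atlas A \<and> Groups.group mul one invs \<and>
     smooth_map (product_atlas A A) A (\<lambda>(g, h). mul g h) \<and> smooth_map A A invs"

text \<open>The condition is \<open>\<Pi>(gh) = (L\<^sub>g)\<^sub>*(\<Pi>(h)) + (R\<^sub>h)\<^sub>*(\<Pi>(g))\<close>.\<close>

definition multiplicative_bivector ::
    "('g, 'e::euclidean_space) atlas \<Rightarrow> ('g \<Rightarrow> 'g \<Rightarrow> 'g) \<Rightarrow> ('g, 'e) bivector_field \<Rightarrow> bool" where
  "multiplicative_bivector A mul P \<longleftrightarrow>
     (\<forall>g h \<alpha> \<beta>. P (mul g h) \<alpha> \<beta> =
        P h (pullback_covector (tangent_map A A (\<lambda>x. mul g x) h) \<alpha>)
            (pullback_covector (tangent_map A A (\<lambda>x. mul g x) h) \<beta>) +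
        P g (pullback_covector (tangent_map A A (\<lambda>x. mul x h) g) \<alpha>)
            (pullback_covector (tangent_map A A (\<lambda>x. mul x h) g) \<beta>))"

definition poisson_lie_group ::
    "('g::{t2_space, second_countable_topology}, 'e::euclidean_space) atlas \<Rightarrow>
     ('g \<Rightarrow> 'g \<Rightarrow> 'g) \<Rightarrow> 'g \<Rightarrow> ('g \<Rightarrow> 'g) \<Rightarrow> ('g, 'e) bivector_field \<Rightarrow> bool" where
  "poisson_lie_group A mul one invs P \<longleftrightarrow>
     lie_group A mul one invs \<and> poisson_structure A P \<and> multiplicative_bivector A mul P"

text \<open>The intrinsic derivative \<open>\<delta> = d\<^sub>eP\<close> of a bivector field vanishing at \<open>e\<close>: the derivative of
  its expression in any chart at \<open>e\<close>. The Lie algebra \<open>T\<^sub>eG\<close> is the model space \<open>'e\<close>.\<close>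

definition cobracket ::
    "('g, 'e::euclidean_space) atlas \<Rightarrow> 'g \<Rightarrow> ('g, 'e) bivector_field \<Rightarrow>
     'e \<Rightarrow> 'e dual \<Rightarrow> 'e dual \<Rightarrow> real" where
  "cobracket A one P x \<xi> \<eta> =
     frechet_derivative (\<lambda>q. bivector_in A (chart_at A one) P q \<xi> \<eta>) (at (coord_at A one)) x"

definition dual_bracket ::
    "('g, 'e::euclidean_space) atlas \<Rightarrow> 'g \<Rightarrow> ('g, 'e) bivector_field \<Rightarrow>
     'e dual \<Rightarrow> 'e dual \<Rightarrow> 'e dual" where
  "dual_bracket A one P \<xi> \<eta> = Blinfun (\<lambda>x. cobracket A one P x \<xi> \<eta>)"

definition modular_character :: "('h::real_vector \<Rightarrow> 'h \<Rightarrow> 'h) \<Rightarrow> 'h \<Rightarrow> real" where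
  "modular_character br \<xi> = endo_trace UNIV (br \<xi>)"

definition unimodular :: "('h::real_vector \<Rightarrow> 'h \<Rightarrow> 'h) \<Rightarrow> bool" where
  "unimodular br \<longleftrightarrow> (\<forall>\<xi>. modular_character br \<xi> = 0)"

definition Ad ::
    "('g, 'e::euclidean_space) atlas \<Rightarrow> ('g \<Rightarrow> 'g \<Rightarrow> 'g) \<Rightarrow> 'g \<Rightarrow> ('g \<Rightarrow> 'g) \<Rightarrow> 'g \<Rightarrow> 'e \<Rightarrow> 'e" where
  "Ad A mul one invs g = tangent_map A A (\<lambda>h. mul (mul g h) (invs g)) one"

text \<open>The adjoint action on top-degree multivectors, characterised on decomposables by
  \<open>x\<^sub>1 \<and> \<dots> \<and> x\<^sub>n \<mapsto> Ad\<^sub>g x\<^sub>1 \<and> \<dots> \<and> Ad\<^sub>g x\<^sub>n\<close>.\<close>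

definition Ad_top ::
    "('g, real^'n) atlas \<Rightarrow> ('g \<Rightarrow> 'g \<Rightarrow> 'g) \<Rightarrow> 'g \<Rightarrow> ('g \<Rightarrow> 'g) \<Rightarrow> 'g \<Rightarrow>
     (('n::finite \<Rightarrow> (real^'n) dual) \<Rightarrow> real) \<Rightarrow> (('n \<Rightarrow> (real^'n) dual) \<Rightarrow> real)" where
  "Ad_top A mul one invs g w = (\<lambda>\<alpha>. w (\<lambda>i. pullback_covector (Ad A mul one invs g) (\<alpha> i)))"

definition det_Ad_top ::
    "('g, real^'n) atlas \<Rightarrow> ('g \<Rightarrow> 'g \<Rightarrow> 'g) \<Rightarrow> 'g \<Rightarrow> ('g \<Rightarrow> 'g) \<Rightarrow> 'g \<Rightarrow> real" where
  "det_Ad_top A mul one invs g =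
     endo_det (alternating_forms :: (('n::finite \<Rightarrow> (real^'n) dual) \<Rightarrow> real) set)
       (Ad_top A mul one invs g)"

definition left_invariant_form ::
    "('g, 'e::euclidean_space) atlas \<Rightarrow> ('g \<Rightarrow> 'g \<Rightarrow> 'g) \<Rightarrow> ('g \<Rightarrow> 'g) \<Rightarrow>
     (('k \<Rightarrow> 'e) \<Rightarrow> real) \<Rightarrow> ('g, 'k, 'e) form_field" where
  "left_invariant_form A mul invs \<nu> g v =
     \<nu> (\<lambda>i. tangent_map A A (\<lambda>x. mul (invs g) x) g (v i))"

end

theory Submission
  imports Defs
begin

text \<open>
  Write \<open>\<Phi> = \<surd>f\<^sub>0 \<nu>\<^sup>l\<close>. The form \<open>f\<^sub>0 \<nu>\<^sup>l\<close> is the right-invariant form \<open>\<nu>\<^sup>r\<close> with value \<open>\<nu>\<close> at \<open>e\<close>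
  (\<open>right_form_eq\<close>), so \<open>\<Phi>\<close> is the geometric mean of \<open>\<nu>\<^sup>l\<close> and \<open>\<nu>\<^sup>r\<close>. It is therefore multiplied by a
  constant under left and under right translations, and by \<open>(-1)\<^sup>n\<close> under inversion
  (\<open>mean_form_L\<close>, \<open>mean_form_R\<close>, \<open>mean_form_invs\<close>). For a diffeomorphism \<open>\<phi>\<close> that multiplies \<open>\<Phi>\<close> by a
  constant, the Lie derivative of \<open>\<Phi>\<close> along a pushed-forward field \<open>\<phi>\<^sub>*X\<close> at \<open>\<phi>(p)\<close> is, up to this constant,
  the one along \<open>X\<close> at \<open>p\<close> (\<open>lie_derivative_natural\<close>).

  Fix \<open>g\<close> and let \<open>\<sigma>(x) = g x\<^sup>-\<^sup>1 g\<close>. The inversion maps \<open>\<Pi>\<close> to \<open>-\<Pi>\<close> (\<open>push_invs\<close>), and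
  two further uses of multiplicativity give
  \<open>\<Pi> = (L\<^sub>g)\<^sub>*\<Pi> + (R\<^sub>g)\<^sub>*\<Pi> + \<sigma>\<^sub>*\<Pi>\<close> (\<open>P_decomposition\<close>). Hence \<open>X\<^sub>H\<close> is the sum of the push-forwards of
  \<open>X\<^sub>K\<close> under \<open>\<phi>\<close> for \<open>K = H \<circ> \<phi>\<close>, where \<open>\<phi>\<close> runs through \<open>L\<^sub>g\<close>, \<open>R\<^sub>g\<close> and \<open>\<sigma>\<close>. Take the Lie derivative of
  \<open>\<Phi>\<close> at \<open>g\<close>.

  \<^item> \<open>L\<^sub>g\<close> and \<open>R\<^sub>g\<close> map \<open>e\<close> to \<open>g\<close>, so their terms are computed at \<open>e\<close>. There \<open>\<Pi>\<close> vanishes, and the Lie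
    derivative of \<open>\<Phi>\<close> is the trace of the linearised Hamiltonian field times \<open>\<Phi>\<close>. This trace is the
    modular character of the dual Lie algebra at \<open>d\<^sub>eK\<close>, which is zero (\<open>lie_derivative_at_one\<close>).
  \<^item> \<open>\<sigma>\<close> fixes \<open>g\<close> and has derivative \<open>-1\<close> there, so its term is the Lie derivative at \<open>g\<close> for \<open>H \<circ> \<sigma>\<close>.

  So \<open>H\<close> and \<open>H \<circ> \<sigma>\<close> give the same Lie derivative of \<open>\<Phi>\<close> at \<open>g\<close>. On the other hand \<open>H + H \<circ> \<sigma>\<close> is
  critical at \<open>g\<close>, and for a critical point the Lie derivative is the trace of the product of the
  antisymmetric \<open>\<Pi>(g)\<close> with the symmetric Hessian, that is, zero (\<open>lie_derivative_ham_critical\<close>).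
  Both Lie derivatives are therefore zero.

  That \<open>\<Phi>\<close> is a volume form is a matter of smoothness and sign: in a chart, \<open>f\<^sub>0\<close> is the quotient of the
  coefficients of \<open>\<nu>\<^sup>r\<close> and \<open>\<nu>\<^sup>l\<close>, and these are partial derivatives of the multiplication
  (\<open>translation_derivative_smooth\<close>); connectedness makes \<open>f\<^sub>0\<close> positive.
\<close>

section \<open>Alternating forms, covectors, traces and determinants\<close>

lemma alternating_form_linear:
  assumes "\<omega> \<in> alternating_forms"
  shows "linear (\<lambda>x. \<omega> (v(i := x)))"
  using assms by (simp add: alternating_forms_def)

lemma alternating_form_eq_0:
  assumes "\<omega> \<in> alternating_forms" "i \<noteq> j" "v i = v j"
  shows "\<omega> v = 0"
  using assms unfolding alternating_forms_def by blast

lemma alternating_form_swap: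
  assumes \<omega>: "\<omega> \<in> alternating_forms" and "i \<noteq> j"
  shows "\<omega> (v(i := x, j := y)) = - \<omega> (v(i := y, j := x))"
proof -
  let ?f = "\<lambda>a b. \<omega> (v(i := a, j := b))"
  have lin_j: "?f a (b + c) = ?f a b + ?f a c" for a b c
    using linear_add[OF alternating_form_linear[OF \<omega>, of "v(i := a)" j]] by simp
  have lin_i: "?f (a + b) c = ?f a c + ?f b c" for a b c
    using linear_add[OF alternating_form_linear[OF \<omega>, of "v(j := c)" i]] \<open>i \<noteq> j\<close>
    by (simp add: fun_upd_twist)
  have diag: "?f a a = 0" for a
    using \<open>i \<noteq> j\<close> by (intro alternating_form_eq_0[OF \<omega> \<open>i \<noteq> j\<close>]) simp
  have "0 = ?f (x + y) (x + y)"
    by (simp only: diag)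
  also have "\<dots> = ?f x y + ?f y x"
    using lin_i[of x y x] lin_i[of x y y] lin_j[of "x + y" x y] diag[of x] diag[of y] by linarith
  finally show ?thesis
    by linarith
qed

lemma alternating_form_compose_linear:
  fixes \<omega> :: "('k::finite \<Rightarrow> 'w::real_vector) \<Rightarrow> real" and L :: "'v::real_vector \<Rightarrow> 'w"
  assumes \<omega>: "\<omega> \<in> alternating_forms" and L: "linear L"
  shows "(\<lambda>v. \<omega> (\<lambda>i. L (v i))) \<in> alternating_forms"
  unfolding alternating_forms_def mem_Collect_eq
proof (intro conjI allI impI)
  fix v :: "'k \<Rightarrow> 'v" and k
  have "(\<lambda>i. L ((v(k := x)) i)) = (\<lambda>i. L (v i))(k := L x)" for x
    by auto
  then show "linear (\<lambda>x. \<omega> (\<lambda>i. L ((v(k := x)) i)))"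
    using linear_compose[OF L alternating_form_linear[OF \<omega>, of "\<lambda>i. L (v i)" k]] by (simp add: o_def)
next
  fix v :: "'k \<Rightarrow> 'v" and i j
  assume "i \<noteq> j \<and> v i = v j"
  then show "\<omega> (\<lambda>i. L (v i)) = 0"
    by (intro alternating_form_eq_0[OF \<omega>, of i j]) auto
qed

lemma alternating_form_scale:
  assumes \<omega>: "\<omega> \<in> alternating_forms"
  shows "\<omega> (\<lambda>i. c i *\<^sub>R v i) = (\<Prod>i\<in>UNIV. c i) * \<omega> v"
proof -
  have "\<omega> (\<lambda>i. if i \<in> S then c i *\<^sub>R v i else v i) = (\<Prod>i\<in>S. c i) * \<omega> v" if "finite S" for S
    using that
  proof induction
    case (insert j S)
    let ?w = "\<lambda>i. if i \<in> S then c i *\<^sub>R v i else v i"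
    have "\<omega> (\<lambda>i. if i \<in> insert j S then c i *\<^sub>R v i else v i) = \<omega> (?w(j := c j *\<^sub>R ?w j))"
      using insert by (intro arg_cong[of _ _ \<omega>]) (auto simp: fun_eq_iff)
    also have "\<dots> = c j * \<omega> ?w"
      using linear_scale[OF alternating_form_linear[OF \<omega>, of ?w j], of "c j" "?w j"]
        fun_upd_triv[of ?w j] by simp
    finally show ?case
      using insert by simp
  qed simp
  from this[of UNIV] show ?thesis
    by simp
qed

text \<open>Adding a multiple of a row to another row changes neither side, and exchanging two columns
  changes the sign of both. These operations reduce every matrix to a diagonal one or to one with a
  zero row, where multilinearity applies.\<close>

lemma alternating_form_eq_det:
  fixes \<omega> :: "('n::finite \<Rightarrow> real^'n) \<Rightarrow> real"
  assumes "\<omega> \<in> alternating_forms"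
  shows "\<omega> v = det (\<chi> i. v i) * \<omega> (\<lambda>i. axis i 1)"
proof -
  have "\<omega> (\<lambda>i. row i M) = det M * \<omega> (\<lambda>i. axis i 1)" if "\<omega> \<in> alternating_forms"
    for M :: "real^'n^'n" and \<omega>
    using that
  proof (induction M arbitrary: \<omega> rule: induct_matrix_row_operations[case_names zero_row diagonal swap_cols row_op])
    case (zero_row M i)
    have "\<omega> ((\<lambda>i. row i M)(i := 0)) = 0"
      using linear_0[OF alternating_form_linear[OF zero_row(2)]] .
    moreover have "(\<lambda>i. row i M)(i := 0) = (\<lambda>i. row i M)"
      using zero_row(1) by auto
    ultimately show ?case
      using zero_row(1) by (simp add: det_zero_row)
  next
    case (diagonal M)
    have "row i M = M$i$i *\<^sub>R axis i 1" for i
      using diagonal(1)[of i] by (auto simp: row_def vec_eq_iff axis_def)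
    then show ?case
      using alternating_form_scale[OF diagonal(2)] diagonal(1) by (simp add: det_diagonal)
  next
    case (swap_cols M m n)
    let ?t = "Transposition.transpose m n"
    \<comment> \<open>Exchanging coordinates in all arguments gives another form, to which the hypothesis applies.\<close>
    define \<omega>' where "\<omega>' w = \<omega> (\<lambda>i. \<chi> j. w i $ ?t j)" for w :: "'n \<Rightarrow> real^'n"
    have perm_linear: "linear (\<lambda>x::real^'n. \<chi> j. x $ ?t j)"
      by (rule linearI) (simp_all add: vec_eq_iff)
    have "\<omega>' \<in> alternating_forms"
      unfolding \<omega>'_def by (rule alternating_form_compose_linear[OF swap_cols(3) perm_linear])
    then have "\<omega>' (\<lambda>i. row i M) = det M * \<omega>' (\<lambda>i. axis i 1)"
      by (rule swap_cols.IH)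
    moreover have "\<omega>' (\<lambda>i. row i M) = \<omega> (\<lambda>i. row i (\<chi> i j. M $ i $ ?t j))"
      by (simp add: \<omega>'_def row_def)
    moreover have "\<omega>' (\<lambda>i. axis i 1) = - \<omega> (\<lambda>i. axis i 1)"
    proof -
      let ?a = "\<lambda>i. axis i (1::real)"
      have "(\<chi> j. axis i (1::real) $ ?t j) = axis (?t i) 1" for i
        by (auto simp: vec_eq_iff axis_def transpose_eq_iff)
      then have "\<omega>' ?a = \<omega> (\<lambda>i. ?a (?t i))"
        by (simp add: \<omega>'_def)
      also have "(\<lambda>i. ?a (?t i)) = ?a(m := ?a n, n := ?a m)"
        by (auto simp: fun_eq_iff Transposition.transpose_def)
      also have "\<omega> \<dots> = - \<omega> (?a(m := ?a m, n := ?a n))"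
        by (rule alternating_form_swap[OF swap_cols(3,2)])
      finally show ?thesis
        using fun_upd_triv[of ?a m] fun_upd_triv[of ?a n] by simp
    qed
    moreover have "det (\<chi> i j. M $ i $ ?t j) = - det M"
      using det_permute_columns[OF permutes_swap_id[of m UNIV n], of M] swap_cols(2)
      by (simp add: sign_swap_id)
    ultimately show ?case
      by simp
  next
    case (row_op M m n c)
    let ?r = "\<lambda>i. row i M"
    have "\<omega> (?r(m := row m M + c *\<^sub>R row n M)) = \<omega> (?r(m := row m M)) + c * \<omega> (?r(m := row n M))"
      using linear_add[OF alternating_form_linear[OF row_op(3)], of ?r m "row m M" "c *\<^sub>R row n M"]
        linear_scale[OF alternating_form_linear[OF row_op(3)], of ?r m c "row n M"]
      unfolding real_scaleR_def by linarith
    moreover have "\<omega> (?r(m := row n M)) = 0"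
      using row_op(2) by (intro alternating_form_eq_0[OF row_op(3,2)]) simp
    moreover have "(\<lambda>i. row i (\<chi> i. if i = m then row m M + c *\<^sub>R row n M else row i M))
        = ?r(m := row m M + c *\<^sub>R row n M)"
      by (auto simp: fun_eq_iff row_def)
    moreover have "?r(m := row m M) = ?r"
      by auto
    moreover have "det (\<chi> i. if i = m then row m M + c *\<^sub>R row n M else row i M) = det M"
      using det_row_operation[OF row_op(2), of M c] unfolding scalar_mult_eq_scaleR .
    ultimately show ?case
      using row_op(1)[OF row_op(3)] by simp
  qed
  from this[OF assms, of "\<chi> i. v i"] show ?thesis
    by (simp add: row_def)
qed

lemma alternating_form_linear_image:
  fixes \<omega> :: "('n::finite \<Rightarrow> real^'n) \<Rightarrow> real"
  assumes \<omega>: "\<omega> \<in> alternating_forms" and L: "linear L"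
  shows "\<omega> (\<lambda>i. L (v i)) = det (matrix L) * \<omega> v"
proof -
  have "(\<chi> i. L (v i)) = (\<chi> i. v i) ** Finite_Cartesian_Product.transpose (matrix L)"
    using matrix_works[OF L[unfolded linear_matrix_vector_mul_eq[symmetric]], symmetric]
    by (simp add: vec_eq_iff matrix_matrix_mult_def matrix_vector_mult_def mult.commute
        Finite_Cartesian_Product.transpose_def)
  then show ?thesis
    by (subst (1 2) alternating_form_eq_det[OF \<omega>]) (simp add: det_mul)
qed

lemma alternating_form_uminus:
  fixes \<omega> :: "('n::finite \<Rightarrow> real^'n) \<Rightarrow> real"
  assumes \<omega>: "\<omega> \<in> alternating_forms"
  shows "\<omega> (\<lambda>i. - v i) = (- 1) ^ CARD('n) * \<omega> v"
  using alternating_form_scale[OF \<omega>, of "\<lambda>_. - 1" v] by simp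

text \<open>The derivation of the exterior algebra that extends \<open>T\<close> acts on the top degree as the
  trace: it is alternating again, so it suffices to evaluate it on the standard basis.\<close>

lemma alternating_form_trace:
  fixes \<omega> :: "('n::finite \<Rightarrow> real^'n) \<Rightarrow> real"
  assumes \<omega>: "\<omega> \<in> alternating_forms" and T: "linear T"
  shows "(\<Sum>i\<in>UNIV. \<omega> (v(i := T (v i)))) = (\<Sum>i\<in>UNIV. T (axis i 1) $ i) * \<omega> v"
proof -
  define \<tau> where "\<tau> v = (\<Sum>i\<in>UNIV. \<omega> (v(i := T (v i))))" for v
  have "\<tau> \<in> alternating_forms"
    unfolding alternating_forms_def mem_Collect_eq
  proof (intro conjI allI impI)
    fix w :: "'n \<Rightarrow> real^'n" and k
    have "linear (\<lambda>x. \<omega> ((w(k := x))(i := T ((w(k := x)) i))))" for i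
    proof (cases "i = k")
      case True
      then show ?thesis
        using linear_compose[OF T alternating_form_linear[OF \<omega>, of w k]] by (simp add: o_def)
    next
      case False
      then have "(w(k := x))(i := T ((w(k := x)) i)) = (w(i := T (w i)))(k := x)" for x
        by (auto simp: fun_eq_iff)
      then show ?thesis
        using alternating_form_linear[OF \<omega>, of "w(i := T (w i))" k] by simp
    qed
    then show "linear (\<lambda>x. \<tau> (w(k := x)))"
      unfolding \<tau>_def by (intro linear_compose_sum) auto
  next
    fix w :: "'n \<Rightarrow> real^'n" and k l :: 'n
    assume kl: "k \<noteq> l \<and> w k = w l"
    have "\<omega> (w(i := T (w i))) = 0" if "i \<in> UNIV - {k, l}" for i
      using that kl by (intro alternating_form_eq_0[OF \<omega>, of k l]) auto
    then have "\<tau> w = (\<Sum>i\<in>{k, l}. \<omega> (w(i := T (w i))))"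
      unfolding \<tau>_def by (intro sum.mono_neutral_right) auto
    also have "\<dots> = \<omega> (w(k := T (w k), l := w k)) + \<omega> (w(k := w k, l := T (w k)))"
    proof -
      have "w(k := T (w k), l := w k) = w(k := T (w k))" "w(k := w k, l := T (w k)) = w(l := T (w l))"
        using kl by (auto simp: fun_eq_iff)
      then show ?thesis
        using kl by (simp only: sum.insert sum.empty finite.intros) simp
    qed
    also have "\<dots> = 0"
      using alternating_form_swap[OF \<omega>, of k l w "T (w k)" "w k"] kl by linarith
    finally show "\<tau> w = 0" .
  qed
  moreover have "\<tau> (\<lambda>i. axis i 1) = (\<Sum>i\<in>UNIV. T (axis i 1) $ i) * \<omega> (\<lambda>i. axis i 1)"
  proof -
    let ?a = "\<lambda>i. axis i (1::real)"
    have "\<omega> (?a(i := T (?a i))) = T (?a i) $ i * \<omega> ?a" for i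
    proof -
      note lin = alternating_form_linear[OF \<omega>, of ?a i]
      have "\<omega> (?a(i := T (?a i))) = \<omega> (?a(i := (\<Sum>j\<in>UNIV. T (?a i) $ j *\<^sub>R ?a j)))"
        using basis_expansion[of "T (?a i)"] by (simp add: scalar_mult_eq_scaleR)
      also have "\<dots> = (\<Sum>j\<in>UNIV. T (?a i) $ j * \<omega> (?a(i := ?a j)))"
        using linear_sum[OF lin, of "\<lambda>j. T (?a i) $ j *\<^sub>R ?a j" UNIV]
        by (simp add: linear_scale[OF lin])
      also have "\<dots> = (\<Sum>j\<in>{i}. T (?a i) $ j * \<omega> (?a(i := ?a j)))"
      proof (rule sum.mono_neutral_right)
        show "\<forall>j\<in>UNIV - {i}. T (?a i) $ j * \<omega> (?a(i := ?a j)) = 0"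
          by (auto intro!: alternating_form_eq_0[OF \<omega>])
      qed auto
      finally show ?thesis
        using fun_upd_triv[of ?a i] by simp
    qed
    then show ?thesis
      by (simp add: \<tau>_def sum_distrib_right)
  qed
  ultimately have "\<tau> v = (\<Sum>i\<in>UNIV. T (axis i 1) $ i) * \<omega> v"
    using alternating_form_eq_det[of \<tau> v] alternating_form_eq_det[OF \<omega>, of v] by simp
  then show ?thesis
    by (simp add: \<tau>_def)
qed

lemma alternating_form_axis_nonzero:
  fixes \<omega> :: "('n::finite \<Rightarrow> real^'n) \<Rightarrow> real"
  assumes \<omega>: "\<omega> \<in> alternating_forms" and "\<omega> \<noteq> 0"
  shows "\<omega> (\<lambda>i. axis i 1) \<noteq> 0"
proof
  assume *: "\<omega> (\<lambda>i. axis i 1) = 0"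
  have "\<omega> v = 0" for v
    using alternating_form_eq_det[OF \<omega>, of v] by (simp add: *)
  then show False
    using \<open>\<omega> \<noteq> 0\<close> by (simp add: fun_eq_iff)
qed

text \<open>The identification with the dual space that sends the standard basis to its dual basis.\<close>

definition covec :: "real^'n \<Rightarrow> (real^'n::finite) dual" where
  "covec a = Blinfun (\<lambda>x. a \<bullet> x)"

lemma covec_apply [simp]: "blinfun_apply (covec a) x = a \<bullet> x"
  unfolding covec_def by (subst bounded_linear_Blinfun_apply) (auto intro: bounded_linear_inner_right)

lemma covec_linear: "linear covec"
  by (rule linearI; rule blinfun_eqI)
    (simp_all add: inner_add_left plus_blinfun.rep_eq scaleR_blinfun.rep_eq)

lemma covec_expansion:
  fixes \<alpha> :: "(real^'n::finite) dual"
  shows "\<alpha> = (\<Sum>i\<in>UNIV. blinfun_apply \<alpha> (axis i 1) *\<^sub>R covec (axis i 1))"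
proof (rule blinfun_eqI)
  fix x :: "real^'n"
  have "blinfun_apply \<alpha> x = blinfun_apply \<alpha> (\<Sum>i\<in>UNIV. x $ i *\<^sub>R axis i 1)"
    using basis_expansion[of x] by (simp add: scalar_mult_eq_scaleR)
  also have "\<dots> = (\<Sum>i\<in>UNIV. x $ i * blinfun_apply \<alpha> (axis i 1))"
    by (simp add: blinfun.sum_right blinfun.scaleR_right)
  also have "\<dots> = blinfun_apply (\<Sum>i\<in>UNIV. blinfun_apply \<alpha> (axis i 1) *\<^sub>R covec (axis i 1)) x"
    by (simp add: blinfun.sum_left blinfun.scaleR_left inner_axis' mult.commute)
  finally show "blinfun_apply \<alpha> x = \<dots>" .
qed

lemma covec_surj: "\<exists>a. \<alpha> = covec a"
proof
  let ?a = "\<Sum>i\<in>UNIV. blinfun_apply \<alpha> (axis i 1) *\<^sub>R axis i (1::real)"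
  show "\<alpha> = covec ?a"
    by (subst covec_expansion) (simp add: linear_sum[OF covec_linear] linear_scale[OF covec_linear])
qed

lemma covector_determines_vector:
  fixes v w :: "real^'n::finite"
  assumes "\<And>\<beta> :: (real^'n) dual. blinfun_apply \<beta> v = blinfun_apply \<beta> w"
  shows "v = w"
  using assms[of "covec (axis _ 1)"] by (simp add: vec_eq_iff inner_axis')

lemma linear_covec_expansion:
  fixes f :: "(real^'n::finite) dual \<Rightarrow> real"
  assumes "linear f"
  shows "f \<alpha> = (\<Sum>i\<in>UNIV. blinfun_apply \<alpha> (axis i 1) * f (covec (axis i 1)))"
proof -
  have "f \<alpha> = f (\<Sum>i\<in>UNIV. blinfun_apply \<alpha> (axis i 1) *\<^sub>R covec (axis i 1))"
    by (subst covec_expansion) (rule refl)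
  then show ?thesis
    by (simp add: linear_sum[OF assms] linear_scale[OF assms])
qed

lemma sharp_apply:
  fixes B :: "(real^'n::finite) dual \<Rightarrow> (real^'n) dual \<Rightarrow> real"
  assumes "bilinear B"
  shows "blinfun_apply \<beta> (sharp B \<alpha>) = B \<alpha> \<beta>"
proof -
  have lin: "linear (B \<alpha>)"
    using assms by (simp add: bilinear_def)
  define v where "v = (\<Sum>j\<in>UNIV. B \<alpha> (covec (axis j 1)) *\<^sub>R axis j (1::real))"
  have v: "blinfun_apply \<beta> v = B \<alpha> \<beta>" for \<beta>
    unfolding v_def blinfun.sum_right blinfun.scaleR_right linear_covec_expansion[OF lin, of \<beta>]
    by (simp add: mult.commute)
  have "sharp B \<alpha> = v"
    unfolding sharp_def
  proof (rule the_equality)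
    show "\<forall>\<beta>. blinfun_apply \<beta> v = B \<alpha> \<beta>"
      using v by blast
    show "w = v" if "\<forall>\<beta>. blinfun_apply \<beta> w = B \<alpha> \<beta>" for w
      using that v by (intro covector_determines_vector) simp
  qed
  then show ?thesis
    using v by simp
qed

lemma pullback_covector_apply [simp]:
  assumes "bounded_linear L"
  shows "blinfun_apply (pullback_covector L \<alpha>) v = blinfun_apply \<alpha> (L v)"
  unfolding pullback_covector_def
  by (subst bounded_linear_Blinfun_apply)
    (auto intro: bounded_linear_compose[OF blinfun.bounded_linear_right assms])

lemma pullback_covector_add_scale:
  assumes "bounded_linear L"
  shows "pullback_covector L (\<alpha> + \<beta>) = pullback_covector L \<alpha> + pullback_covector L \<beta>"
    "pullback_covector L (r *\<^sub>R \<alpha>) = r *\<^sub>R pullback_covector L \<alpha>"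
  by (rule blinfun_eqI; simp add: assms blinfun.add_left blinfun.scaleR_left)+

lemma pullback_covector_linear:
  assumes "bounded_linear L"
  shows "linear (pullback_covector L)"
  by (rule linearI) (simp_all add: pullback_covector_add_scale[OF assms])

lemma pullback_covector_covec:
  fixes L :: "real^'n::finite \<Rightarrow> real^'n"
  assumes "linear L"
  shows "pullback_covector L (covec a) = covec (Finite_Cartesian_Product.transpose (matrix L) *v a)"
  using assms
  by (intro blinfun_eqI)
    (simp add: linear_conv_bounded_linear dot_lmul_matrix flip: vector_transpose_matrix
      matrix_vector_mul(1))

text \<open>Covectors pull back by the transpose, which has the same determinant.\<close>

lemma alternating_form_pullback:
  fixes w :: "('n::finite \<Rightarrow> (real^'n) dual) \<Rightarrow> real"
  assumes w: "w \<in> alternating_forms" and L: "linear L"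
  shows "w (\<lambda>i. pullback_covector L (\<alpha> i)) = det (matrix L) * w \<alpha>"
proof -
  define w' where "w' v = w (\<lambda>i. covec (v i))" for v
  have w': "w' \<in> alternating_forms"
    unfolding w'_def by (rule alternating_form_compose_linear[OF w covec_linear])
  obtain a where a: "\<alpha> = (\<lambda>i. covec (a i))"
    using choice[OF allI[OF covec_surj], of \<alpha>] by blast
  show ?thesis
    using alternating_form_linear_image[OF w' matrix_vector_mul_linear, of "Finite_Cartesian_Product.transpose (matrix L)" a]
    by (simp only: a w'_def pullback_covector_covec[OF L] matrix_of_matrix_vector_mul det_transpose)
qed

text \<open>Every basis of a line consists of one vector, so the determinant does not depend on its choice.\<close>

lemma endo_det_homothety:
  assumes V: "V = span {w\<^sub>0}" and "w\<^sub>0 \<noteq> 0" and T: "\<And>w. w \<in> V \<Longrightarrow> T w = c *\<^sub>R w"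
  shows "endo_det V T = c"
proof -
  define B where "B = some_basis V"
  have "\<exists>B. B \<subseteq> V \<and> independent B \<and> span B = V"
    unfolding V using \<open>w\<^sub>0 \<noteq> 0\<close> by (intro exI[of _ "{w\<^sub>0}"]) (simp add: span_superset)
  then have "B \<subseteq> V \<and> independent B \<and> span B = V"
    unfolding B_def some_basis_def by (rule someI_ex)
  then have B: "B \<subseteq> V" "independent B" "span B = V"
    by auto
  have "card B = card {w\<^sub>0}"
  proof -
    have "dim V = card B"
      using B by (intro dim_unique) auto
    moreover have "dim V = card {w\<^sub>0}"
      unfolding V using \<open>w\<^sub>0 \<noteq> 0\<close> by (intro dim_unique[of "{w\<^sub>0}"]) (simp_all add: span_superset)
    ultimately show ?thesis
      by simp
  qed
  then obtain b where b: "B = {b}"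
    by (auto simp: card_1_singleton_iff)
  have "T b = c *\<^sub>R b"
    using B b T by auto
  then have "representation B (T b) b = c"
    using B b by (simp add: representation_scale span_base representation_basis)
  then show ?thesis
    unfolding endo_det_def Let_def B_def[symmetric] b by simp
qed

text \<open>The top-degree multivectors form a line, spanned by the determinant of the coordinates of
  the covectors, and there \<open>L\<close> acts as multiplication by a number.\<close>

lemma endo_det_alternating_forms:
  fixes L :: "real^'n::finite \<Rightarrow> real^'n"
  assumes L: "linear L"
  shows "endo_det (alternating_forms :: (('n \<Rightarrow> (real^'n) dual) \<Rightarrow> real) set)
           (\<lambda>w \<alpha>. w (\<lambda>i. pullback_covector L (\<alpha> i))) = det (matrix L)"
proof -
  define w\<^sub>0 :: "('n \<Rightarrow> (real^'n) dual) \<Rightarrow> real"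
    where "w\<^sub>0 \<alpha> = det (\<chi> i j. blinfun_apply (\<alpha> i) (axis j 1))" for \<alpha>
  have row: "w\<^sub>0 (v(i := x)) = det (\<chi> k. if k = i then (\<chi> j. blinfun_apply x (axis j 1))
      else (\<chi> j. blinfun_apply (v k) (axis j 1)))" for v i x
    unfolding w\<^sub>0_def by (intro arg_cong[of _ _ det]) (simp add: vec_eq_iff)
  have w\<^sub>0: "w\<^sub>0 \<in> alternating_forms"
    unfolding alternating_forms_def mem_Collect_eq
  proof (intro conjI allI impI)
    fix v :: "'n \<Rightarrow> (real^'n) dual" and k
    let ?a = "\<lambda>x::(real^'n) dual. \<chi> j. blinfun_apply x (axis j 1)"
    have a: "?a (x + y) = ?a x + ?a y" "?a (r *\<^sub>R x) = r *s ?a x" for x y r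
      by (simp_all add: vec_eq_iff blinfun.add_left blinfun.scaleR_left)
    show "linear (\<lambda>x. w\<^sub>0 (v(k := x)))"
      unfolding row by (rule linearI; simp only: a det_row_add det_row_mul real_scaleR_def)
  next
    fix v :: "'n \<Rightarrow> (real^'n) dual" and k l :: 'n
    assume "k \<noteq> l \<and> v k = v l"
    then show "w\<^sub>0 v = 0"
      unfolding w\<^sub>0_def by (intro det_identical_rows[of k l]) (auto simp: row_def)
  qed
  let ?e = "\<lambda>i. covec (axis i 1 :: real^'n)"
  have e: "w\<^sub>0 ?e = 1"
  proof -
    have "(\<chi> i j. blinfun_apply (?e i) (axis j 1)) = (mat 1 :: real^'n^'n)"
      by (simp add: vec_eq_iff mat_def inner_axis' inner_axis) (simp add: axis_def)
    then show ?thesis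
      by (simp add: w\<^sub>0_def)
  qed
  have "w = w ?e *\<^sub>R w\<^sub>0" if w: "w \<in> alternating_forms" for w :: "('n \<Rightarrow> (real^'n) dual) \<Rightarrow> real"
  proof
    fix \<alpha> :: "'n \<Rightarrow> (real^'n) dual"
    obtain a where a: "\<And>i. \<alpha> i = covec (a i)"
      using choice[OF allI[OF covec_surj], of \<alpha>] by blast
    have "Finite_Cartesian_Product.transpose (\<chi> i. a i) *v axis i 1 = a i" for i
      by (simp add: matrix_vector_mult_basis column_def Finite_Cartesian_Product.transpose_def vec_eq_iff
          del: transpose_matrix_vector)
    then have "\<alpha> = (\<lambda>i. pullback_covector (\<lambda>x. (\<chi> i. a i) *v x) (?e i))"
      by (simp only: fun_eq_iff a pullback_covector_covec[OF matrix_vector_mul_linear]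
          matrix_of_matrix_vector_mul) simp
    then have "w \<alpha> = det (\<chi> i. a i) * w ?e" "w\<^sub>0 \<alpha> = det (\<chi> i. a i) * w\<^sub>0 ?e"
      using alternating_form_pullback[OF w matrix_vector_mul_linear, of "\<chi> i. a i" ?e]
        alternating_form_pullback[OF w\<^sub>0 matrix_vector_mul_linear, of "\<chi> i. a i" ?e] by simp_all
    then show "w \<alpha> = (w ?e *\<^sub>R w\<^sub>0) \<alpha>"
      by (simp add: e scaleR_fun_def)
  qed
  moreover have "r *\<^sub>R w\<^sub>0 \<in> alternating_forms" for r
    using w\<^sub>0 unfolding alternating_forms_def
    by (auto simp: scaleR_fun_def intro!: linear_compose_scale_right[where 'b=real, unfolded real_scaleR_def])
  ultimately have "(alternating_forms :: (('n \<Rightarrow> (real^'n) dual) \<Rightarrow> real) set) = span {w\<^sub>0}"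
    unfolding span_singleton by blast
  moreover have "w\<^sub>0 \<noteq> 0"
    using e by auto
  ultimately show ?thesis
    by (rule endo_det_homothety)
      (auto simp: fun_eq_iff scaleR_fun_def alternating_form_pullback[OF _ L])
qed

text \<open>Expanding \<open>T b\<close> along the dual standard basis and summing over the chosen basis first
  recovers each \<open>T \<epsilon>\<^sub>i\<close>, which removes the dependence on the chosen basis.\<close>

lemma endo_trace_dual:
  fixes T :: "(real^'n::finite) dual \<Rightarrow> (real^'n) dual"
  assumes T: "linear T"
  shows "endo_trace UNIV T = (\<Sum>i\<in>UNIV. blinfun_apply (T (covec (axis i 1))) (axis i 1))"
proof -
  define B where "B = some_basis (UNIV :: (real^'n) dual set)"
  let ?e = "\<lambda>i. covec (axis i 1 :: real^'n)"
  have "\<exists>B. B \<subseteq> (UNIV :: (real^'n) dual set) \<and> independent B \<and> span B = UNIV"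
    using basis_exists[of "UNIV :: (real^'n) dual set"] by (metis UNIV_eq_I subset_UNIV top.extremum_uniqueI)
  then have "independent B \<and> span B = UNIV"
    unfolding B_def some_basis_def by (rule someI2_ex) auto
  then have B: "independent B" "span B = UNIV"
    by auto
  have "span (range ?e) = UNIV"
  proof -
    have "\<alpha> \<in> span (range ?e)" for \<alpha>
      by (subst covec_expansion) (intro span_sum span_scale span_base, auto)
    then show ?thesis
      by auto
  qed
  then have fin: "finite B"
    using independent_span_bound[of "range ?e" B] B by auto
  have "representation B (T b) b = (\<Sum>i\<in>UNIV. blinfun_apply b (axis i 1) * representation B (T (?e i)) b)"
    for b
  proof -
    have "T b = (\<Sum>i\<in>UNIV. blinfun_apply b (axis i 1) *\<^sub>R T (?e i))"
      by (subst covec_expansion) (simp add: linear_sum[OF T] linear_scale[OF T])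
    then show ?thesis
      using B by (simp add: representation_sum representation_scale)
  qed
  then have "endo_trace UNIV T
      = (\<Sum>b\<in>B. \<Sum>i\<in>UNIV. blinfun_apply b (axis i 1) * representation B (T (?e i)) b)"
    unfolding endo_trace_def Let_def B_def[symmetric] by simp
  also have "\<dots> = (\<Sum>i\<in>UNIV. blinfun_apply (\<Sum>b\<in>B. representation B (T (?e i)) b *\<^sub>R b) (axis i 1))"
    by (subst sum.swap) (simp add: blinfun.sum_left blinfun.scaleR_left mult.commute)
  also have "\<dots> = (\<Sum>i\<in>UNIV. blinfun_apply (T (?e i)) (axis i 1))"
    using B fin by (simp add: sum_representation_eq)
  finally show ?thesis .
qed


section \<open>Smooth functions on open sets\<close>

lemma Ck_on_Suc_has_derivative:
  assumes "open S" "Ck_on (Suc k) f S" "x \<in> S"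
  shows "(f has_derivative frechet_derivative f (at x)) (at x)"
proof -
  have "f differentiable (at x within S)"
    using assms(2,3) by (simp add: differentiable_on_def)
  then show ?thesis
    unfolding at_within_open[OF \<open>x \<in> S\<close> \<open>open S\<close>] frechet_derivative_works .
qed

lemma Ck_on_cong:
  assumes "open S" "Ck_on k f S" "\<And>x. x \<in> S \<Longrightarrow> f x = g x"
  shows "Ck_on k g S"
  using assms(2,3)
proof (induction k arbitrary: f g)
  case 0
  then show ?case
    using continuous_on_cong by fastforce
next
  case (Suc k)
  have g: "(g has_derivative frechet_derivative f (at x)) (at x)" if "x \<in> S" for x
    using Ck_on_Suc_has_derivative[OF \<open>open S\<close> Suc.prems(1) that] \<open>open S\<close> that Suc.prems(2)
    by (rule has_derivative_transform_within_open)
  have "g differentiable_on S"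
    unfolding differentiable_on_def differentiable_def using g has_derivative_at_withinI by blast
  moreover have "Ck_on k (\<lambda>x. frechet_derivative g (at x) v) S" for v
  proof (rule Suc.IH)
    show "Ck_on k (\<lambda>x. frechet_derivative f (at x) v) S"
      using Suc.prems(1) by simp
    show "frechet_derivative f (at x) v = frechet_derivative g (at x) v" if "x \<in> S" for x
      by (rule fun_cong[OF frechet_derivative_at[OF g[OF that]]])
  qed
  ultimately show ?case
    by simp
qed

lemma Ck_on_SucI:
  assumes "open S"
    and f': "\<And>x. x \<in> S \<Longrightarrow> (f has_derivative f' x) (at x)"
    and "\<And>v. Ck_on k (\<lambda>x. f' x v) S"
  shows "Ck_on (Suc k) f S"
proof -
  have "f differentiable_on S"
    unfolding differentiable_on_def differentiable_def using f' has_derivative_at_withinI by blast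
  moreover have "Ck_on k (\<lambda>x. frechet_derivative f (at x) v) S" for v
    by (rule Ck_on_cong[OF \<open>open S\<close> assms(3)]) (simp add: frechet_derivative_at[OF f', symmetric])
  ultimately show ?thesis
    by simp
qed

lemma Ck_on_SucD:
  assumes "Ck_on (Suc k) f S" "open S"
  shows "Ck_on k f S"
  using assms(1)
proof (induction k arbitrary: f)
  case 0
  then show ?case
    by (simp add: differentiable_imp_continuous_on)
next
  case (Suc k)
  have "Ck_on k (\<lambda>x. frechet_derivative f (at x) v) S" for v
    using Suc.prems by (intro Suc.IH) simp
  then show ?case
    using Suc.prems by simp
qed

lemma Ck_on_subset:
  assumes "Ck_on k f S" "open S" "open T" "T \<subseteq> S"
  shows "Ck_on k f T"
  using assms(1)
proof (induction k arbitrary: f)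
  case 0
  then show ?case
    using assms continuous_on_subset by auto
next
  case (Suc k)
  then show ?case
    using assms differentiable_on_subset by auto
qed

lemma Ck_on_local:
  assumes "open S" "\<And>x. x \<in> S \<Longrightarrow> \<exists>T. open T \<and> x \<in> T \<and> Ck_on k f T"
  shows "Ck_on k f S"
  using assms(2)
proof (induction k arbitrary: f)
  case 0
  have "continuous (at x within S) f" if x: "x \<in> S" for x
  proof -
    obtain T where "open T" "x \<in> T" "continuous_on T f"
      using 0[OF x] by auto
    then show ?thesis
      using continuous_at_imp_continuous_at_within continuous_on_eq_continuous_at by blast
  qed
  then show ?case
    by (simp add: continuous_on_eq_continuous_within)
next
  case (Suc k)
  have "f differentiable at x within S" if x: "x \<in> S" for x
  proof -
    obtain T where "open T" "x \<in> T" "Ck_on (Suc k) f T"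
      using Suc.prems[OF x] by blast
    then have "f differentiable at x"
      using Ck_on_Suc_has_derivative differentiable_def by blast
    then show ?thesis
      by (rule differentiable_at_withinI)
  qed
  moreover have "Ck_on k (\<lambda>x. frechet_derivative f (at x) v) S" for v
    using Suc.prems by (intro Suc.IH) (metis Ck_on.simps(2))
  ultimately show ?case
    by (simp add: differentiable_on_def)
qed

lemma Ck_on_const: "Ck_on k (\<lambda>_. c) S"
  by (induction k arbitrary: c) auto

lemma Ck_on_bounded_linear_compose:
  assumes L: "bounded_linear L" and "open S" and "Ck_on k f S"
  shows "Ck_on k (\<lambda>x. L (f x)) S"
  using assms(3)
proof (induction k arbitrary: f)
  case 0
  then show ?case
    using bounded_linear.continuous_on[OF L] by simp
next
  case (Suc k)
  show ?case
  proof (rule Ck_on_SucI[OF \<open>open S\<close>])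
    fix x assume "x \<in> S"
    then show "((\<lambda>x. L (f x)) has_derivative (\<lambda>v. L (frechet_derivative f (at x) v))) (at x)"
      using bounded_linear.has_derivative[OF L] Ck_on_Suc_has_derivative[OF \<open>open S\<close> Suc.prems] by blast
  next
    fix v
    show "Ck_on k (\<lambda>x. L (frechet_derivative f (at x) v)) S"
      using Suc by simp
  qed
qed

lemma Ck_on_ident: "open S \<Longrightarrow> Ck_on k (\<lambda>x. x) S"
proof (cases k)
  case (Suc m)
  assume "open S"
  then show ?thesis
    unfolding Suc by (intro Ck_on_SucI[where f' = "\<lambda>_ v. v"] Ck_on_const) auto
qed simp

lemma Ck_on_add:
  assumes "open S" "Ck_on k f S" "Ck_on k g S"
  shows "Ck_on k (\<lambda>x. f x + g x) S"
  using assms(2,3)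
proof (induction k arbitrary: f g)
  case 0
  then show ?case
    by (simp add: continuous_on_add)
next
  case (Suc k)
  show ?case
  proof (rule Ck_on_SucI[OF \<open>open S\<close>])
    fix x assume "x \<in> S"
    then show "((\<lambda>x. f x + g x) has_derivative
        (\<lambda>v. frechet_derivative f (at x) v + frechet_derivative g (at x) v)) (at x)"
      using Suc.prems Ck_on_Suc_has_derivative[OF \<open>open S\<close>] by (intro has_derivative_add) blast+
  next
    fix v
    show "Ck_on k (\<lambda>x. frechet_derivative f (at x) v + frechet_derivative g (at x) v) S"
      using Suc by simp
  qed
qed

lemma Ck_on_sum:
  assumes "open S" "\<And>i. i \<in> I \<Longrightarrow> Ck_on k (f i) S"
  shows "Ck_on k (\<lambda>x. \<Sum>i\<in>I. f i x) S"
  using assms(2)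
  by (induction I rule: infinite_finite_induct) (auto intro: Ck_on_const Ck_on_add[OF \<open>open S\<close>])

lemma Ck_on_bilinear:
  assumes B: "bounded_bilinear B" and "open S" and "Ck_on k f S" "Ck_on k g S"
  shows "Ck_on k (\<lambda>x. B (f x) (g x)) S"
  using assms(3,4)
proof (induction k arbitrary: f g)
  case 0
  then show ?case
    using bounded_bilinear.continuous_on[OF B] by simp
next
  case (Suc k)
  show ?case
  proof (rule Ck_on_SucI[OF \<open>open S\<close>])
    fix x assume "x \<in> S"
    then show "((\<lambda>x. B (f x) (g x)) has_derivative
        (\<lambda>v. B (f x) (frechet_derivative g (at x) v) + B (frechet_derivative f (at x) v) (g x))) (at x)"
      using Suc.prems[THEN Ck_on_Suc_has_derivative[OF \<open>open S\<close>]]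
      by (intro bounded_bilinear.FDERIV[OF B])
  next
    fix v
    show "Ck_on k (\<lambda>x. B (f x) (frechet_derivative g (at x) v) +
        B (frechet_derivative f (at x) v) (g x)) S"
      using Suc.prems Suc.prems[THEN Ck_on_SucD[OF _ \<open>open S\<close>]]
      by (intro Ck_on_add[OF \<open>open S\<close>] Suc.IH) simp_all
  qed
qed

text \<open>\<^const>\<open>Ck_on\<close> differentiates in fixed directions only; this reduces a variable direction to
  fixed ones.\<close>

lemma frechet_derivative_apply_basis:
  fixes f :: "'a::euclidean_space \<Rightarrow> 'b::real_normed_vector"
  assumes "(f has_derivative frechet_derivative f (at x)) (at x)"
  shows "frechet_derivative f (at x) v = (\<Sum>b\<in>Basis. (v \<bullet> b) *\<^sub>R frechet_derivative f (at x) b)"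
  by (subst euclidean_representation[of v, symmetric])
    (simp add: linear_sum[OF has_derivative_linear[OF assms]] linear_scale[OF has_derivative_linear[OF assms]])

lemma Ck_on_compose:
  fixes g :: "'a::real_normed_vector \<Rightarrow> 'b::euclidean_space"
  assumes "open S" "open T" "Ck_on k f T" "Ck_on k g S" "g ` S \<subseteq> T"
  shows "Ck_on k (\<lambda>x. f (g x)) S"
  using assms(3,4)
proof (induction k arbitrary: f)
  case 0
  then show ?case
    using assms(5) continuous_on_compose2 by auto
next
  case (Suc k)
  let ?f' = "\<lambda>y. frechet_derivative f (at y)" and ?g' = "\<lambda>x. frechet_derivative g (at x)"
  have f: "(f has_derivative ?f' y) (at y)" if "y \<in> T" for y
    using Ck_on_Suc_has_derivative[OF \<open>open T\<close> Suc.prems(1) that] .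
  have g: "(g has_derivative ?g' x) (at x)" if "x \<in> S" for x
    using Ck_on_Suc_has_derivative[OF \<open>open S\<close> Suc.prems(2) that] .
  show ?case
  proof (rule Ck_on_SucI[OF \<open>open S\<close>])
    fix x assume x: "x \<in> S"
    then have "g x \<in> T"
      using assms(5) by blast
    have "?f' (g x) (?g' x v) = (\<Sum>b\<in>Basis. (?g' x v \<bullet> b) *\<^sub>R ?f' (g x) b)" for v
      by (rule frechet_derivative_apply_basis[OF f[OF \<open>g x \<in> T\<close>]])
    then show "((\<lambda>x. f (g x)) has_derivative
        (\<lambda>v. \<Sum>b\<in>Basis. (?g' x v \<bullet> b) *\<^sub>R ?f' (g x) b)) (at x)"
      using has_derivative_compose[OF g[OF x] f[OF \<open>g x \<in> T\<close>]] by simp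
  next
    fix v
    have "Ck_on k (\<lambda>x. ?f' (g x) b) S" for b
    proof (rule Suc.IH[OF _ Ck_on_SucD[OF Suc.prems(2) \<open>open S\<close>]])
      show "Ck_on k (\<lambda>y. ?f' y b) T"
        using Suc.prems(1) unfolding Ck_on.simps by blast
    qed
    moreover have "Ck_on k (\<lambda>x. ?g' x v \<bullet> b) S" for b
      using Suc.prems(2) by (intro Ck_on_bounded_linear_compose[OF bounded_linear_inner_left] \<open>open S\<close>) simp
    ultimately show "Ck_on k (\<lambda>x. \<Sum>b\<in>Basis. (?g' x v \<bullet> b) *\<^sub>R ?f' (g x) b) S"
      by (intro Ck_on_sum Ck_on_bilinear[OF bounded_bilinear_scaleR] \<open>open S\<close>)
  qed
qed

lemma Ck_on_inverse:
  fixes f :: "'a::real_normed_vector \<Rightarrow> real"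
  assumes "open S" "Ck_on k f S" and nz: "\<And>x. x \<in> S \<Longrightarrow> f x \<noteq> 0"
  shows "Ck_on k (\<lambda>x. inverse (f x)) S"
  using assms(2)
proof (induction k)
  case 0
  then show ?case
    using nz by (simp add: continuous_on_inverse)
next
  case (Suc k)
  show ?case
  proof (rule Ck_on_SucI[OF \<open>open S\<close>])
    fix x assume "x \<in> S"
    then show "((\<lambda>x. inverse (f x)) has_derivative
        (\<lambda>v. - (inverse (f x) * frechet_derivative f (at x) v * inverse (f x)))) (at x)"
      using Suc.prems[THEN Ck_on_Suc_has_derivative[OF \<open>open S\<close>]] nz
      by (intro Deriv.has_derivative_inverse)
  next
    fix v
    have "Ck_on k (\<lambda>x. inverse (f x)) S"
      using Suc Ck_on_SucD[OF _ \<open>open S\<close>] by blast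
    then show "Ck_on k (\<lambda>x. - (inverse (f x) * frechet_derivative f (at x) v * inverse (f x))) S"
      using Suc.prems
      by (intro Ck_on_bounded_linear_compose[OF bounded_linear_minus[OF bounded_linear_ident]]
          Ck_on_bilinear[OF bounded_bilinear_mult] \<open>open S\<close>) auto
  qed
qed

lemma Ck_on_sqrt:
  fixes f :: "'a::real_normed_vector \<Rightarrow> real"
  assumes "open S" "Ck_on k f S" and pos: "\<And>x. x \<in> S \<Longrightarrow> f x > 0"
  shows "Ck_on k (\<lambda>x. sqrt (f x)) S"
  using assms(2)
proof (induction k)
  case 0
  then show ?case
    by (simp add: continuous_on_real_sqrt)
next
  case (Suc k)
  show ?case
  proof (rule Ck_on_SucI[OF \<open>open S\<close>])
    fix x assume "x \<in> S"
    from has_derivative_compose[OF Ck_on_Suc_has_derivative[OF \<open>open S\<close> Suc.prems this]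
        DERIV_real_sqrt[OF pos[OF this], unfolded has_field_derivative_def]]
    show "((\<lambda>x. sqrt (f x)) has_derivative
        (\<lambda>v. frechet_derivative f (at x) v * (inverse (sqrt (f x)) * (1/2)))) (at x)"
      by (simp add: mult.commute)
  next
    fix v
    have "Ck_on k (\<lambda>x. sqrt (f x)) S"
      using Suc Ck_on_SucD[OF _ \<open>open S\<close>] by blast
    then have "Ck_on k (\<lambda>x. inverse (sqrt (f x))) S"
      using pos by (intro Ck_on_inverse \<open>open S\<close>) force+
    then show "Ck_on k (\<lambda>x. frechet_derivative f (at x) v * (inverse (sqrt (f x)) * (1/2))) S"
      using Suc.prems
      by (intro Ck_on_bilinear[OF bounded_bilinear_mult] Ck_on_const \<open>open S\<close>) auto
  qed
qed

lemma smooth_onD: "smooth_on S f \<Longrightarrow> Ck_on k f S"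
  by (simp add: smooth_on_def)

lemma smooth_on_has_derivative:
  "\<lbrakk>open S; smooth_on S f; x \<in> S\<rbrakk> \<Longrightarrow> (f has_derivative frechet_derivative f (at x)) (at x)"
  using Ck_on_Suc_has_derivative smooth_onD by blast

lemma smooth_on_derivative:
  "smooth_on S f \<Longrightarrow> smooth_on S (\<lambda>x. frechet_derivative f (at x) v)"
  by (metis Ck_on.simps(2) smooth_on_def)

lemma smooth_on_cong:
  "\<lbrakk>open S; smooth_on S f; \<And>x. x \<in> S \<Longrightarrow> f x = g x\<rbrakk> \<Longrightarrow> smooth_on S g"
  unfolding smooth_on_def using Ck_on_cong by blast

lemma smooth_on_subset: "\<lbrakk>smooth_on S f; open S; open T; T \<subseteq> S\<rbrakk> \<Longrightarrow> smooth_on T f"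
  unfolding smooth_on_def using Ck_on_subset by blast

lemma smooth_on_local:
  "\<lbrakk>open S; \<And>x. x \<in> S \<Longrightarrow> \<exists>T. open T \<and> x \<in> T \<and> smooth_on T f\<rbrakk> \<Longrightarrow> smooth_on S f"
  unfolding smooth_on_def by (intro allI Ck_on_local) metis+

lemma smooth_on_const: "smooth_on S (\<lambda>_. c)"
  unfolding smooth_on_def using Ck_on_const by blast

lemma smooth_on_ident: "open S \<Longrightarrow> smooth_on S (\<lambda>x. x)"
  unfolding smooth_on_def using Ck_on_ident by blast

lemma smooth_on_bounded_linear_compose:
  "\<lbrakk>bounded_linear L; open S; smooth_on S f\<rbrakk> \<Longrightarrow> smooth_on S (\<lambda>x. L (f x))"
  unfolding smooth_on_def using Ck_on_bounded_linear_compose by blast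

lemma smooth_on_add:
  "\<lbrakk>open S; smooth_on S f; smooth_on S g\<rbrakk> \<Longrightarrow> smooth_on S (\<lambda>x. f x + g x)"
  unfolding smooth_on_def by (rule allI, rule Ck_on_add, simp_all)

lemma smooth_on_sum:
  "\<lbrakk>open S; \<And>i. i \<in> I \<Longrightarrow> smooth_on S (f i)\<rbrakk> \<Longrightarrow> smooth_on S (\<lambda>x. \<Sum>i\<in>I. f i x)"
  unfolding smooth_on_def by (rule allI, rule Ck_on_sum, simp_all)

lemma smooth_on_bilinear:
  "\<lbrakk>bounded_bilinear B; open S; smooth_on S f; smooth_on S g\<rbrakk> \<Longrightarrow> smooth_on S (\<lambda>x. B (f x) (g x))"
  unfolding smooth_on_def by (rule allI, rule Ck_on_bilinear, simp_all)

lemmas smooth_on_mult = smooth_on_bilinear[OF bounded_bilinear_mult]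
lemmas smooth_on_scaleR = smooth_on_bilinear[OF bounded_bilinear_scaleR]

lemma smooth_on_compose:
  fixes g :: "'a::real_normed_vector \<Rightarrow> 'b::euclidean_space"
  shows "\<lbrakk>open S; open T; smooth_on T f; smooth_on S g; g ` S \<subseteq> T\<rbrakk> \<Longrightarrow> smooth_on S (\<lambda>x. f (g x))"
  unfolding smooth_on_def by (rule allI, rule Ck_on_compose[of S T], simp_all)

lemma smooth_on_Pair:
  assumes "open S" "smooth_on S f" "smooth_on S g"
  shows "smooth_on S (\<lambda>x. (f x, g x))"
proof -
  have "bounded_linear (\<lambda>a::'b. (a, 0::'c))" "bounded_linear (\<lambda>b::'c. (0::'b, b))"
    by (intro bounded_linear_Pair bounded_linear_ident bounded_linear_zero)+
  from this[THEN smooth_on_bounded_linear_compose, OF \<open>open S\<close>] assms(2,3)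
  have "smooth_on S (\<lambda>x. (f x, 0) + (0, g x))"
    by (intro smooth_on_add \<open>open S\<close>)
  then show ?thesis
    by simp
qed

lemma smooth_on_inverse:
  "\<lbrakk>open S; smooth_on S f; \<And>x. x \<in> S \<Longrightarrow> f x \<noteq> (0::real)\<rbrakk> \<Longrightarrow> smooth_on S (\<lambda>x. inverse (f x))"
  unfolding smooth_on_def by (rule allI, rule Ck_on_inverse, simp_all)

lemma smooth_on_sqrt:
  "\<lbrakk>open S; smooth_on S f; \<And>x. x \<in> S \<Longrightarrow> f x > 0\<rbrakk> \<Longrightarrow> smooth_on S (\<lambda>x. sqrt (f x))"
  unfolding smooth_on_def by (rule allI, rule Ck_on_sqrt, simp_all)

lemma smooth_on_prod:
  fixes f :: "'i \<Rightarrow> 'a::real_normed_vector \<Rightarrow> real"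
  assumes "open S" "\<And>i. i \<in> I \<Longrightarrow> smooth_on S (f i)"
  shows "smooth_on S (\<lambda>x. \<Prod>i\<in>I. f i x)"
  using assms(2)
  by (induction I rule: infinite_finite_induct) (auto intro: smooth_on_const smooth_on_mult[OF \<open>open S\<close>])

lemma smooth_on_vec_lambda:
  fixes f :: "'a::real_normed_vector \<Rightarrow> real^'n"
  assumes "open S" "\<And>i. smooth_on S (\<lambda>x. f x $ i)"
  shows "smooth_on S f"
proof -
  have "smooth_on S (\<lambda>x. \<Sum>i\<in>UNIV. f x $ i *\<^sub>R axis i (1::real))"
    by (intro smooth_on_sum smooth_on_scaleR smooth_on_const assms)
  then show ?thesis
    using basis_expansion[of "f _"] by (simp add: scalar_mult_eq_scaleR)
qed

lemma smooth_on_derivative_apply: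
  fixes f :: "'a::euclidean_space \<Rightarrow> 'b::real_normed_vector"
  assumes "open S" "smooth_on S f" "smooth_on S X"
  shows "smooth_on S (\<lambda>x. frechet_derivative f (at x) (X x))"
proof (rule smooth_on_cong[OF \<open>open S\<close>])
  show "smooth_on S (\<lambda>x. \<Sum>b\<in>Basis. (X x \<bullet> b) *\<^sub>R frechet_derivative f (at x) b)"
    by (intro smooth_on_sum smooth_on_scaleR smooth_on_derivative assms
        smooth_on_bounded_linear_compose[OF bounded_linear_inner_left])
next
  fix x assume "x \<in> S"
  show "(\<Sum>b\<in>Basis. (X x \<bullet> b) *\<^sub>R frechet_derivative f (at x) b) = frechet_derivative f (at x) (X x)"
    by (rule frechet_derivative_apply_basis[OF smooth_on_has_derivative[OF assms(1,2) \<open>x \<in> S\<close>], symmetric])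
qed

text \<open>Both mixed derivatives are limits of the same second difference quotient, which the mean
  value theorem rewrites in two ways.\<close>

lemma second_derivative_symmetric_real:
  fixes f :: "'a::real_normed_vector \<Rightarrow> real"
  assumes "open S" "smooth_on S f" "x \<in> S"
  defines "D v \<equiv> \<lambda>y. frechet_derivative f (at y) v"
  defines "DD v u \<equiv> \<lambda>y. frechet_derivative (D v) (at y) u"
  shows "DD v u x = DD u v x"
proof -
  have f: "(f has_derivative (\<lambda>v. D v y)) (at y)" if "y \<in> S" for y
    using smooth_on_has_derivative[OF assms(1,2) that] by (simp add: D_def)
  have sD: "smooth_on S (D v)" for v
    unfolding D_def using assms(2) by (rule smooth_on_derivative)
  have D: "(D v has_derivative (\<lambda>u. DD v u y)) (at y)" if "y \<in> S" for v y
    using smooth_on_has_derivative[OF assms(1) sD that] by (simp add: DD_def)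
  have "isCont (DD v u) x" for v u
    using smooth_onD[OF smooth_on_derivative[OF sD], of 0] assms
    by (simp add: DD_def continuous_on_eq_continuous_at)
  obtain r where r: "r > 0" "cball x r \<subseteq> S"
    using assms open_contains_cball by blast
  have key: "\<exists>s t. 0 < s \<and> s < h \<and> 0 < t \<and> t < h \<and>
      f (x + h *\<^sub>R u + h *\<^sub>R v) - f (x + h *\<^sub>R v) - (f (x + h *\<^sub>R u) - f x)
        = h * (h * DD v u (x + s *\<^sub>R u + t *\<^sub>R v))"
    if h: "0 < h" "h * (norm u + norm v) \<le> r" for h u v
  proof -
    have in_S: "x + s *\<^sub>R u + t *\<^sub>R v \<in> S" if "0 \<le> s" "s \<le> h" "0 \<le> t" "t \<le> h" for s t
    proof -
      have "norm (s *\<^sub>R u + t *\<^sub>R v) \<le> s * norm u + t * norm v"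
        using that norm_triangle_ineq[of "s *\<^sub>R u" "t *\<^sub>R v"] by simp
      also have "\<dots> \<le> h * norm u + h * norm v"
        using that by (intro add_mono mult_right_mono) auto
      finally have "norm (s *\<^sub>R u + t *\<^sub>R v) \<le> r"
        using h by (simp add: algebra_simps)
      then have "dist (x + (s *\<^sub>R u + t *\<^sub>R v)) x \<le> r"
        by (simp add: dist_norm)
      then show ?thesis
        by (intro subsetD[OF r(2)]) (simp add: dist_commute add.assoc)
    qed
    let ?g = "\<lambda>t. f (x + h *\<^sub>R u + t *\<^sub>R v) - f (x + t *\<^sub>R v)"
    have line: "((\<lambda>t. F (a + t *\<^sub>R w)) has_real_derivative F' w) (at t)"
      if "(F has_derivative F') (at (a + t *\<^sub>R w))" for F :: "'a \<Rightarrow> real" and F' a w t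
    proof -
      have "(\<lambda>d. F' (d *\<^sub>R w)) = (*) (F' w)"
        by (simp add: fun_eq_iff linear_scale[OF has_derivative_linear[OF that]] mult.commute)
      moreover have "((\<lambda>t. F (a + t *\<^sub>R w)) has_derivative (\<lambda>d. F' (d *\<^sub>R w))) (at t)"
        by (rule has_derivative_compose[where g = F and f = "\<lambda>t. a + t *\<^sub>R w"])
          (auto intro!: derivative_eq_intros that)
      ultimately show ?thesis
        unfolding has_field_derivative_def by (simp only:)
    qed
    have "\<exists>t>0. t < h \<and> ?g h - ?g 0 = (h - 0) * (D v (x + h *\<^sub>R u + t *\<^sub>R v) - D v (x + t *\<^sub>R v))"
    proof (rule MVT2[OF \<open>0 < h\<close>])
      fix t assume t: "0 \<le> t" "t \<le> h"
      show "(?g has_real_derivative D v (x + h *\<^sub>R u + t *\<^sub>R v) - D v (x + t *\<^sub>R v)) (at t)"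
        using in_S[of h t] in_S[of 0 t] t h by (intro DERIV_diff line f) auto
    qed
    then obtain t where t: "0 < t" "t < h"
      "?g h - ?g 0 = h * (D v (x + h *\<^sub>R u + t *\<^sub>R v) - D v (x + t *\<^sub>R v))"
      by auto
    let ?k = "\<lambda>s. D v ((x + t *\<^sub>R v) + s *\<^sub>R u)"
    have "\<exists>s>0. s < h \<and> ?k h - ?k 0 = (h - 0) * DD v u ((x + t *\<^sub>R v) + s *\<^sub>R u)"
    proof (rule MVT2[OF \<open>0 < h\<close>])
      fix s assume s: "0 \<le> s" "s \<le> h"
      show "(?k has_real_derivative DD v u ((x + t *\<^sub>R v) + s *\<^sub>R u)) (at s)"
        using in_S[of s t] t s h by (intro line D) (simp add: algebra_simps)
    qed
    then obtain s where "0 < s" "s < h"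
      "D v (x + h *\<^sub>R u + t *\<^sub>R v) - D v (x + t *\<^sub>R v) = h * DD v u (x + s *\<^sub>R u + t *\<^sub>R v)"
      by (auto simp: algebra_simps)
    then show ?thesis
      using t by (intro exI[of _ s] exI[of _ t]) simp
  qed
  show ?thesis
  proof (rule ccontr)
    assume neq: "DD v u x \<noteq> DD u v x"
    define e where "e = \<bar>DD v u x - DD u v x\<bar> / 2"
    have "e > 0"
      using neq by (simp add: e_def)
    obtain d\<^sub>1 where d1: "d\<^sub>1 > 0" "\<And>y. dist y x < d\<^sub>1 \<Longrightarrow> dist (DD v u y) (DD v u x) < e"
      using \<open>isCont (DD v u) x\<close> \<open>e > 0\<close> by (metis continuous_at_eps_delta)
    obtain d\<^sub>2 where d2: "d\<^sub>2 > 0" "\<And>y. dist y x < d\<^sub>2 \<Longrightarrow> dist (DD u v y) (DD u v x) < e"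
      using \<open>isCont (DD u v) x\<close> \<open>e > 0\<close> by (metis continuous_at_eps_delta)
    define m where "m = min r (min d\<^sub>1 d\<^sub>2)"
    \<comment> \<open>The parallelogram with sides \<open>h u\<close> and \<open>h v\<close> at \<open>x\<close> lies in the ball of radius \<open>m\<close>; the \<open>1\<close>
      covers the case \<open>u = v = 0\<close>.\<close>
    define h where "h = m / (norm u + norm v + 1)"
    have "m > 0"
      using r d1 d2 by (simp add: m_def)
    have "norm u + norm v + 1 > 0"
      by (simp add: add_nonneg_pos)
    then have "h > 0" "h * (norm u + norm v + 1) = m"
      using \<open>m > 0\<close> by (simp_all add: h_def)
    then have h: "h > 0" "h * (norm u + norm v) < m"
      by (simp_all add: algebra_simps)
    obtain s t where st: "0 < s" "s < h" "0 < t" "t < h"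
      "f (x + h *\<^sub>R u + h *\<^sub>R v) - f (x + h *\<^sub>R v) - (f (x + h *\<^sub>R u) - f x)
        = h * (h * DD v u (x + s *\<^sub>R u + t *\<^sub>R v))"
      using key[of h u v] h by (auto simp: m_def)
    obtain s' t' where st': "0 < s'" "s' < h" "0 < t'" "t' < h"
      "f (x + h *\<^sub>R v + h *\<^sub>R u) - f (x + h *\<^sub>R u) - (f (x + h *\<^sub>R v) - f x)
        = h * (h * DD u v (x + s' *\<^sub>R v + t' *\<^sub>R u))"
      using key[of h v u] h by (auto simp: m_def add.commute)
    have close: "dist (x + a *\<^sub>R p + b *\<^sub>R q) x < m"
      if "0 < a" "a < h" "0 < b" "b < h" "norm p + norm q = norm u + norm v" for a b p q
    proof -
      have "norm (a *\<^sub>R p + b *\<^sub>R q) \<le> a * norm p + b * norm q"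
        using that norm_triangle_ineq[of "a *\<^sub>R p" "b *\<^sub>R q"] by simp
      also have "\<dots> \<le> h * norm p + h * norm q"
        using that by (intro add_mono mult_right_mono) auto
      also have "\<dots> < m"
        using h that by (simp flip: distrib_left)
      finally show ?thesis
        by (simp add: dist_norm add.assoc)
    qed
    have "h * (h * DD v u (x + s *\<^sub>R u + t *\<^sub>R v)) = h * (h * DD u v (x + s' *\<^sub>R v + t' *\<^sub>R u))"
      using st(5) st'(5) unfolding add.assoc[of x] add.commute[of "h *\<^sub>R v" "h *\<^sub>R u"]
      by linarith
    then have "DD v u (x + s *\<^sub>R u + t *\<^sub>R v) = DD u v (x + s' *\<^sub>R v + t' *\<^sub>R u)"
      using h by simp
    moreover have "dist (DD v u (x + s *\<^sub>R u + t *\<^sub>R v)) (DD v u x) < e"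
      using close[of s t u v] st by (intro d1) (simp add: m_def)
    moreover have "dist (DD u v (x + s' *\<^sub>R v + t' *\<^sub>R u)) (DD u v x) < e"
      using close[of s' t' v u] st' by (intro d2) (simp add: m_def add.commute)
    ultimately show False
      unfolding e_def dist_real_def by (simp add: abs_if split: if_splits)
  qed
qed

lemma second_derivative_symmetric:
  fixes f :: "'a::real_normed_vector \<Rightarrow> 'b::euclidean_space"
  assumes "open S" "smooth_on S f" "x \<in> S"
  shows "frechet_derivative (\<lambda>y. frechet_derivative f (at y) v) (at x) u
       = frechet_derivative (\<lambda>y. frechet_derivative f (at y) u) (at x) v"
proof (rule euclidean_eqI)
  fix b :: 'b assume "b \<in> Basis"
  let ?fb = "\<lambda>y. f y \<bullet> b"
  note inner = bounded_linear.has_derivative[OF bounded_linear_inner_left]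
  have "frechet_derivative ?fb (at y) w = frechet_derivative f (at y) w \<bullet> b" if "y \<in> S" for y w
    using frechet_derivative_at[OF inner[OF smooth_on_has_derivative[OF assms(1,2) that], of b]] by metis
  then have 1: "frechet_derivative (\<lambda>y. frechet_derivative ?fb (at y) w) (at x) z
      = frechet_derivative (\<lambda>y. frechet_derivative f (at y) w \<bullet> b) (at x) z" for w z
    using inner[OF smooth_on_has_derivative[OF assms(1) smooth_on_derivative[OF assms(2)] assms(3)], of w b] assms(1,3)
    by (intro fun_cong[OF frechet_derivative_transform_within_open[symmetric]])
      (auto simp: differentiable_def)
  have 2: "frechet_derivative (\<lambda>y. frechet_derivative f (at y) w \<bullet> b) (at x) z
      = frechet_derivative (\<lambda>y. frechet_derivative f (at y) w) (at x) z \<bullet> b" for w z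
    using frechet_derivative_at[OF inner[OF smooth_on_has_derivative[OF assms(1) smooth_on_derivative[OF assms(2)] assms(3)], of w b]]
    by metis
  have "smooth_on S ?fb"
    using assms by (intro smooth_on_bounded_linear_compose[OF bounded_linear_inner_left])
  from second_derivative_symmetric_real[OF assms(1) this assms(3), of v u]
  show "frechet_derivative (\<lambda>y. frechet_derivative f (at y) v) (at x) u \<bullet> b
      = frechet_derivative (\<lambda>y. frechet_derivative f (at y) u) (at x) v \<bullet> b"
    unfolding 1 2 .
qed

text \<open>The product rule, stated with the second derivative at the fixed vector \<open>X x\<close>. Expanding
  along a basis needs linearity in that vector, which follows by exchanging the two directions.\<close>

lemma second_derivative_apply:
  fixes f :: "'a::euclidean_space \<Rightarrow> 'b::euclidean_space"
  assumes "open S" "smooth_on S f" "x \<in> S" and X: "(X has_derivative X') (at x)"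
  shows "((\<lambda>y. frechet_derivative f (at y) (X y)) has_derivative
    (\<lambda>u. frechet_derivative (\<lambda>y. frechet_derivative f (at y) (X x)) (at x) u +
      frechet_derivative f (at x) (X' u))) (at x)"
proof -
  let ?D = "\<lambda>y. frechet_derivative f (at y)"
  let ?DD = "\<lambda>v. frechet_derivative (\<lambda>y. ?D y v) (at x)"
  have D: "(f has_derivative ?D y) (at y)" if "y \<in> S" for y
    using smooth_on_has_derivative[OF assms(1,2) that] .
  have DD: "((\<lambda>y. ?D y v) has_derivative ?DD v) (at x)" for v
    using smooth_on_has_derivative[OF assms(1) smooth_on_derivative[OF assms(2)] assms(3)] .
  have "((\<lambda>y. \<Sum>b\<in>Basis. (X y \<bullet> b) *\<^sub>R ?D y b) has_derivative
      (\<lambda>u. \<Sum>b\<in>Basis. (X x \<bullet> b) *\<^sub>R ?DD b u + (X' u \<bullet> b) *\<^sub>R ?D x b)) (at x)"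
    by (intro has_derivative_sum has_derivative_scaleR DD has_derivative_inner_left X)
  then have "((\<lambda>y. ?D y (X y)) has_derivative
      (\<lambda>u. \<Sum>b\<in>Basis. (X x \<bullet> b) *\<^sub>R ?DD b u + (X' u \<bullet> b) *\<^sub>R ?D x b)) (at x)"
    using assms(1,3)
    by (rule has_derivative_transform_within_open)
      (rule frechet_derivative_apply_basis[OF D, symmetric])
  moreover have "(\<Sum>b\<in>Basis. (X x \<bullet> b) *\<^sub>R ?DD b u + (X' u \<bullet> b) *\<^sub>R ?D x b)
      = ?DD (X x) u + ?D x (X' u)" for u
  proof -
    note sym = second_derivative_symmetric[OF assms(1-3)]
    have "?DD (X x) u = ?DD u (X x)"
      by (rule sym)
    also have "\<dots> = (\<Sum>b\<in>Basis. (X x \<bullet> b) *\<^sub>R ?DD u b)"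
      by (rule frechet_derivative_apply_basis[OF DD])
    also have "\<dots> = (\<Sum>b\<in>Basis. (X x \<bullet> b) *\<^sub>R ?DD b u)"
      by (intro sum.cong refl arg_cong[of _ _ "\<lambda>z. _ *\<^sub>R z"] sym)
    moreover have "?D x (X' u) = (\<Sum>b\<in>Basis. (X' u \<bullet> b) *\<^sub>R ?D x b)"
      by (rule frechet_derivative_apply_basis[OF D[OF assms(3)]])
    ultimately show ?thesis
      by (simp only: sum.distrib)
  qed
  ultimately show ?thesis
    by (simp only:)
qed

lemma frechet_derivative_cong_open:
  assumes "(f has_derivative f') (at x)" "open S" "x \<in> S" "\<And>y. y \<in> S \<Longrightarrow> f y = g y"
  shows "frechet_derivative g (at x) = frechet_derivative f (at x)"
  using frechet_derivative_at[OF has_derivative_transform_within_open[OF assms]]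
    frechet_derivative_at[OF assms(1)] by simp


section \<open>Maps of manifolds in charts\<close>

definition chart_rep :: "('m, 'e) chart \<Rightarrow> ('n, 'f) chart \<Rightarrow> ('m \<Rightarrow> 'n) \<Rightarrow> 'e \<Rightarrow> 'f" where
  "chart_rep c d \<phi> u = snd d (\<phi> (chart_inv c u))"

definition rep_domain :: "('m, 'e) chart \<Rightarrow> ('n, 'f) chart \<Rightarrow> ('m \<Rightarrow> 'n) \<Rightarrow> 'e set" where
  "rep_domain c d \<phi> = {u \<in> chart_range c. \<phi> (chart_inv c u) \<in> fst d}"

text \<open>The maps \<^const>\<open>tangent_map\<close>, \<^const>\<open>to_chart\<close> and \<^const>\<open>from_chart\<close> are all instances of this
  derivative, with preferred charts and the identity in the appropriate places. One chain rule then
  covers their interaction.\<close>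

definition chart_deriv ::
    "('m, 'e::real_normed_vector) chart \<Rightarrow> ('n, 'f::real_normed_vector) chart \<Rightarrow>
     ('m \<Rightarrow> 'n) \<Rightarrow> 'm \<Rightarrow> 'e \<Rightarrow> 'f" where
  "chart_deriv c d \<phi> p = frechet_derivative (chart_rep c d \<phi>) (at (snd c p))"

lemma tangent_map_eq_chart_deriv:
  "tangent_map A B \<phi> p = chart_deriv (chart_at A p) (chart_at B (\<phi> p)) \<phi> p"
  by (simp add: tangent_map_def chart_deriv_def chart_rep_def[abs_def] o_def coord_at_def)

lemma to_chart_eq_chart_deriv: "to_chart A c p = chart_deriv (chart_at A p) c (\<lambda>x. x) p"
  by (simp add: to_chart_def chart_deriv_def chart_rep_def[abs_def] o_def coord_at_def)

lemma from_chart_eq_chart_deriv: "from_chart A c p = chart_deriv c (chart_at A p) (\<lambda>x. x) p"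
  by (simp add: from_chart_def chart_deriv_def chart_rep_def[abs_def] o_def coord_at_def)

locale smooth_manifold =
  fixes A :: "('m::{t2_space, second_countable_topology}, 'e::euclidean_space) atlas"
  assumes smooth_atlas: "smooth_atlas A"
begin

lemma chart_at_in [simp]: "chart_at A p \<in> A" "p \<in> fst (chart_at A p)"
proof -
  have "\<exists>c. c \<in> A \<and> p \<in> fst c"
    using smooth_atlas unfolding smooth_atlas_def by (metis UN_E UNIV_I)
  then have "chart_at A p \<in> A \<and> p \<in> fst (chart_at A p)"
    unfolding chart_at_def by (rule someI_ex)
  then show "chart_at A p \<in> A" "p \<in> fst (chart_at A p)"
    by auto
qed

context
  fixes c assumes c: "c \<in> A"
begin

lemma chart_homeomorphism:
  "homeomorphism (fst c) (chart_range c) (snd c) (chart_inv c)"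
  and open_chart: "open (fst c)" and open_chart_range: "open (chart_range c)"
  using smooth_atlas c by (auto simp: smooth_atlas_def)

lemma chart_inv_snd [simp]: "p \<in> fst c \<Longrightarrow> chart_inv c (snd c p) = p"
  using chart_homeomorphism by (simp add: homeomorphism_def)

lemma snd_chart_inv [simp]: "u \<in> chart_range c \<Longrightarrow> snd c (chart_inv c u) = u"
  using chart_homeomorphism by (simp add: homeomorphism_def)

lemma snd_in_chart_range [simp]: "p \<in> fst c \<Longrightarrow> snd c p \<in> chart_range c"
  by (simp add: chart_range_def)

lemma chart_inv_in [simp]: "u \<in> chart_range c \<Longrightarrow> chart_inv c u \<in> fst c"
  using chart_homeomorphism by (auto simp: homeomorphism_def)

lemma open_chart_preimage:
  assumes "open U"
  shows "open {u \<in> chart_range c. chart_inv c u \<in> U}"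
proof -
  have "continuous_on (chart_range c) (chart_inv c)"
    using chart_homeomorphism by (simp add: homeomorphism_def)
  from continuous_open_preimage[OF this open_chart_range assms] show ?thesis
    by (simp add: vimage_def Int_def)
qed

lemma image_chart_eq_rep_domain: "snd c ` (fst c \<inter> \<phi> -` fst d) = rep_domain c d \<phi>"
proof
  show "snd c ` (fst c \<inter> \<phi> -` fst d) \<subseteq> rep_domain c d \<phi>"
    by (auto simp: rep_domain_def)
  show "rep_domain c d \<phi> \<subseteq> snd c ` (fst c \<inter> \<phi> -` fst d)"
  proof
    fix u assume "u \<in> rep_domain c d \<phi>"
    then show "u \<in> snd c ` (fst c \<inter> \<phi> -` fst d)"
      by (intro image_eqI[of _ _ "chart_inv c u"]) (auto simp: rep_domain_def)
  qed
qed

lemma snd_in_rep_domain: "\<lbrakk>p \<in> fst c; \<phi> p \<in> fst d\<rbrakk> \<Longrightarrow> snd c p \<in> rep_domain c d \<phi>"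
  by (simp add: rep_domain_def)

end

lemma smooth_map_iff:
  "smooth_map A A \<phi> \<longleftrightarrow> continuous_on UNIV \<phi> \<and>
     (\<forall>c\<in>A. \<forall>d\<in>A. smooth_on (rep_domain c d \<phi>) (chart_rep c d \<phi>))"
proof -
  have "snd d \<circ> \<phi> \<circ> chart_inv c = chart_rep c d \<phi>" for c d :: "('m, 'e) chart"
    by (simp add: fun_eq_iff chart_rep_def)
  then show ?thesis
    unfolding smooth_map_def using image_chart_eq_rep_domain by metis
qed

lemma smooth_map_open_vimage: "\<lbrakk>smooth_map A A \<phi>; open U\<rbrakk> \<Longrightarrow> open (\<phi> -` U)"
  unfolding smooth_map_iff using open_vimage by blast

lemma open_rep_domain:
  assumes "smooth_map A A \<phi>" "c \<in> A" "d \<in> A"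
  shows "open (rep_domain c d \<phi>)"
  using open_chart_preimage[OF assms(2) smooth_map_open_vimage[OF assms(1) open_chart[OF assms(3)]]]
  by (simp add: rep_domain_def)

lemma smooth_map_rep:
  "\<lbrakk>smooth_map A A \<phi>; c \<in> A; d \<in> A\<rbrakk> \<Longrightarrow> smooth_on (rep_domain c d \<phi>) (chart_rep c d \<phi>)"
  by (simp add: smooth_map_iff)

lemma smooth_map_ident: "smooth_map A A (\<lambda>x. x)"
  unfolding smooth_map_def
proof (intro conjI ballI)
  fix c d assume "c \<in> A" "d \<in> A"
  then show "smooth_on (snd c ` (fst c \<inter> (\<lambda>x. x) -` fst d)) (snd d \<circ> (\<lambda>x. x) \<circ> chart_inv c)"
    using smooth_atlas unfolding smooth_atlas_def o_def vimage_ident by blast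
qed (rule continuous_on_id)

lemma smooth_map_compose:
  assumes \<phi>: "smooth_map A A \<phi>" and \<psi>: "smooth_map A A \<psi>"
  shows "smooth_map A A (\<lambda>x. \<psi> (\<phi> x))"
  unfolding smooth_map_iff
proof (intro conjI ballI)
  show cont: "continuous_on UNIV (\<lambda>x. \<psi> (\<phi> x))"
    using \<phi> \<psi> unfolding smooth_map_def by (auto intro: continuous_on_compose2)
  fix c e assume c: "c \<in> A" and e: "e \<in> A"
  have open_dom: "open (rep_domain c e (\<lambda>x. \<psi> (\<phi> x)))"
    using open_chart_preimage[OF c open_vimage[OF open_chart[OF e] cont]]
    by (simp add: rep_domain_def)
  then show "smooth_on (rep_domain c e (\<lambda>x. \<psi> (\<phi> x))) (chart_rep c e (\<lambda>x. \<psi> (\<phi> x)))"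
  proof (rule smooth_on_local)
    fix u assume u: "u \<in> rep_domain c e (\<lambda>x. \<psi> (\<phi> x))"
    define d where "d = chart_at A (\<phi> (chart_inv c u))"
    have d: "d \<in> A"
      by (simp add: d_def)
    let ?T = "rep_domain c d \<phi> \<inter> rep_domain c e (\<lambda>x. \<psi> (\<phi> x))"
    have T: "open ?T"
      using open_rep_domain[OF \<phi> c d] open_dom by blast
    moreover have "u \<in> ?T"
      using u by (auto simp: rep_domain_def d_def)
    moreover have "smooth_on ?T (chart_rep c e (\<lambda>x. \<psi> (\<phi> x)))"
    proof (rule smooth_on_cong[OF T])
      show "smooth_on ?T (\<lambda>u. chart_rep d e \<psi> (chart_rep c d \<phi> u))"
      proof (rule smooth_on_compose[OF T open_rep_domain[OF \<psi> d e] smooth_map_rep[OF \<psi> d e]])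
        show "smooth_on ?T (chart_rep c d \<phi>)"
          by (rule smooth_on_subset[OF smooth_map_rep[OF \<phi> c d] open_rep_domain[OF \<phi> c d] T]) blast
        show "chart_rep c d \<phi> ` ?T \<subseteq> rep_domain d e \<psi>"
          using d by (auto simp: rep_domain_def chart_rep_def)
      qed
      show "chart_rep d e \<psi> (chart_rep c d \<phi> u) = chart_rep c e (\<lambda>x. \<psi> (\<phi> x)) u" if "u \<in> ?T" for u
        using that d by (auto simp: rep_domain_def chart_rep_def)
    qed
    ultimately show "\<exists>T. open T \<and> u \<in> T \<and> smooth_on T (chart_rep c e (\<lambda>x. \<psi> (\<phi> x)))"
      by blast
  qed
qed

lemma chart_rep_has_derivative:
  assumes "smooth_map A A \<phi>" "c \<in> A" "d \<in> A" "p \<in> fst c" "\<phi> p \<in> fst d"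
  shows "(chart_rep c d \<phi> has_derivative chart_deriv c d \<phi> p) (at (snd c p))"
  unfolding chart_deriv_def
  using assms by (intro smooth_on_has_derivative[OF open_rep_domain smooth_map_rep] snd_in_rep_domain)

lemma chart_deriv_linear:
  assumes "smooth_map A A \<phi>" "c \<in> A" "d \<in> A" "p \<in> fst c" "\<phi> p \<in> fst d"
  shows "bounded_linear (chart_deriv c d \<phi> p)" "linear (chart_deriv c d \<phi> p)"
  using has_derivative_bounded_linear[OF chart_rep_has_derivative[OF assms]]
  by (auto intro: bounded_linear.linear)

text \<open>The chart at the intermediate point is arbitrary; choosing it suitably changes charts.\<close>

lemma chart_deriv_compose:
  assumes \<phi>: "smooth_map A A \<phi>" and \<psi>: "smooth_map A A \<psi>"
    and c: "c \<in> A" "p \<in> fst c" and d: "d \<in> A" "\<phi> p \<in> fst d" and e: "e \<in> A" "\<psi> (\<phi> p) \<in> fst e"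
  shows "chart_deriv c e (\<lambda>x. \<psi> (\<phi> x)) p v = chart_deriv d e \<psi> (\<phi> p) (chart_deriv c d \<phi> p v)"
proof -
  note D1 = chart_rep_has_derivative[OF \<phi> c(1) d(1) c(2) d(2)]
  have p: "chart_rep c d \<phi> (snd c p) = snd d (\<phi> p)"
    using c by (simp add: chart_rep_def)
  have D2: "(chart_rep d e \<psi> has_derivative chart_deriv d e \<psi> (\<phi> p)) (at (chart_rep c d \<phi> (snd c p)))"
    unfolding p using chart_rep_has_derivative[OF \<psi> d(1) e(1) d(2) e(2)] .
  have "((\<lambda>u. chart_rep d e \<psi> (chart_rep c d \<phi> u)) has_derivative
      (\<lambda>v. chart_deriv d e \<psi> (\<phi> p) (chart_deriv c d \<phi> p v))) (at (snd c p))"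
    by (rule has_derivative_compose[OF D1 D2])
  then have "(chart_rep c e (\<lambda>x. \<psi> (\<phi> x)) has_derivative
      (\<lambda>v. chart_deriv d e \<psi> (\<phi> p) (chart_deriv c d \<phi> p v))) (at (snd c p))"
  proof (rule has_derivative_transform_within_open)
    show "open (rep_domain c d \<phi>)" "snd c p \<in> rep_domain c d \<phi>"
      using open_rep_domain[OF \<phi> c(1) d(1)] snd_in_rep_domain[OF c(1), of p \<phi> d] c d by auto
    show "chart_rep d e \<psi> (chart_rep c d \<phi> u) = chart_rep c e (\<lambda>x. \<psi> (\<phi> x)) u"
      if "u \<in> rep_domain c d \<phi>" for u
      using that d by (simp add: rep_domain_def chart_rep_def)
  qed
  then show ?thesis
    unfolding chart_deriv_def[of c e] by (metis frechet_derivative_at)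
qed

lemma chart_deriv_ident:
  assumes "c \<in> A" "p \<in> fst c"
  shows "chart_deriv c c (\<lambda>x. x) p v = v"
proof -
  have "(chart_rep c c (\<lambda>x. x) has_derivative (\<lambda>v. v)) (at (snd c p))"
    using assms
    by (intro has_derivative_transform_within_open[OF has_derivative_ident open_chart_range])
      (auto simp: chart_rep_def)
  then show ?thesis
    unfolding chart_deriv_def by (metis frechet_derivative_at)
qed

lemma chart_deriv_ident_cancel:
  assumes "c \<in> A" "p \<in> fst c" "d \<in> A" "p \<in> fst d"
  shows "chart_deriv d c (\<lambda>x. x) p (chart_deriv c d (\<lambda>x. x) p v) = v"
  using chart_deriv_compose[OF smooth_map_ident smooth_map_ident assms assms(1,2), of v]
    chart_deriv_ident[OF assms(1,2)] by simp

abbreviation "T \<phi> p \<equiv> tangent_map A A \<phi> p"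

lemma tangent_map_linear:
  assumes "smooth_map A A \<phi>"
  shows "bounded_linear (T \<phi> p)" "linear (T \<phi> p)"
  unfolding tangent_map_eq_chart_deriv using chart_deriv_linear[OF assms] by simp_all

lemma tangent_map_compose:
  assumes "smooth_map A A \<phi>" "smooth_map A A \<psi>"
  shows "T (\<lambda>x. \<psi> (\<phi> x)) p v = T \<psi> (\<phi> p) (T \<phi> p v)"
  unfolding tangent_map_eq_chart_deriv by (rule chart_deriv_compose[OF assms]) simp_all

lemma tangent_map_ident: "T (\<lambda>x. x) p v = v"
  unfolding tangent_map_eq_chart_deriv by (rule chart_deriv_ident) simp_all

lemma to_chart_self: "to_chart A (chart_at A p) p v = v"
  unfolding to_chart_eq_chart_deriv by (rule chart_deriv_ident) simp_all

lemma from_chart_self: "from_chart A (chart_at A p) p v = v"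
  unfolding from_chart_eq_chart_deriv by (rule chart_deriv_ident) simp_all

lemma to_chart_linear:
  assumes "c \<in> A" "p \<in> fst c"
  shows "bounded_linear (to_chart A c p)"
  unfolding to_chart_eq_chart_deriv using assms chart_deriv_linear[OF smooth_map_ident] by simp

lemma from_chart_linear:
  assumes "c \<in> A" "p \<in> fst c"
  shows "bounded_linear (from_chart A c p)"
  unfolding from_chart_eq_chart_deriv using assms chart_deriv_linear[OF smooth_map_ident] by simp

lemma to_chart_from_chart:
  assumes "c \<in> A" "p \<in> fst c"
  shows "to_chart A c p (from_chart A c p v) = v" "from_chart A c p (to_chart A c p v) = v"
  unfolding from_chart_eq_chart_deriv to_chart_eq_chart_deriv
  using assms by (simp_all add: chart_deriv_ident_cancel)

lemma chart_deriv_eq_tangent_map: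
  assumes \<phi>: "smooth_map A A \<phi>" and "c \<in> A" "p \<in> fst c" "d \<in> A" "\<phi> p \<in> fst d"
  shows "T \<phi> p (from_chart A c p v) = from_chart A d (\<phi> p) (chart_deriv c d \<phi> p v)"
    and "chart_deriv c d \<phi> p (to_chart A c p v) = to_chart A d (\<phi> p) (T \<phi> p v)"
  unfolding from_chart_eq_chart_deriv to_chart_eq_chart_deriv tangent_map_eq_chart_deriv
  using assms
  by (simp_all flip: chart_deriv_compose[OF \<phi> smooth_map_ident] chart_deriv_compose[OF smooth_map_ident \<phi>])

lemma smooth_fun_rep: "\<lbrakk>smooth_fun A H; c \<in> A\<rbrakk> \<Longrightarrow> smooth_on (chart_range c) (\<lambda>u. H (chart_inv c u))"
  by (simp add: smooth_fun_def o_def)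

lemma smooth_fun_add: "\<lbrakk>smooth_fun A H; smooth_fun A K\<rbrakk> \<Longrightarrow> smooth_fun A (\<lambda>x. H x + K x)"
  unfolding smooth_fun_def o_def using smooth_on_add open_chart_range by blast

lemma smooth_fun_compose:
  assumes H: "smooth_fun A H" and \<phi>: "smooth_map A A \<phi>"
  shows "smooth_fun A (\<lambda>x. H (\<phi> x))"
  unfolding smooth_fun_def o_def
proof
  fix c assume c: "c \<in> A"
  show "smooth_on (chart_range c) (\<lambda>u. H (\<phi> (chart_inv c u)))"
  proof (rule smooth_on_local[OF open_chart_range[OF c]])
    fix u assume u: "u \<in> chart_range c"
    define d where "d = chart_at A (\<phi> (chart_inv c u))"
    have d: "d \<in> A"
      by (simp add: d_def)
    note dom = open_rep_domain[OF \<phi> c d]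
    have "u \<in> rep_domain c d \<phi>"
      using u by (simp add: rep_domain_def d_def)
    moreover have "smooth_on (rep_domain c d \<phi>) (\<lambda>u. H (\<phi> (chart_inv c u)))"
    proof (rule smooth_on_cong[OF dom])
      show "smooth_on (rep_domain c d \<phi>) (\<lambda>u. H (chart_inv d (chart_rep c d \<phi> u)))"
        by (rule smooth_on_compose[OF dom open_chart_range[OF d] smooth_fun_rep[OF H d] smooth_map_rep[OF \<phi> c d]])
          (auto simp: rep_domain_def chart_rep_def d)
    qed (simp add: rep_domain_def chart_rep_def d)
    ultimately show "\<exists>T. open T \<and> u \<in> T \<and> smooth_on T (\<lambda>u. H (\<phi> (chart_inv c u)))"
      using dom by blast
  qed
qed

lemma fun_rep_has_derivative:
  assumes "smooth_fun A H" "c \<in> A" "p \<in> fst c"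
  shows "((\<lambda>u. H (chart_inv c u)) has_derivative
    frechet_derivative (\<lambda>u. H (chart_inv c u)) (at (snd c p))) (at (snd c p))"
  using assms by (intro smooth_on_has_derivative[OF open_chart_range smooth_fun_rep]) simp_all

lemma differential_apply:
  assumes "smooth_fun A H"
  shows "blinfun_apply (differential A H p) v
    = frechet_derivative (\<lambda>u. H (chart_inv (chart_at A p) u)) (at (snd (chart_at A p) p)) v"
  unfolding differential_def o_def coord_at_def
  using has_derivative_bounded_linear[OF fun_rep_has_derivative[OF assms chart_at_in]]
  by (simp add: bounded_linear_Blinfun_apply)

lemma differential_compose_chart:
  assumes H: "smooth_fun A H" and \<phi>: "smooth_map A A \<phi>"
    and c: "c \<in> A" "p \<in> fst c" and d: "d \<in> A" "\<phi> p \<in> fst d"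
  shows "frechet_derivative (\<lambda>u. H (\<phi> (chart_inv c u))) (at (snd c p)) v
    = frechet_derivative (\<lambda>u. H (chart_inv d u)) (at (snd d (\<phi> p))) (chart_deriv c d \<phi> p v)"
proof -
  have p: "chart_rep c d \<phi> (snd c p) = snd d (\<phi> p)"
    using c by (simp add: chart_rep_def)
  have "((\<lambda>u. H (chart_inv d (chart_rep c d \<phi> u))) has_derivative
      (\<lambda>v. frechet_derivative (\<lambda>u. H (chart_inv d u)) (at (snd d (\<phi> p))) (chart_deriv c d \<phi> p v)))
      (at (snd c p))"
    using fun_rep_has_derivative[OF H d]
    by (intro has_derivative_compose[OF chart_rep_has_derivative[OF \<phi> c(1) d(1) c(2) d(2)],
        where g = "\<lambda>u. H (chart_inv d u)"]) (simp add: p)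
  then have "((\<lambda>u. H (\<phi> (chart_inv c u))) has_derivative
      (\<lambda>v. frechet_derivative (\<lambda>u. H (chart_inv d u)) (at (snd d (\<phi> p))) (chart_deriv c d \<phi> p v)))
      (at (snd c p))"
    using open_rep_domain[OF \<phi> c(1) d(1)] snd_in_rep_domain[OF c(1), of p \<phi> d] c d
    by (elim has_derivative_transform_within_open) (auto simp: rep_domain_def chart_rep_def)
  then show ?thesis
    by (metis frechet_derivative_at)
qed

lemma differential_compose:
  assumes H: "smooth_fun A H" and \<phi>: "smooth_map A A \<phi>"
  shows "differential A (\<lambda>x. H (\<phi> x)) p = pullback_covector (T \<phi> p) (differential A H (\<phi> p))"
proof (rule blinfun_eqI)
  fix v
  show "blinfun_apply (differential A (\<lambda>x. H (\<phi> x)) p) v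
      = blinfun_apply (pullback_covector (T \<phi> p) (differential A H (\<phi> p))) v"
    unfolding pullback_covector_apply[OF tangent_map_linear(1)[OF \<phi>]]
      differential_apply[OF H] differential_apply[OF smooth_fun_compose[OF H \<phi>]]
    unfolding tangent_map_eq_chart_deriv
    by (rule differential_compose_chart[OF H \<phi> chart_at_in chart_at_in])
qed

lemma differential_chart:
  assumes H: "smooth_fun A H" and c: "c \<in> A" "p \<in> fst c"
  shows "blinfun_apply (differential A H p) v
    = frechet_derivative (\<lambda>u. H (chart_inv c u)) (at (snd c p)) (to_chart A c p v)"
  using differential_compose_chart[OF H smooth_map_ident chart_at_in c]
  by (simp add: differential_apply[OF H] to_chart_eq_chart_deriv)

lemma differential_add:
  assumes "smooth_fun A H" "smooth_fun A K"
  shows "differential A (\<lambda>x. H x + K x) p = differential A H p + differential A K p"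
proof (rule blinfun_eqI)
  fix v
  note D = assms[THEN fun_rep_has_derivative[OF _ chart_at_in]]
  show "blinfun_apply (differential A (\<lambda>x. H x + K x) p) v
      = blinfun_apply (differential A H p + differential A K p) v"
    unfolding plus_blinfun.rep_eq differential_apply[OF assms(1)] differential_apply[OF assms(2)]
      differential_apply[OF smooth_fun_add[OF assms]]
    by (rule fun_cong[OF frechet_derivative_at[OF has_derivative_add[OF D], symmetric]])
qed

definition smooth_vector_field :: "('m \<Rightarrow> 'e) \<Rightarrow> bool" where
  "smooth_vector_field X \<longleftrightarrow> (\<forall>c\<in>A. smooth_on (chart_range c) (vector_field_in A c X))"

lemma smooth_vector_field_has_derivative:
  assumes "smooth_vector_field X" "c \<in> A" "u \<in> chart_range c"
  shows "(vector_field_in A c X has_derivative frechet_derivative (vector_field_in A c X) (at u)) (at u)"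
  using assms by (intro smooth_on_has_derivative[OF open_chart_range]) (auto simp: smooth_vector_field_def)

lemma smooth_vector_field_add:
  assumes "smooth_vector_field X" "smooth_vector_field Y"
  shows "smooth_vector_field (\<lambda>p. X p + Y p)"
  unfolding smooth_vector_field_def
proof
  fix c assume c: "c \<in> A"
  show "smooth_on (chart_range c) (vector_field_in A c (\<lambda>p. X p + Y p))"
  proof (rule smooth_on_cong[OF open_chart_range[OF c]])
    show "smooth_on (chart_range c) (\<lambda>u. vector_field_in A c X u + vector_field_in A c Y u)"
      using assms c by (intro smooth_on_add[OF open_chart_range[OF c]]) (auto simp: smooth_vector_field_def)
  next
    fix u assume "u \<in> chart_range c"
    then show "vector_field_in A c X u + vector_field_in A c Y u = vector_field_in A c (\<lambda>p. X p + Y p) u"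
      using linear_add[OF bounded_linear.linear[OF to_chart_linear[OF c chart_inv_in[OF c]]]]
      by (simp add: vector_field_in_def)
  qed
qed

text \<open>In charts the push-forward is the derivative of \<open>\<phi>\<close> applied to \<open>X\<close>, both at the image under \<open>\<theta>\<close>.\<close>

lemma smooth_vector_field_pushforward:
  assumes \<phi>: "smooth_map A A \<phi>" and \<theta>: "smooth_map A A \<theta>" and inv: "\<And>p. \<phi> (\<theta> p) = p"
    and X: "smooth_vector_field X"
  shows "smooth_vector_field (\<lambda>p. T \<phi> (\<theta> p) (X (\<theta> p)))"
  unfolding smooth_vector_field_def
proof
  fix d assume d: "d \<in> A"
  let ?Y = "\<lambda>p. T \<phi> (\<theta> p) (X (\<theta> p))"
  show "smooth_on (chart_range d) (vector_field_in A d ?Y)"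
  proof (rule smooth_on_local[OF open_chart_range[OF d]])
    fix u assume u: "u \<in> chart_range d"
    define c where "c = chart_at A (\<theta> (chart_inv d u))"
    have c: "c \<in> A"
      by (simp add: c_def)
    note dom = open_rep_domain[OF \<theta> d c]
    have "u \<in> rep_domain d c \<theta>"
      using u by (simp add: rep_domain_def c_def)
    moreover have "smooth_on (rep_domain d c \<theta>) (vector_field_in A d ?Y)"
    proof (rule smooth_on_cong[OF dom])
      let ?f = "\<lambda>y. frechet_derivative (chart_rep c d \<phi>) (at y) (vector_field_in A c X y)"
      show "smooth_on (rep_domain d c \<theta>) (\<lambda>u. ?f (chart_rep d c \<theta> u))"
      proof (rule smooth_on_compose[OF dom open_rep_domain[OF \<phi> c d] _ smooth_map_rep[OF \<theta> d c]])
        show "smooth_on (rep_domain c d \<phi>) ?f"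
          using X c
          by (intro smooth_on_derivative_apply open_rep_domain[OF \<phi> c d] smooth_map_rep[OF \<phi> c d])
            (auto simp: smooth_vector_field_def rep_domain_def
              intro!: smooth_on_subset[OF _ open_chart_range[OF c] open_rep_domain[OF \<phi> c d], unfolded rep_domain_def])
        show "chart_rep d c \<theta> ` rep_domain d c \<theta> \<subseteq> rep_domain c d \<phi>"
          using c d by (auto simp: rep_domain_def chart_rep_def inv)
      qed
    next
      fix v assume v: "v \<in> rep_domain d c \<theta>"
      let ?p = "\<theta> (chart_inv d v)"
      have p: "?p \<in> fst c" "chart_inv d v \<in> fst d"
        using v d by (auto simp: rep_domain_def)
      have "chart_rep d c \<theta> v = snd c ?p"
        by (simp add: chart_rep_def)
      then have "frechet_derivative (chart_rep c d \<phi>) (at (chart_rep d c \<theta> v)) (vector_field_in A c X (chart_rep d c \<theta> v))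
          = chart_deriv c d \<phi> ?p (to_chart A c ?p (X ?p))"
        using p c by (simp add: chart_deriv_def vector_field_in_def)
      also have "\<dots> = vector_field_in A d ?Y v"
        using chart_deriv_eq_tangent_map(2)[OF \<phi> c p(1) d, of "X ?p"] p
        by (simp add: inv vector_field_in_def)
      finally show "frechet_derivative (chart_rep c d \<phi>) (at (chart_rep d c \<theta> v)) (vector_field_in A c X (chart_rep d c \<theta> v))
          = vector_field_in A d ?Y v" .
    qed
    ultimately show "\<exists>T. open T \<and> u \<in> T \<and> smooth_on T (vector_field_in A d ?Y)"
      using dom by blast
  qed
qed

end


section \<open>The Lie derivative of a volume form\<close>

text \<open>A top-degree form is a polynomial in the coordinates of its arguments.\<close>

lemma alternating_form_has_derivative:
  fixes \<omega> :: "('n::finite \<Rightarrow> real^'n) \<Rightarrow> real"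
  assumes \<omega>: "\<omega> \<in> alternating_forms" and w: "\<And>i. (w i has_derivative w' i) (at x)"
  shows "((\<lambda>q. \<omega> (\<lambda>i. w i q)) has_derivative (\<lambda>u. \<Sum>i\<in>UNIV. \<omega> ((\<lambda>i. w i x)(i := w' i u)))) (at x)"
proof -
  define a where "a = \<omega> (\<lambda>i. axis i 1)"
  have comp: "((\<lambda>q. w i q $ j) has_derivative (\<lambda>u. w' i u $ j)) (at x)" for i j
    by (rule bounded_linear.has_derivative[OF bounded_linear_vec_nth w])
  have \<omega>_eq: "\<omega> v = (\<Sum>p | p permutes UNIV. of_int (sign p) * (\<Prod>i\<in>UNIV. v i $ p i)) * a" for v
    using alternating_form_eq_det[OF \<omega>, of v] by (simp add: det_def a_def)
  have upd: "(\<Prod>j\<in>UNIV. ((\<lambda>i. w i x)(i := z)) j $ p j) = z $ p i * (\<Prod>j\<in>UNIV - {i}. w j x $ p j)"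
    for i z and p :: "'n \<Rightarrow> 'n"
    by (subst prod.remove[of UNIV i]) (auto intro!: prod.cong)
  have "((\<lambda>q. (\<Sum>p | p permutes UNIV. of_int (sign p) * (\<Prod>i\<in>UNIV. w i q $ p i)) * a) has_derivative
      (\<lambda>u. (\<Sum>p | p permutes UNIV. of_int (sign p) *
        (\<Sum>i\<in>UNIV. w' i u $ p i * (\<Prod>j\<in>UNIV - {i}. w j x $ p j))) * a)) (at x)"
    by (intro has_derivative_mult_left has_derivative_mult_right has_derivative_sum has_derivative_prod comp)
  moreover have "(\<Sum>p | p permutes UNIV. of_int (sign p) *
        (\<Sum>i\<in>UNIV. w' i u $ p i * (\<Prod>j\<in>UNIV - {i}. w j x $ p j))) * a
      = (\<Sum>i\<in>UNIV. \<omega> ((\<lambda>i. w i x)(i := w' i u)))" for u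
    unfolding \<omega>_eq upd sum_distrib_right[symmetric] sum_distrib_left
    by (rule arg_cong[of _ _ "\<lambda>z. z * a"], rule sum.swap)
  ultimately show ?thesis
    unfolding \<omega>_eq by (simp only:)
qed

lemma smooth_on_alternating_form:
  fixes \<omega> :: "('n::finite \<Rightarrow> real^'n) \<Rightarrow> real"
  assumes \<omega>: "\<omega> \<in> alternating_forms" and S: "open S" and w: "\<And>i. smooth_on S (w i)"
  shows "smooth_on S (\<lambda>q. \<omega> (\<lambda>i. w i q))"
proof -
  have expand: "\<omega> v = (\<Sum>p | p permutes UNIV. of_int (sign p) * (\<Prod>i\<in>UNIV. v i $ p i)) * \<omega> (\<lambda>i. axis i 1)" for v
    using alternating_form_eq_det[OF \<omega>, of v] by (simp add: det_def)
  have "smooth_on S (\<lambda>q. (\<Sum>p | p permutes UNIV. of_int (sign p) * (\<Prod>i\<in>UNIV. w i q $ p i)) * \<omega> (\<lambda>i. axis i 1))"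
    by (intro smooth_on_mult[OF S] smooth_on_sum[OF S] smooth_on_prod[OF S] smooth_on_const
        smooth_on_bounded_linear_compose[OF bounded_linear_vec_nth S w])
  then show ?thesis
    by (rule smooth_on_cong[OF S]) (rule expand[symmetric])
qed

text \<open>Top-degree forms are multiples of the determinant, so this is the product rule for a scalar
  function times a constant form.\<close>

lemma alternating_form_field_has_derivative:
  fixes \<omega> :: "'a::real_normed_vector \<Rightarrow> ('n::finite \<Rightarrow> real^'n) \<Rightarrow> real"
  assumes "open S" "x \<in> S" and \<omega>: "\<And>y. y \<in> S \<Longrightarrow> \<omega> y \<in> alternating_forms"
    and diff: "\<And>v. ((\<lambda>y. \<omega> y v) has_derivative \<omega>' v) (at x)"
    and w: "\<And>i. (w i has_derivative w' i) (at x)"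
  shows "((\<lambda>y. \<omega> y (\<lambda>i. w i y)) has_derivative
    (\<lambda>u. \<omega>' (\<lambda>i. w i x) u + (\<Sum>i\<in>UNIV. \<omega> x ((\<lambda>i. w i x)(i := w' i u))))) (at x)"
proof -
  let ?e = "\<lambda>i. axis i (1::real)"
  define det0 :: "('n \<Rightarrow> real^'n) \<Rightarrow> real" where "det0 v = det (\<chi> i. v i)" for v
  have \<omega>_eq: "\<omega> y v = \<omega> y ?e * det0 v" if "y \<in> S" for y v
    using alternating_form_eq_det[OF \<omega>[OF that], of v] by (simp add: det0_def)
  show ?thesis
  proof (cases "\<exists>y\<in>S. \<omega> y ?e \<noteq> 0")
    case True
    then obtain y where y: "y \<in> S" "\<omega> y ?e \<noteq> 0"
      by blast
    \<comment> \<open>\<open>det0\<close> is itself proportional to one of the forms, hence an alternating form.\<close>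
    have det0_eq: "det0 v = inverse (\<omega> y ?e) * \<omega> y v" for v
      using \<omega>_eq[OF y(1), of v] y(2) by simp
    have det0': "((\<lambda>q. det0 (\<lambda>i. w i q)) has_derivative
        (\<lambda>u. \<Sum>i\<in>UNIV. det0 ((\<lambda>i. w i x)(i := w' i u)))) (at x)"
      unfolding det0_eq sum_distrib_left[symmetric]
      by (intro has_derivative_mult_right alternating_form_has_derivative[OF \<omega>[OF y(1)] w])
    have "((\<lambda>q. \<omega> q ?e * det0 (\<lambda>i. w i q)) has_derivative
        (\<lambda>u. \<omega> x ?e * (\<Sum>i\<in>UNIV. det0 ((\<lambda>i. w i x)(i := w' i u))) + \<omega>' ?e u * det0 (\<lambda>i. w i x))) (at x)"
      by (rule has_derivative_mult[OF diff det0'])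
    then have "((\<lambda>q. \<omega> q (\<lambda>i. w i q)) has_derivative
        (\<lambda>u. \<omega> x ?e * (\<Sum>i\<in>UNIV. det0 ((\<lambda>i. w i x)(i := w' i u))) + \<omega>' ?e u * det0 (\<lambda>i. w i x))) (at x)"
      by (rule has_derivative_transform_within_open[OF _ \<open>open S\<close> \<open>x \<in> S\<close>])
        (simp add: \<omega>_eq[symmetric])
    moreover have "\<omega>' (\<lambda>i. w i x) = (\<lambda>u. \<omega>' ?e u * det0 (\<lambda>i. w i x))"
    proof (rule has_derivative_unique[OF diff])
      show "((\<lambda>y. \<omega> y (\<lambda>i. w i x)) has_derivative (\<lambda>u. \<omega>' ?e u * det0 (\<lambda>i. w i x))) (at x)"
        by (rule has_derivative_transform_within_open[OF has_derivative_mult_left[OF diff] \<open>open S\<close> \<open>x \<in> S\<close>])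
          (simp add: \<omega>_eq[symmetric])
    qed
    moreover have "(\<Sum>i\<in>UNIV. \<omega> x ((\<lambda>i. w i x)(i := w' i u)))
        = \<omega> x ?e * (\<Sum>i\<in>UNIV. det0 ((\<lambda>i. w i x)(i := w' i u)))" for u
      unfolding sum_distrib_left by (rule sum.cong[OF refl \<omega>_eq[OF \<open>x \<in> S\<close>]])
    ultimately show ?thesis
      by (simp only: add.commute)
  next
    case False
    then have zero: "\<omega> y v = 0" if "y \<in> S" for y v
      using \<omega>_eq[OF that] that by simp
    have vanish: "((\<lambda>y. \<omega> y (W y)) has_derivative (\<lambda>_. 0)) (at x)" for W
      by (rule has_derivative_transform_within_open[OF has_derivative_const \<open>open S\<close> \<open>x \<in> S\<close>])
        (simp add: zero)
    then have "\<omega>' v = (\<lambda>_. 0)" for v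
      using has_derivative_unique[OF diff vanish[of "\<lambda>_. v"]] by simp
    then show ?thesis
      using vanish by (simp add: zero[OF \<open>x \<in> S\<close>])
  qed
qed

locale coordinate_manifold = smooth_manifold A
  for A :: "('m::{t2_space, second_countable_topology}, real^'n::finite) atlas"
begin

lemma form_in_alternating:
  assumes "volume_form A \<omega>" "c \<in> A" "u \<in> chart_range c"
  shows "form_in A c \<omega> u \<in> alternating_forms"
  unfolding form_in_def[abs_def]
proof (rule alternating_form_compose_linear)
  show "\<omega> (chart_inv c u) \<in> alternating_forms"
    using assms(1) by (simp add: volume_form_def)
  show "linear (from_chart A c (chart_inv c u))"
    using from_chart_linear[OF assms(2) chart_inv_in[OF assms(2,3)]] by (rule bounded_linear.linear)
qed

lemma form_in_has_derivative:
  assumes "volume_form A \<omega>" "c \<in> A" "u \<in> chart_range c"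
  shows "((\<lambda>q. form_in A c \<omega> q v) has_derivative frechet_derivative (\<lambda>q. form_in A c \<omega> q v) (at u)) (at u)"
proof (rule smooth_on_has_derivative[OF open_chart_range[OF assms(2)] _ assms(3)])
  show "smooth_on (chart_range c) (\<lambda>q. form_in A c \<omega> q v)"
    using assms(1,2) unfolding volume_form_def by blast
qed

lemma lie_derivative_eq:
  "lie_derivative A X \<omega> p v =
    frechet_derivative (\<lambda>q. form_in A (chart_at A p) \<omega> q v) (at (snd (chart_at A p) p))
      (vector_field_in A (chart_at A p) X (snd (chart_at A p) p)) +
    (\<Sum>i\<in>UNIV. form_in A (chart_at A p) \<omega> (snd (chart_at A p) p)
      (v(i := frechet_derivative (vector_field_in A (chart_at A p) X) (at (snd (chart_at A p) p)) (v i))))"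
  by (simp add: lie_derivative_def Let_def coord_at_def)

lemma vector_field_in_chart_at: "vector_field_in A (chart_at A p) X (snd (chart_at A p) p) = X p"
  by (simp add: vector_field_in_def to_chart_self)

lemma form_in_chart_at: "form_in A (chart_at A p) \<omega> (snd (chart_at A p) p) v = \<omega> p v"
  by (simp add: form_in_def from_chart_self)

lemma lie_derivative_add:
  assumes \<omega>: "volume_form A \<omega>" and X: "smooth_vector_field X" and Y: "smooth_vector_field Y"
  shows "lie_derivative A (\<lambda>p. X p + Y p) \<omega> p v = lie_derivative A X \<omega> p v + lie_derivative A Y \<omega> p v"
proof -
  define c where "c = chart_at A p"
  define x where "x = snd c p"
  have c: "c \<in> A" "p \<in> fst c" and x: "x \<in> chart_range c"
    by (simp_all add: c_def x_def)
  let ?X = "vector_field_in A c X" and ?Y = "vector_field_in A c Y"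
  let ?F = "frechet_derivative (\<lambda>q. form_in A c \<omega> q v) (at x)"
  have XY: "vector_field_in A c (\<lambda>p. X p + Y p) u = ?X u + ?Y u" if "u \<in> chart_range c" for u
    using linear_add[OF bounded_linear.linear[OF to_chart_linear[OF c(1) chart_inv_in[OF c(1) that]]]]
    by (simp add: vector_field_in_def)
  note DX = smooth_vector_field_has_derivative[OF X c(1) x]
  note DY = smooth_vector_field_has_derivative[OF Y c(1) x]
  have "frechet_derivative (vector_field_in A c (\<lambda>p. X p + Y p)) (at x)
      = frechet_derivative (\<lambda>u. ?X u + ?Y u) (at x)"
    using XY by (intro frechet_derivative_cong_open[OF has_derivative_add[OF DX DY] open_chart_range[OF c(1)] x]) simp
  also have "\<dots> = (\<lambda>w. frechet_derivative ?X (at x) w + frechet_derivative ?Y (at x) w)"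
    using frechet_derivative_at[OF has_derivative_add[OF DX DY]] by simp
  finally have D: "frechet_derivative (vector_field_in A c (\<lambda>p. X p + Y p)) (at x)
      = (\<lambda>w. frechet_derivative ?X (at x) w + frechet_derivative ?Y (at x) w)" .
  note lin = linear_add[OF alternating_form_linear[OF form_in_alternating[OF \<omega> c(1) x]]]
  have "?F (?X x + ?Y x) = ?F (?X x) + ?F (?Y x)"
    using linear_add[OF has_derivative_linear[OF form_in_has_derivative[OF \<omega> c(1) x]]] .
  then show ?thesis
    unfolding lie_derivative_eq c_def[symmetric] x_def[symmetric] XY[OF x] D lin sum.distrib by simp
qed

lemma lie_derivative_uminus_args:
  assumes \<omega>: "volume_form A \<omega>" and X: "smooth_vector_field X"
  shows "lie_derivative A X \<omega> p (\<lambda>i. - v i) = (- 1) ^ CARD('n) * lie_derivative A X \<omega> p v"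
proof -
  define c where "c = chart_at A p"
  define x where "x = snd c p"
  have c: "c \<in> A" "p \<in> fst c" and x: "x \<in> chart_range c"
    by (simp_all add: c_def x_def)
  let ?X' = "frechet_derivative (vector_field_in A c X) (at x)"
  let ?s = "(- 1) ^ CARD('n) :: real"
  note neg = alternating_form_uminus[OF form_in_alternating[OF \<omega> c(1)]]
  have "frechet_derivative (\<lambda>q. form_in A c \<omega> q (\<lambda>i. - v i)) (at x)
      = frechet_derivative (\<lambda>q. ?s * form_in A c \<omega> q v) (at x)"
    by (rule frechet_derivative_cong_open[OF has_derivative_mult_right[OF form_in_has_derivative[OF \<omega> c(1) x]]
          open_chart_range[OF c(1)] x]) (simp add: neg)
  also have "\<dots> = (\<lambda>w. ?s * frechet_derivative (\<lambda>q. form_in A c \<omega> q v) (at x) w)"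
    using frechet_derivative_at[OF has_derivative_mult_right[OF form_in_has_derivative[OF \<omega> c(1) x]]] by simp
  finally have D: "frechet_derivative (\<lambda>q. form_in A c \<omega> q (\<lambda>i. - v i)) (at x)
      = (\<lambda>w. ?s * frechet_derivative (\<lambda>q. form_in A c \<omega> q v) (at x) w)" .
  have "(\<lambda>i. - v i)(i := ?X' (- v i)) = (\<lambda>j. - (v(i := ?X' (v i))) j)" for i
    using linear_neg[OF has_derivative_linear[OF smooth_vector_field_has_derivative[OF X c(1) x]]]
    by (simp add: fun_eq_iff)
  then have "form_in A c \<omega> x ((\<lambda>i. - v i)(i := ?X' (- v i))) = ?s * form_in A c \<omega> x (v(i := ?X' (v i)))" for i
    using neg[OF x, of "v(i := ?X' (v i))"] by simp
  then show ?thesis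
    unfolding lie_derivative_eq c_def[symmetric] x_def[symmetric] D
    by (simp only: distrib_left sum_distrib_left)
qed

text \<open>Where \<open>X\<close> vanishes only its linearisation contributes, and on top-degree forms this acts by
  its trace.\<close>

lemma lie_derivative_at_zero:
  assumes \<omega>: "volume_form A \<omega>" and X: "smooth_vector_field X" and "X p = 0"
  shows "lie_derivative A X \<omega> p v = (\<Sum>i\<in>UNIV. frechet_derivative (vector_field_in A (chart_at A p) X)
    (at (snd (chart_at A p) p)) (axis i 1) $ i) * \<omega> p v"
proof -
  define c where "c = chart_at A p"
  define x where "x = snd c p"
  have c: "c \<in> A" "p \<in> fst c" and x: "x \<in> chart_range c"
    by (simp_all add: c_def x_def)
  have "vector_field_in A c X x = 0"
    using vector_field_in_chart_at[of p X] assms(3) by (simp add: c_def x_def)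
  moreover have "frechet_derivative (\<lambda>q. form_in A c \<omega> q v) (at x) 0 = 0"
    using linear_0[OF has_derivative_linear[OF form_in_has_derivative[OF \<omega> c(1) x]]] .
  ultimately show ?thesis
    unfolding lie_derivative_eq c_def[symmetric] x_def[symmetric]
    using alternating_form_trace[OF form_in_alternating[OF \<omega> c(1) x]
        has_derivative_linear[OF smooth_vector_field_has_derivative[OF X c(1) x]], of v]
      form_in_chart_at[of p \<omega> v]
    by (simp add: c_def x_def)
qed

text \<open>Let \<open>\<psi>\<close> represent \<open>\<phi>\<close> in charts. Differentiating \<open>Y \<circ> \<psi> = D\<psi> X\<close> produces second derivatives of \<open>\<psi>\<close>,
  and so does differentiating the pulled-back form along \<open>X\<close>. Since second derivatives are symmetric,
  the two contributions agree, and the two sides match term by term.\<close>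

lemma lie_derivative_natural:
  assumes \<phi>: "smooth_map A A \<phi>" and \<omega>: "volume_form A \<omega>"
    and X: "smooth_vector_field X" and Y: "smooth_vector_field Y"
    and related: "\<And>p. Y (\<phi> p) = T \<phi> p (X p)"
    and invariant: "\<And>p v. \<omega> (\<phi> p) (\<lambda>i. T \<phi> p (v i)) = k * \<omega> p v"
  shows "lie_derivative A Y \<omega> (\<phi> p) (\<lambda>i. T \<phi> p (v i)) = k * lie_derivative A X \<omega> p v"
proof -
  define c where "c = chart_at A p"
  define d where "d = chart_at A (\<phi> p)"
  define x where "x = snd c p"
  define \<psi> where "\<psi> = chart_rep c d \<phi>"
  define U where "U = rep_domain c d \<phi>"
  have c: "c \<in> A" "p \<in> fst c" and d: "d \<in> A" "\<phi> p \<in> fst d" and x: "x \<in> chart_range c"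
    by (simp_all add: c_def d_def x_def)
  have U: "open U" "x \<in> U"
    using open_rep_domain[OF \<phi> c(1) d(1)] snd_in_rep_domain[OF c(1), of p \<phi> d] c d
    by (auto simp: U_def x_def)
  have in_U: "u \<in> chart_range c" "\<psi> u \<in> chart_range d" "\<phi> (chart_inv c u) \<in> fst d"
    "chart_inv d (\<psi> u) = \<phi> (chart_inv c u)" if "u \<in> U" for u
    using that d by (auto simp: U_def rep_domain_def \<psi>_def chart_rep_def)
  have \<psi>x: "\<psi> x = snd d (\<phi> p)"
    using c by (simp add: \<psi>_def chart_rep_def x_def)
  have s\<psi>: "smooth_on U \<psi>"
    unfolding U_def \<psi>_def by (rule smooth_map_rep[OF \<phi> c(1) d(1)])
  let ?D = "\<lambda>u. frechet_derivative \<psi> (at u)"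
  let ?X = "vector_field_in A c X" and ?Y = "vector_field_in A d Y"
  let ?X' = "frechet_derivative ?X (at x)" and ?Y' = "frechet_derivative ?Y (at (\<psi> x))"
  let ?\<omega>c = "form_in A c \<omega>" and ?\<omega>d = "form_in A d \<omega>"
  let ?DD = "\<lambda>a. frechet_derivative (\<lambda>y. ?D y a) (at x)"
  have D_eq: "?D u = chart_deriv c d \<phi> (chart_inv c u)" if "u \<in> U" for u
    using in_U(1)[OF that] c by (simp add: chart_deriv_def \<psi>_def)
  have D: "(\<psi> has_derivative ?D x) (at x)"
    by (rule smooth_on_has_derivative[OF U(1) s\<psi> U(2)])
  have Dx: "?D x = T \<phi> p"
    unfolding D_eq[OF U(2)] tangent_map_eq_chart_deriv
    using c by (simp add: x_def c_def d_def)
  have YX: "?Y (\<psi> u) = ?D u (?X u)" if "u \<in> U" for u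
    unfolding vector_field_in_def in_U(4)[OF that] related D_eq[OF that]
    using in_U[OF that] c d chart_deriv_eq_tangent_map(2)[OF \<phi> c(1) _ d(1)] by simp
  have \<omega>cd: "?\<omega>d (\<psi> u) (\<lambda>i. ?D u (w i)) = k * ?\<omega>c u w" if "u \<in> U" for u w
    unfolding form_in_def in_U(4)[OF that] D_eq[OF that] invariant[symmetric]
    using in_U[OF that] c d chart_deriv_eq_tangent_map(1)[OF \<phi> c(1) _ d(1)] by simp
  have \<psi>x_range: "\<psi> x \<in> chart_range d"
    using in_U(2)[OF U(2)] .
  note DX = smooth_vector_field_has_derivative[OF X c(1) x]
  note DY = smooth_vector_field_has_derivative[OF Y d(1) \<psi>x_range]
  have Y': "?Y' (?D x w) = ?DD (?X x) w + ?D x (?X' w)" for w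
  proof -
    have "((\<lambda>u. ?Y (\<psi> u)) has_derivative (\<lambda>w. ?Y' (?D x w))) (at x)"
      by (rule has_derivative_compose[OF D DY])
    moreover have "((\<lambda>u. ?Y (\<psi> u)) has_derivative (\<lambda>w. ?DD (?X x) w + ?D x (?X' w))) (at x)"
      by (rule has_derivative_transform_within_open[OF second_derivative_apply[OF U(1) s\<psi> U(2) DX] U])
        (simp add: YX)
    ultimately show ?thesis
      by (rule fun_cong[OF has_derivative_unique])
  qed
  let ?w = "\<lambda>i. ?D x (v i)"
  let ?F = "frechet_derivative (\<lambda>q. ?\<omega>d q ?w) (at (\<psi> x))"
  let ?G = "frechet_derivative (\<lambda>q. ?\<omega>c q v) (at x)"
  have G: "k * ?G u = ?F (?D x u) + (\<Sum>i\<in>UNIV. ?\<omega>d (\<psi> x) (?w(i := ?DD (v i) u)))" for u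
  proof -
    have "((\<lambda>u. ?\<omega>d (\<psi> u) (\<lambda>i. ?D u (v i))) has_derivative
        (\<lambda>u. ?F (?D x u) + (\<Sum>i\<in>UNIV. ?\<omega>d (\<psi> x) (?w(i := ?DD (v i) u))))) (at x)"
    proof (rule alternating_form_field_has_derivative[OF U])
      show "?\<omega>d (\<psi> u) \<in> alternating_forms" if "u \<in> U" for u
        by (rule form_in_alternating[OF \<omega> d(1) in_U(2)[OF that]])
      show "((\<lambda>u. ?\<omega>d (\<psi> u) w) has_derivative
          (\<lambda>u. frechet_derivative (\<lambda>q. ?\<omega>d q w) (at (\<psi> x)) (?D x u))) (at x)" for w
        by (rule has_derivative_compose[OF D form_in_has_derivative[OF \<omega> d(1) \<psi>x_range]])
      show "((\<lambda>u. ?D u (v i)) has_derivative ?DD (v i)) (at x)" for i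
        by (rule smooth_on_has_derivative[OF U(1) smooth_on_derivative[OF s\<psi>] U(2)])
    qed
    moreover have "((\<lambda>u. ?\<omega>d (\<psi> u) (\<lambda>i. ?D u (v i))) has_derivative (\<lambda>u. k * ?G u)) (at x)"
      by (rule has_derivative_transform_within_open[OF has_derivative_mult_right[OF form_in_has_derivative[OF \<omega> c(1) x]] U])
        (simp add: \<omega>cd)
    ultimately show ?thesis
      by (rule fun_cong[OF has_derivative_unique, symmetric])
  qed
  have upd: "?\<omega>d (\<psi> x) (?w(i := ?D x z)) = k * ?\<omega>c x (v(i := z))" for i z
  proof -
    have "?w(i := ?D x z) = (\<lambda>j. ?D x ((v(i := z)) j))"
      by (simp add: fun_eq_iff)
    then show ?thesis
      using \<omega>cd[OF U(2), of "v(i := z)"] by simp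
  qed
  have "lie_derivative A Y \<omega> (\<phi> p) (\<lambda>i. T \<phi> p (v i))
      = ?F (?Y (\<psi> x)) + (\<Sum>i\<in>UNIV. ?\<omega>d (\<psi> x) (?w(i := ?Y' (?w i))))"
    unfolding lie_derivative_eq d_def[symmetric] \<psi>x[symmetric] Dx[symmetric] by simp
  also have "\<dots> = ?F (?D x (?X x)) + (\<Sum>i\<in>UNIV. ?\<omega>d (\<psi> x) (?w(i := ?DD (v i) (?X x)))) +
      (\<Sum>i\<in>UNIV. ?\<omega>d (\<psi> x) (?w(i := ?D x (?X' (v i)))))"
  proof -
    note lin = linear_add[OF alternating_form_linear[OF form_in_alternating[OF \<omega> d(1) \<psi>x_range]]]
    have "?DD (?X x) (v i) = ?DD (v i) (?X x)" for i
      by (rule second_derivative_symmetric[OF U(1) s\<psi> U(2)])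
    then have "?\<omega>d (\<psi> x) (?w(i := ?Y' (?w i))) = ?\<omega>d (\<psi> x) (?w(i := ?DD (v i) (?X x))) +
        ?\<omega>d (\<psi> x) (?w(i := ?D x (?X' (v i))))" for i
      using lin[of ?w i "?DD (v i) (?X x)" "?D x (?X' (v i))"] by (simp only: Y')
    then show ?thesis
      unfolding YX[OF U(2)] by (simp only: sum.distrib add.assoc)
  qed
  also have "\<dots> = k * ?G (?X x) + (\<Sum>i\<in>UNIV. k * ?\<omega>c x (v(i := ?X' (v i))))"
    by (simp only: G upd)
  also have "\<dots> = k * lie_derivative A X \<omega> p v"
    unfolding lie_derivative_eq c_def[symmetric] x_def[symmetric] by (simp only: distrib_left sum_distrib_left)
  finally show ?thesis .
qed

end


section \<open>Hamiltonian vector fields\<close>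

locale bivector_manifold = coordinate_manifold A
  for A :: "('m::{t2_space, second_countable_topology}, real^'n::finite) atlas" +
  fixes P :: "('m, real^'n) bivector_field"
  assumes bivector: "bivector_field A P"
begin

abbreviation "ham H \<equiv> hamiltonian_vector_field A P H"

lemma bivector_bilinear: "bilinear (P p)"
  using bivector by (simp add: bivector_field_def)

lemma bivector_antisym: "P p \<alpha> \<beta> = - P p \<beta> \<alpha>"
proof -
  have l: "linear (P p \<gamma>)" "linear (\<lambda>\<gamma>'. P p \<gamma>' \<gamma>)" for \<gamma>
    using bivector_bilinear by (auto simp: bilinear_def)
  have "0 = P p (\<alpha> + \<beta>) (\<alpha> + \<beta>)"
    using bivector by (simp add: bivector_field_def)
  also have "\<dots> = P p \<alpha> \<alpha> + P p \<alpha> \<beta> + (P p \<beta> \<alpha> + P p \<beta> \<beta>)"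
    by (simp add: linear_add[OF l(1)] linear_add[OF l(2)])
  finally show ?thesis
    using bivector by (simp add: bivector_field_def)
qed

lemma ham_apply: "blinfun_apply \<beta> (ham H p) = P p (differential A H p) \<beta>"
  unfolding hamiltonian_vector_field_def by (rule sharp_apply[OF bivector_bilinear])

lemma ham_add:
  assumes "smooth_fun A H" "smooth_fun A K"
  shows "ham (\<lambda>x. H x + K x) p = ham H p + ham K p"
proof (rule covector_determines_vector)
  fix \<beta> :: "(real^'n) dual"
  have "linear (\<lambda>\<alpha>. P p \<alpha> \<beta>)"
    using bivector_bilinear by (simp add: bilinear_def)
  then show "blinfun_apply \<beta> (ham (\<lambda>x. H x + K x) p) = blinfun_apply \<beta> (ham H p + ham K p)"
    by (simp add: ham_apply blinfun.add_right differential_add[OF assms] linear_add[of "\<lambda>\<alpha>. P p \<alpha> \<beta>"])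
qed

definition component :: "('m, real^'n) chart \<Rightarrow> 'n \<Rightarrow> 'n \<Rightarrow> real^'n \<Rightarrow> real" where
  "component c i j u = bivector_in A c P u (covec (axis i 1)) (covec (axis j 1))"

lemma component_antisym: "component c i j u = - component c j i u"
  unfolding component_def bivector_in_def by (rule bivector_antisym)

lemma component_smooth: "c \<in> A \<Longrightarrow> smooth_on (chart_range c) (component c i j)"
  using bivector unfolding bivector_field_def component_def[abs_def] by blast

lemma ham_in_chart:
  assumes H: "smooth_fun A H" and c: "c \<in> A" and u: "u \<in> chart_range c"
  shows "vector_field_in A c (ham H) u $ j =
    (\<Sum>i\<in>UNIV. frechet_derivative (\<lambda>u. H (chart_inv c u)) (at u) (axis i 1) * component c i j u)"
proof -
  let ?p = "chart_inv c u"
  define L where "L = to_chart A c ?p"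
  have p: "?p \<in> fst c" "snd c ?p = u"
    using c u by simp_all
  have L: "bounded_linear L"
    unfolding L_def by (rule to_chart_linear[OF c p(1)])
  define dH where "dH = Blinfun (frechet_derivative (\<lambda>u. H (chart_inv c u)) (at u))"
  have dH: "blinfun_apply dH v = frechet_derivative (\<lambda>u. H (chart_inv c u)) (at u) v" for v
    unfolding dH_def
    using has_derivative_bounded_linear[OF fun_rep_has_derivative[OF H c p(1)]]
    by (simp add: bounded_linear_Blinfun_apply p)
  have d: "differential A H ?p = pullback_covector L dH"
    by (rule blinfun_eqI) (simp add: L dH differential_chart[OF H c p(1)] p(2) flip: L_def)
  have "vector_field_in A c (ham H) u $ j = blinfun_apply (pullback_covector L (covec (axis j 1))) (ham H ?p)"
    by (simp add: L vector_field_in_def L_def[symmetric] inner_axis')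
  also have "\<dots> = P ?p (pullback_covector L dH) (pullback_covector L (covec (axis j 1)))"
    by (simp add: ham_apply d)
  also have "\<dots> = (\<Sum>i\<in>UNIV. blinfun_apply dH (axis i 1) * component c i j u)"
  proof -
    have "linear (\<lambda>\<alpha>. P ?p \<alpha> \<beta>)" for \<beta>
      using bivector_bilinear by (simp add: bilinear_def)
    from linear_compose[OF pullback_covector_linear[OF L] this]
    have "linear (\<lambda>\<alpha>. P ?p (pullback_covector L \<alpha>) (pullback_covector L (covec (axis j 1))))"
      by (simp add: o_def)
    from linear_covec_expansion[OF this, of dH] show ?thesis
      unfolding component_def bivector_in_def L_def .
  qed
  finally show ?thesis
    by (simp add: dH)
qed

lemma ham_smooth:
  assumes H: "smooth_fun A H"
  shows "smooth_vector_field (ham H)"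
  unfolding smooth_vector_field_def
proof
  fix c assume c: "c \<in> A"
  note O = open_chart_range[OF c]
  show "smooth_on (chart_range c) (vector_field_in A c (ham H))"
  proof (rule smooth_on_vec_lambda[OF O], rule smooth_on_cong[OF O])
    fix j
    show "smooth_on (chart_range c) (\<lambda>u. \<Sum>i\<in>UNIV.
        frechet_derivative (\<lambda>u. H (chart_inv c u)) (at u) (axis i 1) * component c i j u)"
      by (intro smooth_on_sum[OF O] smooth_on_mult[OF O] smooth_on_derivative smooth_fun_rep[OF H c] component_smooth[OF c])
  qed (simp add: ham_in_chart[OF H c])
qed

lemma ham_derivative:
  assumes H: "smooth_fun A H" and c: "c \<in> A" and u: "u \<in> chart_range c"
  defines "h \<equiv> \<lambda>u. H (chart_inv c u)"
  shows "frechet_derivative (vector_field_in A c (ham H)) (at u) v $ j =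
    (\<Sum>i\<in>UNIV. frechet_derivative h (at u) (axis i 1) * frechet_derivative (component c i j) (at u) v +
       frechet_derivative (\<lambda>u. frechet_derivative h (at u) (axis i 1)) (at u) v * component c i j u)"
proof -
  note O = open_chart_range[OF c]
  have h: "smooth_on (chart_range c) h"
    unfolding h_def by (rule smooth_fun_rep[OF H c])
  have "((\<lambda>u. \<Sum>i\<in>UNIV. frechet_derivative h (at u) (axis i 1) * component c i j u) has_derivative
      (\<lambda>v. \<Sum>i\<in>UNIV. frechet_derivative h (at u) (axis i 1) * frechet_derivative (component c i j) (at u) v +
       frechet_derivative (\<lambda>u. frechet_derivative h (at u) (axis i 1)) (at u) v * component c i j u)) (at u)"
    by (intro has_derivative_sum has_derivative_mult smooth_on_has_derivative[OF O _ u]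
        smooth_on_derivative h component_smooth[OF c])
  then have "((\<lambda>u. vector_field_in A c (ham H) u $ j) has_derivative
      (\<lambda>v. \<Sum>i\<in>UNIV. frechet_derivative h (at u) (axis i 1) * frechet_derivative (component c i j) (at u) v +
       frechet_derivative (\<lambda>u. frechet_derivative h (at u) (axis i 1)) (at u) v * component c i j u)) (at u)"
    by (rule has_derivative_transform_within_open[OF _ O u]) (simp add: ham_in_chart[OF H c] h_def)
  moreover have "((\<lambda>u. vector_field_in A c (ham H) u $ j) has_derivative
      (\<lambda>v. frechet_derivative (vector_field_in A c (ham H)) (at u) v $ j)) (at u)"
    by (rule bounded_linear.has_derivative[OF bounded_linear_vec_nth
          smooth_vector_field_has_derivative[OF ham_smooth[OF H] c u]])
  ultimately show ?thesis
    by (rule fun_cong[OF has_derivative_unique, symmetric])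
qed

text \<open>The linearisation of the Hamiltonian field at a critical point is the Hessian followed by
  \<open>P\<^sup>\<sharp>\<close>. Its trace pairs a symmetric with an antisymmetric matrix.\<close>

lemma lie_derivative_ham_critical:
  assumes \<omega>: "volume_form A \<omega>" and H: "smooth_fun A H" and crit: "differential A H p = 0"
  shows "lie_derivative A (ham H) \<omega> p v = 0"
proof -
  define c where "c = chart_at A p"
  define x where "x = snd c p"
  have c: "c \<in> A" "p \<in> fst c" and x: "x \<in> chart_range c"
    by (simp_all add: c_def x_def)
  define h where "h = (\<lambda>u. H (chart_inv c u))"
  define hess where "hess i j = frechet_derivative (\<lambda>u. frechet_derivative h (at u) (axis i 1)) (at x) (axis j 1)"
    for i j :: 'n
  have "linear (\<lambda>\<alpha>. P p \<alpha> \<beta>)" for \<beta>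
    using bivector_bilinear by (simp add: bilinear_def)
  then have "ham H p = 0"
    by (intro covector_determines_vector) (simp add: ham_apply crit linear_0[of "\<lambda>\<alpha>. P p \<alpha> _"])
  have dh: "frechet_derivative h (at x) w = 0" for w
    using differential_apply[OF H, of p w] by (simp add: crit h_def c_def x_def)
  have "hess i j = hess j i" for i j
    unfolding hess_def h_def
    by (rule second_derivative_symmetric[OF open_chart_range[OF c(1)] smooth_fun_rep[OF H c(1)] x])
  then have swap: "hess i j * component c i j x = - (hess j i * component c j i x)" for i j
    using component_antisym[of c i j x] by simp
  have "(\<Sum>j\<in>UNIV. frechet_derivative (vector_field_in A c (ham H)) (at x) (axis j 1) $ j)
      = (\<Sum>j\<in>UNIV. \<Sum>i\<in>UNIV. hess i j * component c i j x)"
    unfolding ham_derivative[OF H c(1) x] by (simp add: dh hess_def flip: h_def)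
  also have "\<dots> = 0"
  proof -
    let ?S = "\<Sum>j\<in>UNIV. \<Sum>i\<in>UNIV. hess i j * component c i j x"
    have "?S = (\<Sum>i\<in>UNIV. \<Sum>j\<in>UNIV. hess i j * component c i j x)"
      by (rule sum.swap)
    also have "\<dots> = - ?S"
      by (subst swap) (simp only: sum_negf)
    finally show ?thesis
      by simp
  qed
  finally show ?thesis
    unfolding lie_derivative_at_zero[OF \<omega> ham_smooth[OF H] \<open>ham H p = 0\<close>] by (simp add: c_def x_def)
qed

text \<open>Where \<open>P\<close> vanishes the Hessian drops out, and the linearisation of the Hamiltonian field
  involves the first derivatives of \<open>P\<close> only.\<close>

lemma lie_derivative_ham_at_zero:
  assumes \<omega>: "volume_form A \<omega>" and H: "smooth_fun A H"
    and zero: "\<And>\<alpha> \<beta>. P p \<alpha> \<beta> = 0"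
    and trace: "\<And>i. (\<Sum>j\<in>UNIV. frechet_derivative (component (chart_at A p) i j) (at (snd (chart_at A p) p)) (axis j 1)) = 0"
  shows "lie_derivative A (ham H) \<omega> p v = 0"
proof -
  define c where "c = chart_at A p"
  define x where "x = snd c p"
  have c: "c \<in> A" "p \<in> fst c" and x: "x \<in> chart_range c"
    by (simp_all add: c_def x_def)
  have ham0: "ham H p = 0"
    by (intro covector_determines_vector) (simp add: ham_apply zero)
  have comp: "component c i j x = 0" for i j
    using c by (simp add: component_def bivector_in_def x_def zero)
  let ?h = "\<lambda>i. frechet_derivative (\<lambda>u. H (chart_inv c u)) (at x) (axis i 1)"
  have "(\<Sum>j\<in>UNIV. frechet_derivative (vector_field_in A c (ham H)) (at x) (axis j 1) $ j)
      = (\<Sum>j\<in>UNIV. \<Sum>i\<in>UNIV. ?h i * frechet_derivative (component c i j) (at x) (axis j 1))"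
    unfolding ham_derivative[OF H c(1) x] by (simp add: comp)
  also have "\<dots> = (\<Sum>i\<in>UNIV. ?h i * (\<Sum>j\<in>UNIV. frechet_derivative (component c i j) (at x) (axis j 1)))"
    unfolding sum_distrib_left by (rule sum.swap)
  also have "\<dots> = 0"
    using trace by (simp add: c_def x_def)
  finally show ?thesis
    unfolding lie_derivative_at_zero[OF \<omega> ham_smooth[OF H] ham0] by (simp add: c_def x_def)
qed

end

text \<open>The structure constants of the bracket on the dual are the first derivatives of the
  components of \<open>P\<close>; this identifies the traces that occur in \<open>lie_derivative_ham_at_zero\<close>.\<close>

lemma endo_trace_dual_bracket:
  fixes A :: "('m::{t2_space, second_countable_topology}, real^'n::finite) atlas"
  assumes "bivector_manifold A P"
  shows "endo_trace UNIV (dual_bracket A p P (covec (axis i 1))) =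
    (\<Sum>j\<in>UNIV. frechet_derivative (bivector_manifold.component A P (chart_at A p) i j)
      (at (snd (chart_at A p) p)) (axis j 1))"
proof -
  interpret bivector_manifold A P
    by (rule assms)
  define c where "c = chart_at A p"
  define x where "x = snd c p"
  have c: "c \<in> A" "p \<in> fst c" and x: "x \<in> chart_range c"
    by (simp_all add: c_def x_def)
  let ?B = "\<lambda>\<alpha> \<beta> q. bivector_in A c P q \<alpha> \<beta>"
  have smooth: "smooth_on (chart_range c) (?B \<alpha> \<beta>)" for \<alpha> \<beta>
    using bivector c unfolding bivector_field_def by blast
  note D = smooth_on_has_derivative[OF open_chart_range[OF c(1)] smooth x]
  have br: "blinfun_apply (dual_bracket A p P \<alpha> \<beta>) v = frechet_derivative (?B \<alpha> \<beta>) (at x) v" for \<alpha> \<beta> v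
    unfolding dual_bracket_def cobracket_def coord_at_def c_def[symmetric] x_def[symmetric]
    by (subst bounded_linear_Blinfun_apply[OF has_derivative_bounded_linear[OF D]]) simp
  have lin: "linear (\<lambda>\<beta>. ?B \<alpha> \<beta> q)" if "q \<in> chart_range c" for \<alpha> q
  proof -
    have "linear (P (chart_inv c q) \<gamma>)" for \<gamma>
      using bivector_bilinear by (simp add: bilinear_def)
    from linear_compose[OF pullback_covector_linear[OF to_chart_linear[OF c(1) chart_inv_in[OF c(1) that]]] this]
    show ?thesis
      by (simp add: bivector_in_def o_def)
  qed
  have "linear (dual_bracket A p P \<alpha>)" for \<alpha>
  proof (rule linearI; rule blinfun_eqI)
    fix \<beta> \<gamma> v
    have "frechet_derivative (?B \<alpha> (\<beta> + \<gamma>)) (at x) = frechet_derivative (\<lambda>q. ?B \<alpha> \<beta> q + ?B \<alpha> \<gamma> q) (at x)"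
      by (rule frechet_derivative_cong_open[OF has_derivative_add[OF D D] open_chart_range[OF c(1)] x])
        (simp add: linear_add[OF lin])
    also have "\<dots> = (\<lambda>v. frechet_derivative (?B \<alpha> \<beta>) (at x) v + frechet_derivative (?B \<alpha> \<gamma>) (at x) v)"
      by (rule frechet_derivative_at[OF has_derivative_add[OF D D], symmetric])
    finally show "blinfun_apply (dual_bracket A p P \<alpha> (\<beta> + \<gamma>)) v
        = blinfun_apply (dual_bracket A p P \<alpha> \<beta> + dual_bracket A p P \<alpha> \<gamma>) v"
      by (simp add: br plus_blinfun.rep_eq)
  next
    fix r \<beta> v
    have "frechet_derivative (?B \<alpha> (r *\<^sub>R \<beta>)) (at x) = frechet_derivative (\<lambda>q. r * ?B \<alpha> \<beta> q) (at x)"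
      by (rule frechet_derivative_cong_open[OF has_derivative_mult_right[OF D] open_chart_range[OF c(1)] x])
        (simp add: linear_scale[OF lin])
    also have "\<dots> = (\<lambda>v. r * frechet_derivative (?B \<alpha> \<beta>) (at x) v)"
      by (rule frechet_derivative_at[OF has_derivative_mult_right[OF D], symmetric])
    finally show "blinfun_apply (dual_bracket A p P \<alpha> (r *\<^sub>R \<beta>)) v
        = blinfun_apply (r *\<^sub>R dual_bracket A p P \<alpha> \<beta>) v"
      by (simp add: br scaleR_blinfun.rep_eq)
  qed
  from endo_trace_dual[OF this] show ?thesis
    by (simp add: br component_def[abs_def] c_def x_def)
qed


section \<open>Lie groups\<close>

locale lie_group_manifold = coordinate_manifold A
  for A :: "('m::{t2_space, second_countable_topology}, real^'n::finite) atlas" +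
  fixes mul :: "'m \<Rightarrow> 'm \<Rightarrow> 'm" and one :: 'm and invs :: "'m \<Rightarrow> 'm"
  assumes lie_group: "lie_group A mul one invs"
begin

sublocale G: Groups.group mul one invs
  using lie_group by (simp add: lie_group_def)

abbreviation "L g \<equiv> \<lambda>x. mul g x"
abbreviation "R g \<equiv> \<lambda>x. mul x g"

lemma mul_cancel [simp]: "mul (invs g) (mul g x) = x" "mul g (mul (invs g) x) = x"
  "mul (mul x g) (invs g) = x" "mul (mul x (invs g)) g = x"
  by (metis G.assoc G.left_inverse G.right_inverse G.left_neutral G.right_neutral)+

lemma invs_smooth: "smooth_map A A invs"
  using lie_group by (simp add: lie_group_def)

definition mul_rep where
  "mul_rep a b e z = snd e (mul (chart_inv a (fst z)) (chart_inv b (snd z)))"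

definition mul_domain where
  "mul_domain a b e = {z. fst z \<in> chart_range a \<and> snd z \<in> chart_range b \<and>
     mul (chart_inv a (fst z)) (chart_inv b (snd z)) \<in> fst e}"

lemma mul_continuous: "continuous_on UNIV (\<lambda>z. mul (fst z) (snd z))"
  using lie_group by (simp add: lie_group_def smooth_map_def case_prod_beta')

lemma
  assumes a: "a \<in> A" and b: "b \<in> A" and e: "e \<in> A"
  shows open_mul_domain: "open (mul_domain a b e)"
    and mul_rep_smooth: "smooth_on (mul_domain a b e) (mul_rep a b e)"
proof -
  have cont: "continuous_on (chart_range a) (chart_inv a)" "continuous_on (chart_range b) (chart_inv b)"
    using chart_homeomorphism[OF a] chart_homeomorphism[OF b] by (simp_all add: homeomorphism_def)
  have "continuous_on (chart_range a \<times> chart_range b)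
      (\<lambda>z. mul (fst (chart_inv a (fst z), chart_inv b (snd z))) (snd (chart_inv a (fst z), chart_inv b (snd z))))"
    by (rule continuous_on_compose2[OF mul_continuous])
      (auto intro!: continuous_on_Pair continuous_on_compose2[OF cont(1)] continuous_on_compose2[OF cont(2)]
        continuous_on_fst continuous_on_snd continuous_on_id)
  from continuous_open_preimage[OF this open_Times[OF open_chart_range[OF a] open_chart_range[OF b]] open_chart[OF e]]
  show "open (mul_domain a b e)"
    by (simp add: mul_domain_def vimage_def Int_def mem_Times_iff conj_assoc)
  define pc where "pc = (fst a \<times> fst b, map_prod (snd a) (snd b))"
  have pc: "pc \<in> product_atlas A A"
    unfolding pc_def product_atlas_def using a b by blast
  have inj: "inj_on (snd pc) (fst pc)"
    unfolding pc_def inj_on_def by (auto, (metis chart_inv_snd a b)+)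
  have inv: "chart_inv pc z = (chart_inv a (fst z), chart_inv b (snd z))"
    if "fst z \<in> chart_range a" "snd z \<in> chart_range b" for z
    unfolding chart_inv_def[of pc]
    using that a b by (intro inv_into_f_eq[OF inj]) (auto simp: pc_def)
  have dom: "snd pc ` (fst pc \<inter> (\<lambda>(g, h). mul g h) -` fst e) = mul_domain a b e" (is "?l = ?r")
  proof
    show "?l \<subseteq> ?r"
      using a b by (auto simp: pc_def mul_domain_def)
    show "?r \<subseteq> ?l"
    proof
      fix z assume "z \<in> ?r"
      then show "z \<in> ?l"
        using a b
        by (intro image_eqI[of _ _ "(chart_inv a (fst z), chart_inv b (snd z))"])
          (auto simp: pc_def mul_domain_def prod_eq_iff)
    qed
  qed
  have "smooth_on (mul_domain a b e) (snd e \<circ> (\<lambda>(g, h). mul g h) \<circ> chart_inv pc)"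
    using lie_group pc e unfolding lie_group_def smooth_map_def dom[symmetric] by blast
  then show "smooth_on (mul_domain a b e) (mul_rep a b e)"
    by (rule smooth_on_cong[OF \<open>open (mul_domain a b e)\<close>])
      (auto simp: mul_domain_def mul_rep_def inv)
qed

lemma smooth_map_const: "smooth_map A A (\<lambda>_. g)"
  unfolding smooth_map_iff chart_rep_def[abs_def] by (auto intro: smooth_on_const)

lemma
  assumes f: "smooth_map A A f" and h: "smooth_map A A h"
  shows smooth_map_mul: "smooth_map A A (\<lambda>x. mul (f x) (h x))"
    and mul_rep_chart_rep: "\<lbrakk>c \<in> A; a \<in> A; b \<in> A; e \<in> A\<rbrakk> \<Longrightarrow>
      u \<in> rep_domain c a f \<inter> rep_domain c b h \<inter> rep_domain c e (\<lambda>x. mul (f x) (h x)) \<Longrightarrow>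
      (chart_rep c a f u, chart_rep c b h u) \<in> mul_domain a b e \<and>
      mul_rep a b e (chart_rep c a f u, chart_rep c b h u) = chart_rep c e (\<lambda>x. mul (f x) (h x)) u"
proof -
  let ?fh = "\<lambda>x. mul (f x) (h x)"
  show eq: "(chart_rep c a f u, chart_rep c b h u) \<in> mul_domain a b e \<and>
      mul_rep a b e (chart_rep c a f u, chart_rep c b h u) = chart_rep c e ?fh u"
    if "c \<in> A" "a \<in> A" "b \<in> A" "e \<in> A"
      "u \<in> rep_domain c a f \<inter> rep_domain c b h \<inter> rep_domain c e ?fh" for a b c e u
    using that by (auto simp: rep_domain_def chart_rep_def mul_rep_def mul_domain_def)
  have "continuous_on UNIV f" "continuous_on UNIV h"
    using f h by (simp_all add: smooth_map_def)
  then have cont: "continuous_on UNIV ?fh"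
    using continuous_on_compose2[OF mul_continuous continuous_on_Pair] by fastforce
  show "smooth_map A A ?fh"
    unfolding smooth_map_iff
  proof (intro conjI ballI cont)
    fix c e assume c: "c \<in> A" and e: "e \<in> A"
    have open_dom: "open (rep_domain c e ?fh)"
      using open_chart_preimage[OF c open_vimage[OF open_chart[OF e] cont]]
      by (simp add: rep_domain_def)
    then show "smooth_on (rep_domain c e ?fh) (chart_rep c e ?fh)"
    proof (rule smooth_on_local)
      fix u assume u: "u \<in> rep_domain c e ?fh"
      define a where "a = chart_at A (f (chart_inv c u))"
      define b where "b = chart_at A (h (chart_inv c u))"
      have a: "a \<in> A" and b: "b \<in> A"
        by (simp_all add: a_def b_def)
      let ?S = "rep_domain c a f \<inter> rep_domain c b h \<inter> rep_domain c e ?fh"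
      have S: "open ?S"
        using open_rep_domain[OF f c a] open_rep_domain[OF h c b] open_dom by blast
      moreover have "u \<in> ?S"
        using u by (auto simp: rep_domain_def a_def b_def)
      moreover have "smooth_on ?S (chart_rep c e ?fh)"
      proof (rule smooth_on_cong[OF S])
        have "smooth_on ?S (chart_rep c a f)" "smooth_on ?S (chart_rep c b h)"
          by (rule smooth_on_subset[OF smooth_map_rep[OF f c a] open_rep_domain[OF f c a] S]
              smooth_on_subset[OF smooth_map_rep[OF h c b] open_rep_domain[OF h c b] S], blast)+
        then show "smooth_on ?S (\<lambda>u. mul_rep a b e (chart_rep c a f u, chart_rep c b h u))"
          using eq[OF c a b e]
          by (intro smooth_on_compose[OF S open_mul_domain[OF a b e] mul_rep_smooth[OF a b e]] smooth_on_Pair[OF S])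
            auto
      qed (use eq[OF c a b e] in blast)
      ultimately show "\<exists>T. open T \<and> u \<in> T \<and> smooth_on T (chart_rep c e ?fh)"
        by blast
    qed
  qed
qed

lemma L_smooth: "smooth_map A A (L g)" and R_smooth: "smooth_map A A (R g)"
  by (intro smooth_map_mul smooth_map_const smooth_map_ident)+

text \<open>With one factor fixed, the multiplication is a translation; this gives its partial derivatives.\<close>

lemma
  assumes a: "a \<in> A" "g \<in> fst a" and b: "b \<in> A" "h \<in> fst b" and e: "e \<in> A" "mul g h \<in> fst e"
  shows mul_rep_has_derivative: "(mul_rep a b e has_derivative
      frechet_derivative (mul_rep a b e) (at (snd a g, snd b h))) (at (snd a g, snd b h))"
    and mul_rep_derivative_left: "frechet_derivative (mul_rep a b e) (at (snd a g, snd b h)) (v, 0)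
      = chart_deriv a e (R h) g v"
    and mul_rep_derivative_right: "frechet_derivative (mul_rep a b e) (at (snd a g, snd b h)) (0, w)
      = chart_deriv b e (L g) h w"
proof -
  let ?D = "frechet_derivative (mul_rep a b e) (at (snd a g, snd b h))"
  show D: "(mul_rep a b e has_derivative ?D) (at (snd a g, snd b h))"
    using a b e by (intro smooth_on_has_derivative[OF open_mul_domain[OF a(1) b(1) e(1)] mul_rep_smooth[OF a(1) b(1) e(1)]])
      (simp add: mul_domain_def)
  have "((\<lambda>u. mul_rep a b e (u, snd b h)) has_derivative (\<lambda>v. ?D (v, 0))) (at (snd a g))"
    using D by (intro has_derivative_compose[where g = "mul_rep a b e", OF has_derivative_Pair[OF has_derivative_ident has_derivative_const]])
  moreover have "(\<lambda>u. mul_rep a b e (u, snd b h)) = chart_rep a e (R h)"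
    using b by (simp add: fun_eq_iff mul_rep_def chart_rep_def)
  ultimately show "?D (v, 0) = chart_deriv a e (R h) g v"
    unfolding chart_deriv_def by (metis frechet_derivative_at)
  have "((\<lambda>u. mul_rep a b e (snd a g, u)) has_derivative (\<lambda>v. ?D (0, v))) (at (snd b h))"
    using D by (intro has_derivative_compose[where g = "mul_rep a b e", OF has_derivative_Pair[OF has_derivative_const has_derivative_ident]])
  moreover have "(\<lambda>u. mul_rep a b e (snd a g, u)) = chart_rep b e (L g)"
    using a by (simp add: fun_eq_iff mul_rep_def chart_rep_def)
  ultimately show "?D (0, w) = chart_deriv b e (L g) h w"
    unfolding chart_deriv_def by (metis frechet_derivative_at)
qed

lemma tangent_map_mul:
  assumes f: "smooth_map A A f" and h: "smooth_map A A h"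
  shows "T (\<lambda>x. mul (f x) (h x)) p v = T (R (h p)) (f p) (T f p v) + T (L (f p)) (h p) (T h p v)"
proof -
  define a b c e where "a = chart_at A (f p)" and "b = chart_at A (h p)" and "c = chart_at A p"
    and "e = chart_at A (mul (f p) (h p))"
  have c: "c \<in> A" "p \<in> fst c" and a: "a \<in> A" "f p \<in> fst a" and b: "b \<in> A" "h p \<in> fst b"
    and e: "e \<in> A" "mul (f p) (h p) \<in> fst e"
    by (simp_all add: a_def b_def c_def e_def)
  let ?S = "rep_domain c a f \<inter> rep_domain c b h \<inter> rep_domain c e (\<lambda>x. mul (f x) (h x))"
  have S: "open ?S" "snd c p \<in> ?S"
    using open_rep_domain[OF f c(1) a(1)] open_rep_domain[OF h c(1) b(1)]
      open_rep_domain[OF smooth_map_mul[OF f h] c(1) e(1)] a b c e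
    by (auto simp: snd_in_rep_domain)
  let ?M = "mul_rep a b e"
  let ?D = "frechet_derivative ?M (at (snd a (f p), snd b (h p)))"
  have at: "(chart_rep c a f (snd c p), chart_rep c b h (snd c p)) = (snd a (f p), snd b (h p))"
    using c by (simp add: chart_rep_def)
  have D: "(?M has_derivative ?D) (at (snd a (f p), snd b (h p)))"
    by (rule mul_rep_has_derivative[OF a b e])
  have "((\<lambda>u. ?M (chart_rep c a f u, chart_rep c b h u)) has_derivative
      (\<lambda>v. ?D (chart_deriv c a f p v, chart_deriv c b h p v))) (at (snd c p))"
    using chart_rep_has_derivative[OF f c(1) a(1) c(2) a(2)] chart_rep_has_derivative[OF h c(1) b(1) c(2) b(2)] D
    by (intro has_derivative_compose[where g = ?M, OF has_derivative_Pair]) (simp_all only: at)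
  then have "(chart_rep c e (\<lambda>x. mul (f x) (h x)) has_derivative
      (\<lambda>v. ?D (chart_deriv c a f p v, chart_deriv c b h p v))) (at (snd c p))"
    by (rule has_derivative_transform_within_open[OF _ S])
      (use mul_rep_chart_rep[OF f h c(1) a(1) b(1) e(1)] in blast)
  then have "chart_deriv c e (\<lambda>x. mul (f x) (h x)) p v = ?D (chart_deriv c a f p v, chart_deriv c b h p v)"
    unfolding chart_deriv_def[of c e] by (rule fun_cong[OF frechet_derivative_at, symmetric])
  also have "\<dots> = ?D (chart_deriv c a f p v, 0) + ?D (0, chart_deriv c b h p v)"
    using linear_add[OF has_derivative_linear[OF D], of "(chart_deriv c a f p v, 0)" "(0, chart_deriv c b h p v)"]
    by simp
  finally show ?thesis
    unfolding mul_rep_derivative_left[OF a b e] mul_rep_derivative_right[OF a b e]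
    by (simp add: tangent_map_eq_chart_deriv a_def b_def c_def e_def)
qed

text \<open>Differentiating \<open>x x\<^sup>-\<^sup>1 = e\<close> at \<open>p\<close> expresses the derivative of the inversion by translations.\<close>

lemma tangent_map_invs: "T invs p v = - T (\<lambda>x. mul (mul (invs p) x) (invs p)) p v"
proof -
  have "T (\<lambda>x. mul x (invs x)) p v = 0"
    by (simp add: tangent_map_def o_def)
  moreover have "T (\<lambda>x. mul x (invs x)) p v = T (R (invs p)) p v + T (L p) (invs p) (T invs p v)"
    using tangent_map_mul[OF smooth_map_ident invs_smooth, of p v] by (simp add: tangent_map_ident)
  ultimately have "T (L p) (invs p) (T invs p v) = - T (R (invs p)) p v"
    by (simp add: eq_neg_iff_add_eq_0 add.commute)
  then have "T (L (invs p)) one (T (L p) (invs p) (T invs p v)) = - T (L (invs p)) one (T (R (invs p)) p v)"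
    by (simp add: linear_neg[OF tangent_map_linear(2)[OF L_smooth]])
  moreover have "T (L (invs p)) one (T (L p) (invs p) w) = w" for w
    using tangent_map_compose[OF L_smooth L_smooth, of "invs p" p "invs p" w] by (simp add: tangent_map_ident)
  moreover have "T (L (invs p)) one (T (R (invs p)) p w) = T (\<lambda>x. mul (mul (invs p) x) (invs p)) p w" for w
    using tangent_map_compose[OF R_smooth L_smooth, of "invs p" "invs p" p w] by (simp add: G.assoc)
  ultimately show ?thesis
    by simp
qed

end


section \<open>The geometric mean of the invariant volume forms\<close>

context lie_group_manifold
begin

abbreviation "Ad' g \<equiv> Ad A mul one invs g"
abbreviation "f\<^sub>0 \<equiv> det_Ad_top A mul one invs"
abbreviation "left \<nu> \<equiv> left_invariant_form A mul invs \<nu>"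

lemma conj_smooth: "smooth_map A A (\<lambda>x. mul (mul g x) h)"
  by (rule smooth_map_compose[OF L_smooth R_smooth])

lemma Ad_linear: "linear (Ad' g)"
  unfolding Ad_def by (rule tangent_map_linear(2)[OF conj_smooth])

lemma f0_eq_det: "f\<^sub>0 g = det (matrix (Ad' g))"
  unfolding det_Ad_top_def Ad_top_def[abs_def] by (rule endo_det_alternating_forms[OF Ad_linear])

lemma f0_scale:
  fixes \<nu> :: "('n \<Rightarrow> real^'n) \<Rightarrow> real"
  assumes "\<nu> \<in> alternating_forms"
  shows "\<nu> (\<lambda>i. Ad' g (v i)) = f\<^sub>0 g * \<nu> v"
  unfolding f0_eq_det by (rule alternating_form_linear_image[OF assms Ad_linear])

lemma f0_mul: "f\<^sub>0 (mul g h) = f\<^sub>0 g * f\<^sub>0 h"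
proof -
  have "Ad' (mul g h) v = Ad' g (Ad' h v)" for v
    using tangent_map_compose[OF conj_smooth[of h "invs h"] conj_smooth[of g "invs g"], of one v]
    unfolding Ad_def by (simp add: G.assoc G.inverse_distrib_swap)
  then have "Ad' (mul g h) = Ad' g \<circ> Ad' h"
    by (simp add: fun_eq_iff)
  then show ?thesis
    unfolding f0_eq_det by (simp add: matrix_compose Ad_linear det_mul)
qed

lemma f0_one: "f\<^sub>0 one = 1"
proof -
  have "Ad' one = id"
    unfolding Ad_def by (simp add: fun_eq_iff tangent_map_ident)
  then show ?thesis
    unfolding f0_eq_det by simp
qed

lemma f0_invs: "f\<^sub>0 g * f\<^sub>0 (invs g) = 1"
  using f0_mul[of g "invs g"] by (simp add: f0_one)

lemma f0_nonzero: "f\<^sub>0 g \<noteq> 0"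
  using f0_invs[of g] by auto

text \<open>Translations of \<open>p\<close> to \<open>e\<close> from the right and from the left differ by \<open>Ad\<^sub>p\<close>. So the left-hand
  side, the right-invariant form with value \<open>\<nu>\<close> at \<open>e\<close>, is \<open>f\<^sub>0 \<nu>\<^sup>l\<close>.\<close>

lemma right_form_eq:
  fixes \<nu> :: "('n \<Rightarrow> real^'n) \<Rightarrow> real"
  assumes "\<nu> \<in> alternating_forms"
  shows "\<nu> (\<lambda>i. T (R (invs p)) p (v i)) = f\<^sub>0 p * left \<nu> p v"
proof -
  have "T (R (invs p)) p w = Ad' p (T (L (invs p)) p w)" for w
    using tangent_map_compose[OF L_smooth[of "invs p"] conj_smooth[of p "invs p"], of p w]
    by (simp add: Ad_def G.assoc)
  then show ?thesis
    unfolding left_invariant_form_def by (simp add: f0_scale[OF assms])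
qed

lemma left_form_L: "left \<nu> (mul g p) (\<lambda>i. T (L g) p (v i)) = left \<nu> p v"
proof -
  have "T (L (invs (mul g p))) (mul g p) (T (L g) p w) = T (L (invs p)) p w" for w
    using tangent_map_compose[OF L_smooth[of g] L_smooth[of "invs (mul g p)"], of p w]
    by (simp add: G.inverse_distrib_swap G.assoc)
  then show ?thesis
    unfolding left_invariant_form_def by simp
qed

text \<open>A right translation by \<open>g\<close> becomes conjugation by \<open>g\<^sup>-\<^sup>1\<close> after translation back to \<open>e\<close>.\<close>

lemma left_form_R:
  fixes \<nu> :: "('n \<Rightarrow> real^'n) \<Rightarrow> real"
  assumes "\<nu> \<in> alternating_forms"
  shows "left \<nu> (mul p g) (\<lambda>i. T (R g) p (v i)) = f\<^sub>0 (invs g) * left \<nu> p v"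
proof -
  have "T (L (invs (mul p g))) (mul p g) (T (R g) p w) = Ad' (invs g) (T (L (invs p)) p w)" for w
    using tangent_map_compose[OF R_smooth[of g] L_smooth[of "invs (mul p g)"], of p w]
      tangent_map_compose[OF L_smooth[of "invs p"] conj_smooth[of "invs g" "invs (invs g)"], of p w]
    by (simp add: Ad_def G.inverse_distrib_swap G.assoc)
  then show ?thesis
    unfolding left_invariant_form_def by (simp add: f0_scale[OF assms])
qed

text \<open>The derivative of the inversion is minus a composition of translations and thus turns the
  left-invariant form into the right-invariant one, up to sign.\<close>

lemma left_form_invs:
  fixes \<nu> :: "('n \<Rightarrow> real^'n) \<Rightarrow> real"
  assumes "\<nu> \<in> alternating_forms"
  shows "left \<nu> (invs p) (\<lambda>i. T invs p (v i)) = (- 1) ^ CARD('n) * f\<^sub>0 p * left \<nu> p v"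
proof -
  have "T (L p) (invs p) (T invs p w) = - T (R (invs p)) p w" for w
    using tangent_map_compose[OF conj_smooth[of "invs p" "invs p"] L_smooth[of p], of p w]
    by (simp add: tangent_map_invs linear_neg[OF tangent_map_linear(2)[OF L_smooth]] G.assoc)
  then have "left \<nu> (invs p) (\<lambda>i. T invs p (v i)) = \<nu> (\<lambda>i. - T (R (invs p)) p (v i))"
    unfolding left_invariant_form_def by simp
  then show ?thesis
    by (simp add: alternating_form_uminus[OF assms] right_form_eq[OF assms])
qed

text \<open>The derivative of \<open>x \<mapsto> p\<^sup>-\<^sup>1 x\<close> at \<open>x = p\<close> is a partial derivative of the
  multiplication at \<open>(p\<^sup>-\<^sup>1, p)\<close>, and thus depends smoothly on \<open>p\<close>.\<close>

lemma translation_derivative_smooth: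
  assumes c: "c \<in> A" and e: "e \<in> A" "one \<in> fst e"
  shows "smooth_on (chart_range c) (\<lambda>q. chart_deriv c e (L (invs (chart_inv c q))) (chart_inv c q) v)" (is "smooth_on _ ?l")
    and "smooth_on (chart_range c) (\<lambda>q. chart_deriv c e (R (invs (chart_inv c q))) (chart_inv c q) v)" (is "smooth_on _ ?r")
proof -
  have nbhd: "\<exists>S. open S \<and> q \<in> S \<and> smooth_on S ?l \<and> smooth_on S ?r" if q: "q \<in> chart_range c" for q
  proof -
    define d where "d = chart_at A (invs (chart_inv c q))"
    have d: "d \<in> A"
      by (simp add: d_def)
    let ?S = "rep_domain c d invs"
    let ?I = "chart_rep c d invs"
    have S: "open ?S"
      by (rule open_rep_domain[OF invs_smooth c d])
    have I: "smooth_on ?S ?I"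
      by (rule smooth_map_rep[OF invs_smooth c d])
    have id: "smooth_on ?S (\<lambda>q. q)"
      by (rule smooth_on_ident[OF S])
    have in_S: "chart_inv c q \<in> fst c" "invs (chart_inv c q) \<in> fst d" "q = snd c (chart_inv c q)" "?I q = snd d (invs (chart_inv c q))"
      if "q \<in> ?S" for q
      using that c d by (auto simp: rep_domain_def chart_rep_def)
    have "q \<in> ?S"
      using q by (simp add: rep_domain_def d_def)
    moreover have "smooth_on ?S ?l"
    proof (rule smooth_on_cong[OF S])
      show "smooth_on ?S (\<lambda>q. frechet_derivative (mul_rep d c e) (at (?I q, q)) (0, v))"
        by (rule smooth_on_compose[OF S open_mul_domain[OF d c e(1)] smooth_on_derivative[OF mul_rep_smooth[OF d c e(1)]]
              smooth_on_Pair[OF S I id]])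
          (auto simp: rep_domain_def chart_rep_def mul_domain_def e c d)
      show "frechet_derivative (mul_rep d c e) (at (?I q, q)) (0, v) = ?l q" if "q \<in> ?S" for q
        using mul_rep_derivative_right[OF d in_S(2)[OF that] c in_S(1)[OF that] e(1), of v]
          in_S(3,4)[OF that] e(2) by simp
    qed
    moreover have "smooth_on ?S ?r"
    proof (rule smooth_on_cong[OF S])
      show "smooth_on ?S (\<lambda>q. frechet_derivative (mul_rep c d e) (at (q, ?I q)) (v, 0))"
        by (rule smooth_on_compose[OF S open_mul_domain[OF c d e(1)] smooth_on_derivative[OF mul_rep_smooth[OF c d e(1)]]
              smooth_on_Pair[OF S id I]])
          (auto simp: rep_domain_def chart_rep_def mul_domain_def e c d)
      show "frechet_derivative (mul_rep c d e) (at (q, ?I q)) (v, 0) = ?r q" if "q \<in> ?S" for q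
        using mul_rep_derivative_left[OF c in_S(1)[OF that] d in_S(2)[OF that] e(1), of v]
          in_S(3,4)[OF that] e(2) by simp
    qed
    ultimately show ?thesis
      using S by blast
  qed
  show "smooth_on (chart_range c) ?l"
    by (rule smooth_on_local[OF open_chart_range[OF c]]) (use nbhd in blast)
  show "smooth_on (chart_range c) ?r"
    by (rule smooth_on_local[OF open_chart_range[OF c]]) (use nbhd in blast)
qed

lemma left_form_in_chart:
  assumes c: "c \<in> A" and q: "q \<in> chart_range c"
  shows "form_in A c (left \<nu>) q v
    = \<nu> (\<lambda>i. chart_deriv c (chart_at A one) (L (invs (chart_inv c q))) (chart_inv c q) (v i))"
proof -
  have "T (L (invs (chart_inv c q))) (chart_inv c q) (from_chart A c (chart_inv c q) w)
      = chart_deriv c (chart_at A one) (L (invs (chart_inv c q))) (chart_inv c q) w" for w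
    using chart_deriv_eq_tangent_map(1)[OF L_smooth c chart_inv_in[OF c q], of "chart_at A one" "invs (chart_inv c q)" w]
    by (simp add: from_chart_self)
  then show ?thesis
    by (simp add: form_in_def left_invariant_form_def)
qed

lemma right_form_in_chart:
  fixes \<nu> :: "('n \<Rightarrow> real^'n) \<Rightarrow> real"
  assumes \<nu>: "\<nu> \<in> alternating_forms" and c: "c \<in> A" and q: "q \<in> chart_range c"
  shows "f\<^sub>0 (chart_inv c q) * form_in A c (left \<nu>) q v
    = \<nu> (\<lambda>i. chart_deriv c (chart_at A one) (R (invs (chart_inv c q))) (chart_inv c q) (v i))"
proof -
  have "T (R (invs (chart_inv c q))) (chart_inv c q) (from_chart A c (chart_inv c q) w)
      = chart_deriv c (chart_at A one) (R (invs (chart_inv c q))) (chart_inv c q) w" for w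
    using chart_deriv_eq_tangent_map(1)[OF R_smooth c chart_inv_in[OF c q], of "chart_at A one" "invs (chart_inv c q)" w]
    by (simp add: from_chart_self)
  then show ?thesis
    by (simp add: form_in_def right_form_eq[OF \<nu>, symmetric])
qed

lemma left_form_volume:
  fixes \<nu> :: "('n \<Rightarrow> real^'n) \<Rightarrow> real"
  assumes \<nu>: "\<nu> \<in> alternating_forms" and "\<nu> \<noteq> 0"
  shows "volume_form A (left \<nu>)"
  unfolding volume_form_def
proof (intro conjI allI ballI)
  fix p
  show "left \<nu> p \<in> alternating_forms"
    unfolding left_invariant_form_def[abs_def]
    by (rule alternating_form_compose_linear[OF \<nu> tangent_map_linear(2)[OF L_smooth]])
  have "T (L (invs p)) p (T (L p) one w) = w" for w
    using tangent_map_compose[OF L_smooth[of p] L_smooth[of "invs p"], of one w] by (simp add: tangent_map_ident)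
  then have restored: "left \<nu> p (\<lambda>i. T (L p) one (v i)) = \<nu> v" for v
    by (simp add: left_invariant_form_def)
  show "left \<nu> p \<noteq> 0"
  proof
    assume "left \<nu> p = 0"
    then have "\<nu> v = 0" for v
      using restored[of v] by simp
    then show False
      using \<open>\<nu> \<noteq> 0\<close> by (simp add: fun_eq_iff)
  qed
next
  fix c v assume c: "c \<in> A"
  note O = open_chart_range[OF c]
  have "smooth_on (chart_range c)
      (\<lambda>q. \<nu> (\<lambda>i. chart_deriv c (chart_at A one) (L (invs (chart_inv c q))) (chart_inv c q) (v i)))"
    by (intro smooth_on_alternating_form[OF \<nu> O] translation_derivative_smooth(1)[OF c]) simp_all
  then show "smooth_on (chart_range c) (\<lambda>q. form_in A c (left \<nu>) q v)"
    by (rule smooth_on_cong[OF O]) (rule left_form_in_chart[OF c, symmetric])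
qed

text \<open>In a chart, \<open>f\<^sub>0\<close> is the coefficient of the right-invariant form divided by that of the
  left-invariant form.\<close>

lemma f0_smooth:
  fixes \<nu> :: "('n \<Rightarrow> real^'n) \<Rightarrow> real"
  assumes \<nu>: "\<nu> \<in> alternating_forms" "\<nu> \<noteq> 0"
  shows "smooth_fun A f\<^sub>0"
  unfolding smooth_fun_def o_def
proof
  fix c assume c: "c \<in> A"
  note O = open_chart_range[OF c]
  let ?e = "\<lambda>i::'n. axis i (1::real)"
  let ?l = "\<lambda>q. form_in A c (left \<nu>) q ?e"
  let ?r = "\<lambda>q. \<nu> (\<lambda>i. chart_deriv c (chart_at A one) (R (invs (chart_inv c q))) (chart_inv c q) (?e i))"
  have nz: "?l q \<noteq> 0" if q: "q \<in> chart_range c" for q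
  proof (rule alternating_form_axis_nonzero[OF form_in_alternating[OF left_form_volume[OF \<nu>] c q]])
    let ?p = "chart_inv c q"
    have restored: "form_in A c (left \<nu>) q (\<lambda>i. to_chart A c ?p (v i)) = left \<nu> ?p v" for v
      unfolding form_in_def by (simp add: to_chart_from_chart(2)[OF c chart_inv_in[OF c q]])
    show "form_in A c (left \<nu>) q \<noteq> 0"
    proof
      assume "form_in A c (left \<nu>) q = 0"
      then have "left \<nu> ?p v = 0" for v
        using restored[of v] by simp
      then have "left \<nu> ?p = 0"
        by (simp add: fun_eq_iff)
      then show False
        using left_form_volume[OF \<nu>] by (simp add: volume_form_def)
    qed
  qed
  have "smooth_on (chart_range c) (\<lambda>q. ?r q * inverse (?l q))"
  proof (intro smooth_on_mult[OF O] smooth_on_inverse[OF O] nz)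
    show "smooth_on (chart_range c) ?r"
      by (intro smooth_on_alternating_form[OF \<nu>(1) O] translation_derivative_smooth(2)[OF c]) simp_all
    show "smooth_on (chart_range c) ?l"
      using left_form_volume[OF \<nu>] c unfolding volume_form_def by blast
  qed
  then show "smooth_on (chart_range c) (\<lambda>q. f\<^sub>0 (chart_inv c q))"
    by (rule smooth_on_cong[OF O]) (simp add: right_form_in_chart[OF \<nu>(1) c, symmetric] nz)
qed

text \<open>\<open>f\<^sub>0\<close> is continuous without zeros and takes the value 1 at \<open>e\<close>, so the intermediate value theorem on
  the connected space \<open>G\<close> excludes negative values.\<close>

lemma f0_pos:
  fixes \<nu> :: "('n \<Rightarrow> real^'n) \<Rightarrow> real"
  assumes \<nu>: "\<nu> \<in> alternating_forms" "\<nu> \<noteq> 0" and conn: "connected (UNIV :: 'm set)"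
  shows "f\<^sub>0 g > 0"
proof (rule ccontr)
  assume "\<not> f\<^sub>0 g > 0"
  then have "f\<^sub>0 g \<le> 0"
    by simp
  have "isCont f\<^sub>0 p" for p
  proof -
    define c where "c = chart_at A p"
    have c: "c \<in> A" "p \<in> fst c"
      by (simp_all add: c_def)
    have "continuous_on (chart_range c) (\<lambda>q. f\<^sub>0 (chart_inv c q))"
      using smooth_onD[OF smooth_fun_rep[OF f0_smooth[OF \<nu>] c(1)], of 0] by simp
    moreover have "continuous_on (fst c) (snd c)"
      using chart_homeomorphism[OF c(1)] by (simp add: homeomorphism_def)
    ultimately have "continuous_on (fst c) (\<lambda>x. f\<^sub>0 (chart_inv c (snd c x)))"
      by (rule continuous_on_compose2) (auto simp: c)
    then have "continuous_on (fst c) f\<^sub>0"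
      by (rule continuous_on_eq) (simp add: c)
    then show ?thesis
      using c open_chart[OF c(1)] by (simp add: continuous_on_eq_continuous_at)
  qed
  then have "connected (range f\<^sub>0)"
    by (intro connected_continuous_image conn) (simp add: continuous_at_imp_continuous_on)
  moreover have "f\<^sub>0 g \<in> range f\<^sub>0" "1 \<in> range f\<^sub>0"
    using f0_one by (auto intro: range_eqI[of _ _ one])
  ultimately have "{f\<^sub>0 g..1} \<subseteq> range f\<^sub>0"
    by (rule connected_contains_Icc)
  then have "0 \<in> range f\<^sub>0"
    using \<open>f\<^sub>0 g \<le> 0\<close> by auto
  then show False
    using f0_nonzero by (metis imageE)
qed

text \<open>The form \<open>\<Phi>\<close> of the theorem. As \<open>f\<^sub>0 \<nu>\<^sup>l\<close> is the right-invariant form \<open>\<nu>\<^sup>r\<close>, it is the geometric mean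
  of \<open>\<nu>\<^sup>l\<close> and \<open>\<nu>\<^sup>r\<close>, hence the symmetry under inversion.\<close>

definition mean_form :: "(('n \<Rightarrow> real^'n) \<Rightarrow> real) \<Rightarrow> ('m, 'n, real^'n) form_field" where
  "mean_form \<nu> = (\<lambda>g v. sqrt (f\<^sub>0 g) * left \<nu> g v)"

lemma mean_form_volume:
  fixes \<nu> :: "('n \<Rightarrow> real^'n) \<Rightarrow> real"
  assumes \<nu>: "\<nu> \<in> alternating_forms" "\<nu> \<noteq> 0" and conn: "connected (UNIV :: 'm set)"
  shows "volume_form A (mean_form \<nu>)"
  unfolding volume_form_def
proof (intro conjI allI ballI)
  note left = left_form_volume[OF \<nu>]
  fix p
  have alt: "left \<nu> p \<in> alternating_forms" and nz: "left \<nu> p \<noteq> 0"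
    using left by (simp_all add: volume_form_def)
  have "linear (\<lambda>x. sqrt (f\<^sub>0 p) * left \<nu> p (v(i := x)))" for v i
    using linear_compose_scale_right[OF alternating_form_linear[OF alt, of v i], of "sqrt (f\<^sub>0 p)"] by simp
  then show "mean_form \<nu> p \<in> alternating_forms"
    using alternating_form_eq_0[OF alt] unfolding alternating_forms_def mean_form_def by auto
  show "mean_form \<nu> p \<noteq> 0"
    using nz f0_pos[OF \<nu> conn, of p] by (auto simp: mean_form_def fun_eq_iff)
next
  fix c v assume c: "c \<in> A"
  note O = open_chart_range[OF c]
  have "smooth_on (chart_range c) (\<lambda>q. sqrt (f\<^sub>0 (chart_inv c q)) * form_in A c (left \<nu>) q v)"
    using left_form_volume[OF \<nu>] c unfolding volume_form_def
    by (intro smooth_on_mult[OF O] smooth_on_sqrt[OF O] smooth_fun_rep[OF f0_smooth[OF \<nu>]] f0_pos[OF \<nu> conn]) auto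
  then show "smooth_on (chart_range c) (\<lambda>q. form_in A c (mean_form \<nu>) q v)"
    by (simp add: form_in_def mean_form_def)
qed

lemma mean_form_L:
  "mean_form \<nu> (mul g p) (\<lambda>i. T (L g) p (v i)) = sqrt (f\<^sub>0 g) * mean_form \<nu> p v"
  by (simp add: mean_form_def left_form_L f0_mul real_sqrt_mult)

lemma mean_form_R:
  fixes \<nu> :: "('n \<Rightarrow> real^'n) \<Rightarrow> real"
  assumes "\<nu> \<in> alternating_forms"
  shows "mean_form \<nu> (mul p g) (\<lambda>i. T (R g) p (v i))
    = sqrt (f\<^sub>0 g) * f\<^sub>0 (invs g) * mean_form \<nu> p v"
  by (simp add: mean_form_def left_form_R[OF assms] f0_mul real_sqrt_mult)

text \<open>The inversion contributes the factor \<open>f\<^sub>0(p)\<close>, and \<open>\<surd>f\<^sub>0(p\<^sup>-\<^sup>1) f\<^sub>0(p) = \<surd>f\<^sub>0(p)\<close>.\<close>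

lemma mean_form_invs:
  fixes \<nu> :: "('n \<Rightarrow> real^'n) \<Rightarrow> real"
  assumes \<nu>: "\<nu> \<in> alternating_forms" "\<nu> \<noteq> 0" and conn: "connected (UNIV :: 'm set)"
  shows "mean_form \<nu> (invs p) (\<lambda>i. T invs p (v i)) = (- 1) ^ CARD('n) * mean_form \<nu> p v"
proof -
  have "f\<^sub>0 p = sqrt (f\<^sub>0 p) * sqrt (f\<^sub>0 p)"
    using f0_pos[OF \<nu> conn, of p] by simp
  then have "sqrt (f\<^sub>0 (invs p)) * f\<^sub>0 p = sqrt (f\<^sub>0 (invs p) * f\<^sub>0 p) * sqrt (f\<^sub>0 p)"
    by (metis mult.assoc real_sqrt_mult)
  also have "\<dots> = sqrt (f\<^sub>0 p)"
    using f0_invs[of p] by (simp add: mult.commute)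
  finally have "sqrt (f\<^sub>0 (invs p)) * f\<^sub>0 p = sqrt (f\<^sub>0 p)" .
  then show ?thesis
    by (simp add: mean_form_def left_form_invs[OF \<nu>(1)] mult.left_commute flip: mult.assoc)
qed

end


section \<open>Poisson-Lie groups\<close>

locale poisson_lie_manifold = lie_group_manifold A mul one invs + bivector_manifold A P
  for A :: "('m::{t2_space, second_countable_topology}, real^'n::finite) atlas"
    and mul one invs P +
  assumes multiplicative: "multiplicative_bivector A mul P"
    and connected: "connected (UNIV :: 'm set)"
    and unimodular: "unimodular (dual_bracket A one P)"
begin

text \<open>The push-forward \<open>\<phi>\<^sub>*P\<close> at the point \<open>\<phi>(p)\<close>. It is indexed by \<open>p\<close>, so that no inverse of \<open>\<phi>\<close> is
  involved.\<close>

definition push :: "('m \<Rightarrow> 'm) \<Rightarrow> 'm \<Rightarrow> (real^'n) dual \<Rightarrow> (real^'n) dual \<Rightarrow> real" where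
  "push \<phi> p \<alpha> \<beta> = P p (pullback_covector (T \<phi> p) \<alpha>) (pullback_covector (T \<phi> p) \<beta>)"

lemma P_mul: "P (mul g h) \<alpha> \<beta> = push (L g) h \<alpha> \<beta> + push (R h) g \<alpha> \<beta>"
  using multiplicative unfolding multiplicative_bivector_def push_def by blast

lemma push_ident: "push (\<lambda>x. x) p \<alpha> \<beta> = P p \<alpha> \<beta>"
proof -
  have "pullback_covector (T (\<lambda>x. x) p) \<gamma> = \<gamma>" for \<gamma>
    by (rule blinfun_eqI) (simp add: tangent_map_linear[OF smooth_map_ident] tangent_map_ident)
  then show ?thesis
    by (simp add: push_def)
qed

lemma push_compose:
  assumes "smooth_map A A \<phi>" "smooth_map A A \<psi>"
  shows "push \<phi> p (pullback_covector (T \<psi> (\<phi> p)) \<alpha>) (pullback_covector (T \<psi> (\<phi> p)) \<beta>)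
    = push (\<lambda>x. \<psi> (\<phi> x)) p \<alpha> \<beta>"
proof -
  have "pullback_covector (T \<phi> p) (pullback_covector (T \<psi> (\<phi> p)) \<gamma>) = pullback_covector (T (\<lambda>x. \<psi> (\<phi> x)) p) \<gamma>" for \<gamma>
    by (rule blinfun_eqI)
      (simp add: tangent_map_linear assms smooth_map_compose tangent_map_compose[OF assms])
  then show ?thesis
    by (simp add: push_def)
qed

lemma P_one: "P one \<alpha> \<beta> = 0"
  using P_mul[of one one \<alpha> \<beta>] by (simp add: push_ident)

text \<open>Both arguments of the bivector change sign, and the two signs cancel.\<close>

lemma push_uminus:
  assumes \<phi>: "smooth_map A A \<phi>" and \<psi>: "smooth_map A A \<psi>" and neg: "\<And>v. T \<psi> p v = - T \<phi> p v"
  shows "push \<psi> p \<alpha> \<beta> = push \<phi> p \<alpha> \<beta>"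
proof -
  have "pullback_covector (T \<psi> p) \<gamma> = - pullback_covector (T \<phi> p) \<gamma>" for \<gamma>
    by (rule blinfun_eqI)
      (simp add: tangent_map_linear \<phi> \<psi> neg blinfun.minus_left blinfun.minus_right)
  moreover have "P p (- a) (- b) = P p a b" for a b
  proof -
    have "linear (P p (- a))" "linear (\<lambda>a. P p a b)"
      using bivector_bilinear by (simp_all add: bilinear_def)
    then show ?thesis
      using linear_neg[of "P p (- a)" b] linear_neg[of "\<lambda>a. P p a b" a] by simp
  qed
  ultimately show ?thesis
    by (simp add: push_def)
qed

text \<open>The inversion is an anti-Poisson map: expand \<open>0 = P(p p\<^sup>-\<^sup>1)\<close> by multiplicativity and translate the
  result to \<open>p\<^sup>-\<^sup>1\<close>, where one term becomes \<open>P(p\<^sup>-\<^sup>1)\<close>. The other is the push-forward under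
  \<open>x \<mapsto> p\<^sup>-\<^sup>1 x p\<^sup>-\<^sup>1\<close>, whose derivative at \<open>p\<close> is minus that of the inversion.\<close>

lemma push_invs: "push invs p \<alpha> \<beta> = - P (invs p) \<alpha> \<beta>"
proof -
  let ?L = "L (invs p)"
  let ?\<alpha> = "pullback_covector (T ?L one) \<alpha>" and ?\<beta> = "pullback_covector (T ?L one) \<beta>"
  have "0 = push (L p) (invs p) ?\<alpha> ?\<beta> + push (R (invs p)) p ?\<alpha> ?\<beta>"
    using P_mul[of p "invs p" ?\<alpha> ?\<beta>] by (simp add: P_one)
  also have "push (L p) (invs p) ?\<alpha> ?\<beta> = P (invs p) \<alpha> \<beta>"
    using push_compose[OF L_smooth[of p] L_smooth[of "invs p"], of "invs p" \<alpha> \<beta>] by (simp add: push_ident)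
  also have "push (R (invs p)) p ?\<alpha> ?\<beta> = push (\<lambda>x. mul (mul (invs p) x) (invs p)) p \<alpha> \<beta>"
    using push_compose[OF R_smooth[of "invs p"] L_smooth[of "invs p"], of p \<alpha> \<beta>] by (simp add: G.assoc)
  also have "\<dots> = push invs p \<alpha> \<beta>"
    by (rule push_uminus[OF conj_smooth invs_smooth tangent_map_invs, symmetric])
  finally show ?thesis
    by simp
qed

abbreviation "\<sigma> g \<equiv> \<lambda>x. mul (mul g (invs x)) g"

lemma \<sigma>_smooth: "smooth_map A A (\<sigma> g)"
  by (rule smooth_map_compose[OF invs_smooth conj_smooth])

lemma \<sigma>_\<sigma>: "\<sigma> g (\<sigma> g x) = x"
  by (simp add: G.inverse_distrib_swap G.assoc)

lemma tangent_map_\<sigma>: "T (\<sigma> g) g v = - v"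
proof -
  have "T (\<sigma> g) g v = T (\<lambda>x. mul (mul g x) g) (invs g) (T invs g v)"
    by (rule tangent_map_compose[OF invs_smooth conj_smooth])
  also have "\<dots> = - T (\<lambda>x. mul (mul g x) g) (invs g) (T (\<lambda>x. mul (mul (invs g) x) (invs g)) g v)"
    by (simp only: tangent_map_invs linear_neg[OF tangent_map_linear(2)[OF conj_smooth]])
  also have "\<dots> = - v"
    using tangent_map_compose[OF conj_smooth[of "invs g" "invs g"] conj_smooth[of g g], of g v]
    by (simp add: G.assoc tangent_map_ident)
  finally show ?thesis .
qed

text \<open>Write \<open>x = g y g\<close>. Expand \<open>P(g \<cdot> y g)\<close> and the push-forward of \<open>P(g \<cdot> y)\<close> under \<open>R\<^sub>g\<close>. Both contain
  the push-forward of \<open>P(g)\<close> under right translation by \<open>y g\<close>. It cancels in the difference, which leaves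
  minus the push-forward of \<open>P(y)\<close> under \<open>z \<mapsto> g z g\<close>. By \<open>push_invs\<close> this is the contribution of \<open>\<sigma>\<close>.\<close>

lemma P_decomposition:
  "P x \<alpha> \<beta> = push (L g) (mul (invs g) x) \<alpha> \<beta> + push (R g) (mul x (invs g)) \<alpha> \<beta> + push (\<sigma> g) (\<sigma> g x) \<alpha> \<beta>"
proof -
  define y where "y = mul (mul (invs g) x) (invs g)"
  have x: "x = mul g (mul y g)" and yg: "mul y g = mul (invs g) x" and gy: "mul g y = mul x (invs g)"
    by (simp_all add: y_def G.assoc)
  let ?\<alpha> = "pullback_covector (T (R g) (mul g y)) \<alpha>" and ?\<beta> = "pullback_covector (T (R g) (mul g y)) \<beta>"
  let ?K = "\<lambda>z. mul (mul g z) g"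
  have 1: "P x \<alpha> \<beta> = push (L g) (mul (invs g) x) \<alpha> \<beta> + push (R (mul y g)) g \<alpha> \<beta>"
    using P_mul[of g "mul y g" \<alpha> \<beta>] by (simp add: x[symmetric]) (simp add: yg)
  have "push (R g) (mul g y) \<alpha> \<beta> = push (L g) y ?\<alpha> ?\<beta> + push (R y) g ?\<alpha> ?\<beta>"
    using P_mul[of g y ?\<alpha> ?\<beta>] by (simp add: push_def)
  also have "push (L g) y ?\<alpha> ?\<beta> = push ?K y \<alpha> \<beta>"
    by (rule push_compose[OF L_smooth R_smooth])
  also have "push (R y) g ?\<alpha> ?\<beta> = push (R (mul y g)) g \<alpha> \<beta>"
    using push_compose[OF R_smooth[of y] R_smooth[of g], of g \<alpha> \<beta>] by (simp add: G.assoc)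
  finally have 2: "push (R g) (mul x (invs g)) \<alpha> \<beta> = push ?K y \<alpha> \<beta> + push (R (mul y g)) g \<alpha> \<beta>"
    by (simp add: gy)
  have "push (\<sigma> g) (invs y) \<alpha> \<beta> = push invs (invs y)
      (pullback_covector (T ?K (invs (invs y))) \<alpha>) (pullback_covector (T ?K (invs (invs y))) \<beta>)"
    by (rule push_compose[OF invs_smooth conj_smooth, symmetric])
  also have "\<dots> = - push ?K y \<alpha> \<beta>"
    by (simp add: push_invs) (simp add: push_def)
  also have "invs y = \<sigma> g x"
    by (simp add: y_def G.inverse_distrib_swap G.assoc)
  finally show ?thesis
    using 1 2 by simp
qed

lemma pushforward_ham_apply:
  assumes "smooth_fun A H" "smooth_map A A \<phi>"
  shows "blinfun_apply \<beta> (T \<phi> p (ham (\<lambda>x. H (\<phi> x)) p)) = push \<phi> p (differential A H (\<phi> p)) \<beta>"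
proof -
  have "blinfun_apply \<beta> (T \<phi> p (ham (\<lambda>x. H (\<phi> x)) p))
      = blinfun_apply (pullback_covector (T \<phi> p) \<beta>) (ham (\<lambda>x. H (\<phi> x)) p)"
    by (simp add: tangent_map_linear assms)
  then show ?thesis
    unfolding ham_apply differential_compose[OF assms] push_def by simp
qed

text \<open>The push-forward under \<open>\<phi>\<close>, with inverse \<open>\<theta>\<close>, of the Hamiltonian field of \<open>H \<circ> \<phi>\<close>; in other
  words, the Hamiltonian field of \<open>H\<close> for the pushed-forward bivector field.\<close>

definition push_ham :: "('m \<Rightarrow> 'm) \<Rightarrow> ('m \<Rightarrow> 'm) \<Rightarrow> ('m \<Rightarrow> real) \<Rightarrow> 'm \<Rightarrow> real^'n" where
  "push_ham \<phi> \<theta> H x = T \<phi> (\<theta> x) (ham (\<lambda>x. H (\<phi> x)) (\<theta> x))"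

lemma push_ham_smooth:
  assumes "smooth_fun A H" "smooth_map A A \<phi>" "smooth_map A A \<theta>" "\<And>x. \<phi> (\<theta> x) = x"
  shows "smooth_vector_field (push_ham \<phi> \<theta> H)"
  unfolding push_ham_def[abs_def]
  by (rule smooth_vector_field_pushforward[OF assms(2-4) ham_smooth[OF smooth_fun_compose[OF assms(1,2)]]])

lemma ham_decomposition:
  assumes H: "smooth_fun A H"
  shows "ham H x = push_ham (L g) (L (invs g)) H x + push_ham (R g) (R (invs g)) H x + push_ham (\<sigma> g) (\<sigma> g) H x"
proof (rule covector_determines_vector)
  fix \<beta> :: "(real^'n) dual"
  show "blinfun_apply \<beta> (ham H x) = blinfun_apply \<beta>
      (push_ham (L g) (L (invs g)) H x + push_ham (R g) (R (invs g)) H x + push_ham (\<sigma> g) (\<sigma> g) H x)"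
    unfolding push_ham_def blinfun.add_right ham_apply P_decomposition[of x _ \<beta> g]
      pushforward_ham_apply[OF H L_smooth] pushforward_ham_apply[OF H R_smooth] pushforward_ham_apply[OF H \<sigma>_smooth]
    by (simp only: mul_cancel \<sigma>_\<sigma>)
qed

context
  fixes \<nu> :: "('n \<Rightarrow> real^'n) \<Rightarrow> real"
  assumes \<nu>: "\<nu> \<in> alternating_forms" "\<nu> \<noteq> 0"
begin

abbreviation "\<Phi> \<equiv> mean_form \<nu>"

lemma \<Phi>_volume: "volume_form A \<Phi>"
  by (rule mean_form_volume[OF \<nu> connected])

text \<open>The constants from the two translations cancel, since \<open>(\<surd>f\<^sub>0(g))\<^sup>2 f\<^sub>0(g\<^sup>-\<^sup>1) = 1\<close>.\<close>

lemma \<Phi>_\<sigma>: "\<Phi> (\<sigma> g p) (\<lambda>i. T (\<sigma> g) p (v i)) = (- 1) ^ CARD('n) * \<Phi> p v"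
proof -
  have "T (\<sigma> g) p w = T (R g) (mul g (invs p)) (T (L g) (invs p) (T invs p w))" for w
    using tangent_map_compose[OF smooth_map_compose[OF invs_smooth L_smooth[of g]] R_smooth[of g], of p w]
      tangent_map_compose[OF invs_smooth L_smooth[of g], of p w] by simp
  then have "\<Phi> (\<sigma> g p) (\<lambda>i. T (\<sigma> g) p (v i))
      = sqrt (f\<^sub>0 g) * f\<^sub>0 (invs g) * (sqrt (f\<^sub>0 g) * ((- 1) ^ CARD('n) * \<Phi> p v))"
    by (simp only: mean_form_R[OF \<nu>(1)] mean_form_L mean_form_invs[OF \<nu> connected])
  also have "\<dots> = (sqrt (f\<^sub>0 g) * sqrt (f\<^sub>0 g)) * f\<^sub>0 (invs g) * ((- 1) ^ CARD('n) * \<Phi> p v)"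
    by (simp only: mult_ac)
  also have "\<dots> = (- 1) ^ CARD('n) * \<Phi> p v"
    using f0_pos[OF \<nu> connected, of g] by (simp add: f0_invs)
  finally show ?thesis .
qed

lemma lie_derivative_push_ham:
  assumes H: "smooth_fun A H" and \<phi>: "smooth_map A A \<phi>" and \<theta>: "smooth_map A A \<theta>"
    and inv: "\<And>x. \<phi> (\<theta> x) = x" "\<And>x. \<theta> (\<phi> x) = x"
    and invariant: "\<And>p v. \<Phi> (\<phi> p) (\<lambda>i. T \<phi> p (v i)) = k * \<Phi> p v"
  shows "lie_derivative A (push_ham \<phi> \<theta> H) \<Phi> (\<phi> p) (\<lambda>i. T \<phi> p (v i))
    = k * lie_derivative A (ham (\<lambda>x. H (\<phi> x))) \<Phi> p v"
proof (rule lie_derivative_natural[where X = "ham (\<lambda>x. H (\<phi> x))" and Y = "push_ham \<phi> \<theta> H"])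
  show "smooth_vector_field (push_ham \<phi> \<theta> H)"
    by (rule push_ham_smooth[OF H \<phi> \<theta> inv(1)])
  show "push_ham \<phi> \<theta> H (\<phi> q) = T \<phi> q (ham (\<lambda>x. H (\<phi> x)) q)" for q
    by (simp add: push_ham_def inv)
qed (rule \<phi> \<Phi>_volume ham_smooth[OF smooth_fun_compose[OF H \<phi>]] invariant)+

lemma lie_derivative_at_one:
  assumes H: "smooth_fun A H"
  shows "lie_derivative A (ham H) \<Phi> one v = 0"
proof (rule lie_derivative_ham_at_zero[OF \<Phi>_volume H P_one])
  fix i
  have "bivector_manifold A P" ..
  from endo_trace_dual_bracket[OF this, of one i] unimodular
  show "(\<Sum>j\<in>UNIV. frechet_derivative (component (chart_at A one) i j) (at (snd (chart_at A one) one)) (axis j 1)) = 0"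
    by (simp add: unimodular_def modular_character_def)
qed

text \<open>The terms of \<open>ham_decomposition\<close> for \<open>L\<^sub>g\<close> and \<open>R\<^sub>g\<close> vanish, being transported from \<open>e\<close>. The term
  for \<open>\<sigma>\<close> gives \<open>H\<close> and \<open>H \<circ> \<sigma>\<close> equal Lie derivatives, while their sum comes from a function that is
  critical at \<open>g\<close>.\<close>

lemma lie_derivative_ham_zero:
  assumes H: "smooth_fun A H"
  shows "lie_derivative A (ham H) \<Phi> g v = 0"
proof -
  let ?lie = "\<lambda>X. lie_derivative A X \<Phi> g v"
  let ?XL = "push_ham (L g) (L (invs g)) H" and ?XR = "push_ham (R g) (R (invs g)) H"
    and ?X\<sigma> = "push_ham (\<sigma> g) (\<sigma> g) H"
  have smooth: "smooth_vector_field ?XL" "smooth_vector_field ?XR" "smooth_vector_field ?X\<sigma>"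
    by (rule push_ham_smooth[OF H L_smooth L_smooth] push_ham_smooth[OF H R_smooth R_smooth]
        push_ham_smooth[OF H \<sigma>_smooth \<sigma>_smooth]; simp add: \<sigma>_\<sigma>)+
  have H\<sigma>: "smooth_fun A (\<lambda>x. H (\<sigma> g x))"
    by (rule smooth_fun_compose[OF H \<sigma>_smooth])
  have L0: "?lie ?XL = 0"
  proof -
    define w where "w i = T (L (invs g)) g (v i)" for i
    have "v = (\<lambda>i. T (L g) one (w i))"
      using tangent_map_compose[OF L_smooth[of "invs g"] L_smooth[of g], of g]
      by (simp add: fun_eq_iff w_def tangent_map_ident)
    then show ?thesis
      using lie_derivative_push_ham[OF H L_smooth[of g] L_smooth[of "invs g"] _ _ mean_form_L, of one w]
        lie_derivative_at_one[OF smooth_fun_compose[OF H L_smooth]] by simp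
  qed
  have R0: "?lie ?XR = 0"
  proof -
    define w where "w i = T (R (invs g)) g (v i)" for i
    have "v = (\<lambda>i. T (R g) one (w i))"
      using tangent_map_compose[OF R_smooth[of "invs g"] R_smooth[of g], of g]
      by (simp add: fun_eq_iff w_def tangent_map_ident)
    then show ?thesis
      using lie_derivative_push_ham[OF H R_smooth[of g] R_smooth[of "invs g"] _ _ mean_form_R[OF \<nu>(1)], of one w]
        lie_derivative_at_one[OF smooth_fun_compose[OF H R_smooth]] by simp
  qed
  \<comment> \<open>\<open>\<sigma>\<close> acts as \<open>-1\<close> on the arguments, and this sign cancels against the constant \<open>(-1)\<^sup>n\<close>.\<close>
  have S: "?lie ?X\<sigma> = ?lie (ham (\<lambda>x. H (\<sigma> g x)))"
  proof -
    have "lie_derivative A ?X\<sigma> \<Phi> g (\<lambda>i. - v i) = (- 1) ^ CARD('n) * ?lie (ham (\<lambda>x. H (\<sigma> g x)))"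
      using lie_derivative_push_ham[OF H \<sigma>_smooth \<sigma>_smooth \<sigma>_\<sigma> \<sigma>_\<sigma> \<Phi>_\<sigma>, of g g v]
      by (simp add: tangent_map_\<sigma>)
    then show ?thesis
      by (simp add: lie_derivative_uminus_args[OF \<Phi>_volume smooth(3)])
  qed
  have "ham H = (\<lambda>x. (?XL x + ?XR x) + ?X\<sigma> x)"
    using ham_decomposition[OF H] by (rule ext)
  moreover have "smooth_vector_field (\<lambda>x. ?XL x + ?XR x)"
    by (rule smooth_vector_field_add[OF smooth(1,2)])
  ultimately have "?lie (ham H) = ?lie ?XL + ?lie ?XR + ?lie ?X\<sigma>"
    using lie_derivative_add[OF \<Phi>_volume _ smooth(3)] lie_derivative_add[OF \<Phi>_volume smooth(1,2)]
    by simp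
  then have eq: "?lie (ham H) = ?lie (ham (\<lambda>x. H (\<sigma> g x)))"
    by (simp add: L0 R0 S)
  have "differential A (\<lambda>x. H x + H (\<sigma> g x)) g = 0"
  proof (rule blinfun_eqI)
    fix w
    show "blinfun_apply (differential A (\<lambda>x. H x + H (\<sigma> g x)) g) w = blinfun_apply 0 w"
      unfolding differential_add[OF H H\<sigma>] differential_compose[OF H \<sigma>_smooth] plus_blinfun.rep_eq
        pullback_covector_apply[OF tangent_map_linear(1)[OF \<sigma>_smooth]] tangent_map_\<sigma>
      by (simp add: blinfun.minus_right)
  qed
  then have "?lie (ham (\<lambda>x. H x + H (\<sigma> g x))) = 0"
    by (rule lie_derivative_ham_critical[OF \<Phi>_volume smooth_fun_add[OF H H\<sigma>]])
  moreover have "ham (\<lambda>x. H x + H (\<sigma> g x)) = (\<lambda>x. ham H x + ham (\<lambda>x. H (\<sigma> g x)) x)"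
    by (rule ext) (rule ham_add[OF H H\<sigma>])
  ultimately have "?lie (ham H) + ?lie (ham (\<lambda>x. H (\<sigma> g x))) = 0"
    by (simp add: lie_derivative_add[OF \<Phi>_volume ham_smooth[OF H] ham_smooth[OF H\<sigma>]])
  then show ?thesis
    using eq by simp
qed

end

end

theorem corollary3p4:
  fixes A :: "('g::{t2_space, second_countable_topology}, real^'n) atlas"
    and mul :: "'g \<Rightarrow> 'g \<Rightarrow> 'g" and one :: 'g and invs :: "'g \<Rightarrow> 'g"
    and P :: "('g, real^'n) bivector_field"
    and \<nu> :: "('n::finite \<Rightarrow> real^'n) \<Rightarrow> real"
  assumes "poisson_lie_group A mul one invs P"
    and "connected (UNIV :: 'g set)"
    and "unimodular (dual_bracket A one P)"
    and "\<nu> \<in> alternating_forms" and "\<nu> \<noteq> 0"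
  shows "let f\<^sub>0 = det_Ad_top A mul one invs;
             \<Phi> = (\<lambda>g v. sqrt (f\<^sub>0 g) * left_invariant_form A mul invs \<nu> g v)
         in volume_form A \<Phi> \<and>
            (\<forall>H. smooth_fun A H \<longrightarrow>
              (\<forall>g v. lie_derivative A (hamiltonian_vector_field A P H) \<Phi> g v = 0))"
proof -
  interpret poisson_lie_manifold A mul one invs P
    using assms(1-3) unfolding poisson_lie_group_def poisson_structure_def
    by unfold_locales (auto simp: lie_group_def)
  show ?thesis
    unfolding Let_def mean_form_def[symmetric]
    using \<Phi>_volume[OF assms(4,5)] lie_derivative_ham_zero[OF assms(4,5)] by blast
qed

end
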